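(* Let $p$ be an odd prime and let $\zeta_p$ be the Kubota--Leopoldt $p$-adic $L$-function, i.e. the unique pseudo-measure on $\mathbf{Z}_p^\times$ with $\int_{\mathbf{Z}_p^\times}x^k\cdot\zeta_p=(1-p^{k-1})\zeta(1-k)$ for all integers $k>0$. Let $\chi$ be a primitive Dirichlet character of conductor $p^n$ for some integer $n\ge 1$, seen as a locally constant character of $\mathbf{Z}_p^\times$. Then, for all integers $k>0$, $$\int_{\mathbf{Z}_p^\times}\chi(x)x^k\cdot\zeta_p = L(\chi,1-k).$$
   Context: Fix embeddings of $\overline{\mathbf{Q}}$ into $\mathbf{C}$ and into $\mathbf{C}_p$; values of Dirichlet characters and the algebraic numbers $L(\chi,1-k)$ are viewed in $\mathbf{C}_p$ via these. $L(\chi,s)$ is the (analytically continued) Dirichlet $L$-function. A Dirichlet character $\chi$ of conductor $p^n$ is viewed as a character of $\mathbf{Z}_p^\times$ through $\mathbf{Z}_p^\times\to(\mathbf{Z}/p^n\mathbf{Z})^\times$. $\Lambda(\mathbf{Z}_p^\times)=\varprojlim_n \mathcal{O}_L[(\mathbf{Z}/p^n\mathbf{Z})^\times]$, with $L/\mathbf{Q}_p$ a fixed finite extension, is identified with the algebra (under convolution) of $\mathcal{O}_L$-valued measures on $\mathbf{Z}_p^\times$, i.e. continuous linear functionals $\phi\mapsto \int\phi\cdot\mu$ on continuous functions; $[g]$ is the Dirac measure at $g$. Let $Q(\mathbf{Z}_p^\times)$ be its total ring of fractions. A pseudo-measure on $\mathbf{Z}_p^\times$ is $\lambda\in Q(\mathbf{Z}_p^\times)$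 with $([g]-[1])\lambda\in\Lambda(\mathbf{Z}_p^\times)$ for all $g\in\mathbf{Z}_p^\times$. For a non-trivial continuous character $\kappa:\mathbf{Z}_p^\times\to\mathbf{C}_p^\times$, $\int\kappa\cdot\lambda:=(\kappa(g)-1)^{-1}\int\kappa\cdot([g]-[1])\lambda$ for any $g$ with $\kappa(g)\neq1$ (independent of $g$). It is known that a pseudo-measure $\zeta_p$ with the stated interpolation property exists and is unique. *)

theory Defs
  imports
    "HOL-Complex_Analysis.Complex_Analysis"
    "HOL-Algebra.Algebraic_Closure_Type"
    "HOL-Number_Theory.Cong"
begin

section \<open>Dirichlet characters and their complex L-functions\<close>

definition dirichlet_character :: "nat \<Rightarrow> (nat \<Rightarrow> complex) \<Rightarrow> bool" where
  "dirichlet_character m chi \<longleftrightarrow>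
     m > 0 \<and> (\<forall>a b. chi (a * b) = chi a * chi b) \<and> (\<forall>a. chi (a + m) = chi a) \<and>
     (\<forall>a. chi a = 0 \<longleftrightarrow> \<not> coprime a m)"

definition dirichlet_conductor :: "nat \<Rightarrow> (nat \<Rightarrow> complex) \<Rightarrow> nat" where
  "dirichlet_conductor m chi =
     (LEAST d. d > 0 \<and> d dvd m \<and> (\<forall>a. coprime a m \<and> [a = 1] (mod d) \<longrightarrow> chi a = 1))"

definition primitive_character :: "nat \<Rightarrow> (nat \<Rightarrow> complex) \<Rightarrow> bool" where
  "primitive_character m chi \<longleftrightarrow> dirichlet_character m chi \<and> dirichlet_conductor m chi = m"

text \<open>
  The value at \<open>s\<close> of the analytic continuation of the Dirichlet series along any domain \<open>A\<close>
  that contains both the half plane \<open>Re w > 1\<close> and \<open>s\<close>.  The value does not depend on \<open>A\<close>, because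
  the L-function continues to the whole plane with at most a pole at \<open>1\<close>; at such a pole the value
  is unspecified.
\<close>

definition dirichlet_L :: "(nat \<Rightarrow> complex) \<Rightarrow> complex \<Rightarrow> complex" where
  "dirichlet_L chi s = (THE z. \<exists>A f. open A \<and> connected A \<and> {w. Re w > 1} \<subseteq> A \<and> s \<in> A \<and>
     f holomorphic_on A \<and>
     (\<forall>w. Re w > 1 \<longrightarrow> (\<lambda>m. chi (Suc m) / of_nat (Suc m) powr w) sums f w) \<and>
     z = f s)"

definition riemann_zeta :: "complex \<Rightarrow> complex" where
  "riemann_zeta = dirichlet_L (\<lambda>_. 1)"


section \<open>The field of complex p-adic numbers\<close>

definition padic_abs :: "'c::{zero, metric_space} \<Rightarrow> real" where
  "padic_abs x = dist x 0"

definition padic_integers :: "'c::{ring_1, topological_space} set" where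
  "padic_integers = closure \<int>"

definition padic_numbers :: "'c::{field_char_0, topological_space} set" where
  "padic_numbers = closure \<rat>"

definition padic_units :: "'c::{ring_1, topological_space} set" where
  "padic_units = {x \<in> padic_integers. \<exists>y \<in> padic_integers. x * y = 1}"

text \<open>
  \<open>'c\<close> is a completion of an algebraic closure of \<open>Q\<^sub>p\<close>, with the absolute value normalised by
  \<open>\<bar>p\<bar> = 1/p\<close>.  Completeness and algebraic closedness are in the sort.  The closure of the rationals
  in \<open>'c\<close> is then \<open>Q\<^sub>p\<close>, its algebraic elements form an algebraic closure of \<open>Q\<^sub>p\<close>, and these are
  required to be dense.  This determines \<open>'c\<close> up to isometric isomorphism.
\<close>

definition is_complex_padic_field ::
    "nat \<Rightarrow> 'c::{alg_closed_field, field_char_0, complete_space} itself \<Rightarrow> bool" where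
  "is_complex_padic_field p (_ :: 'c itself) \<longleftrightarrow>
     Factorial_Ring.prime p \<and>
     (\<forall>x y :: 'c. dist x y = padic_abs (x - y)) \<and>
     (\<forall>x y :: 'c. padic_abs (x * y) = padic_abs x * padic_abs y) \<and>
     (\<forall>x y :: 'c. padic_abs (x + y) \<le> max (padic_abs x) (padic_abs y)) \<and>
     padic_abs (of_nat p :: 'c) = 1 / real p \<and>
     closure {x :: 'c. ring.algebraic ring_of_type_algebra padic_numbers x} = UNIV"

definition finite_padic_extension ::
    "'c::{alg_closed_field, field_char_0, complete_space} set \<Rightarrow> bool" where
  "finite_padic_extension L \<longleftrightarrow>
     subfield L ring_of_type_algebra \<and> padic_numbers \<subseteq> L \<and>
     ring.finite_dimension ring_of_type_algebra padic_numbers L"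

definition valuation_ring :: "'c::{zero, metric_space} set \<Rightarrow> 'c set" where
  "valuation_ring L = {x \<in> L. padic_abs x \<le> 1}"

text \<open>The reduction map \<open>Z\<^sub>p \<rightarrow> Z/p\<^sup>n\<close>, with residues represented in \<open>{0..<p\<^sup>n}\<close>.\<close>

definition padic_residue :: "nat \<Rightarrow> nat \<Rightarrow> 'c::{ring_1, topological_space} \<Rightarrow> nat" where
  "padic_residue p n x =
     (THE a. a < p ^ n \<and> (\<exists>z \<in> padic_integers. x - of_nat a = of_nat (p ^ n) * z))"


section \<open>Values of Dirichlet characters and L-functions in the complex p-adic numbers\<close>

definition field_embedding :: "('a::field \<Rightarrow> 'b::field) \<Rightarrow> bool" where
  "field_embedding \<iota> \<longleftrightarrow> \<iota> \<in> ring_hom ring_of_type_algebra ring_of_type_algebra"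

text \<open>Only meaningful for algebraic complex numbers, i.e. those in the range of \<open>\<iota>\<^sub>C\<close>.\<close>

definition complex_to_padic ::
    "(rat alg_closure \<Rightarrow> complex) \<Rightarrow> (rat alg_closure \<Rightarrow> 'c) \<Rightarrow> complex \<Rightarrow> 'c" where
  "complex_to_padic \<iota>\<^sub>C \<iota>\<^sub>p z = \<iota>\<^sub>p (inv_into UNIV \<iota>\<^sub>C z)"

definition padic_character ::
    "(rat alg_closure \<Rightarrow> complex) \<Rightarrow> (rat alg_closure \<Rightarrow> 'c) \<Rightarrow> nat \<Rightarrow> nat \<Rightarrow> (nat \<Rightarrow> complex)
      \<Rightarrow> 'c::{ring_1, topological_space} \<Rightarrow> 'c" where
  "padic_character \<iota>\<^sub>C \<iota>\<^sub>p p n chi x = complex_to_padic \<iota>\<^sub>C \<iota>\<^sub>p (chi (padic_residue p n x))"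


section \<open>Total ring of fractions\<close>

definition regular_elements :: "('a, 'm) ring_scheme \<Rightarrow> 'a set" where
  "regular_elements R =
     {s \<in> carrier R. \<forall>a \<in> carrier R. a \<otimes>\<^bsub>R\<^esub> s = \<zero>\<^bsub>R\<^esub> \<longrightarrow> a = \<zero>\<^bsub>R\<^esub>}"

definition fraction_rel :: "('a, 'm) ring_scheme \<Rightarrow> (('a \<times> 'a) \<times> ('a \<times> 'a)) set" where
  "fraction_rel R = {((a, s), (b, t)). a \<in> carrier R \<and> s \<in> regular_elements R \<and>
     b \<in> carrier R \<and> t \<in> regular_elements R \<and> a \<otimes>\<^bsub>R\<^esub> t = b \<otimes>\<^bsub>R\<^esub> s}"

definition fraction :: "('a, 'm) ring_scheme \<Rightarrow> 'a \<Rightarrow> 'a \<Rightarrow> ('a \<times> 'a) set" where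
  "fraction R a s = fraction_rel R `` {(a, s)}"

definition total_fractions :: "('a, 'm) ring_scheme \<Rightarrow> ('a \<times> 'a) set ring" where
  "total_fractions R = \<lparr>
     carrier = (carrier R \<times> regular_elements R) // fraction_rel R,
     monoid.mult = (\<lambda>U V. \<Union>(a, s) \<in> U. \<Union>(b, t) \<in> V. fraction R (a \<otimes>\<^bsub>R\<^esub> b) (s \<otimes>\<^bsub>R\<^esub> t)),
     one = fraction R \<one>\<^bsub>R\<^esub> \<one>\<^bsub>R\<^esub>,
     ring.zero = fraction R \<zero>\<^bsub>R\<^esub> \<one>\<^bsub>R\<^esub>,
     add = (\<lambda>U V. \<Union>(a, s) \<in> U. \<Union>(b, t) \<in> V.
       fraction R (a \<otimes>\<^bsub>R\<^esub> t \<oplus>\<^bsub>R\<^esub> b \<otimes>\<^bsub>R\<^esub> s) (s \<otimes>\<^bsub>R\<^esub> t)) \<rparr>"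

definition to_fractions :: "('a, 'm) ring_scheme \<Rightarrow> 'a \<Rightarrow> ('a \<times> 'a) set" where
  "to_fractions R a = fraction R a \<one>\<^bsub>R\<^esub>"


section \<open>Measures and pseudo-measures on the p-adic units\<close>

text \<open>Representatives of \<open>(Z/m)\<^sup>\<times>\<close>; for \<open>m = 1\<close> this is \<open>{0}\<close>.\<close>

definition unit_residues :: "nat \<Rightarrow> nat set" where
  "unit_residues m = {a. a < m \<and> coprime a m}"

text \<open>
  The inverse limit of the group rings \<open>O\<^sub>L[(Z/p\<^sup>n)\<^sup>\<times>]\<close>: \<open>\<mu> n a\<close> is the coefficient at \<open>a\<close> of the
  \<open>n\<close>-th component of \<open>\<mu>\<close> (equivalently, the mass of the residue class of \<open>a\<close> modulo \<open>p\<^sup>n\<close>), and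
  is set to zero for \<open>a\<close> outside the representatives.
\<close>

definition iwasawa_algebra :: "nat \<Rightarrow> 'c::{comm_ring_1, metric_space} set \<Rightarrow> (nat \<Rightarrow> nat \<Rightarrow> 'c) ring" where
  "iwasawa_algebra p L = \<lparr>
     carrier = {\<mu>. \<forall>n.
       (\<forall>a \<in> unit_residues (p ^ n). \<mu> n a \<in> valuation_ring L) \<and>
       (\<forall>a. a \<notin> unit_residues (p ^ n) \<longrightarrow> \<mu> n a = 0) \<and>
       (\<forall>a \<in> unit_residues (p ^ n).
          \<mu> n a = (\<Sum>b | b \<in> unit_residues (p ^ Suc n) \<and> b mod p ^ n = a. \<mu> (Suc n) b))},
     monoid.mult = (\<lambda>\<mu> \<nu> n c.
       \<Sum>(a, b) | a \<in> unit_residues (p ^ n) \<and> b \<in> unit_residues (p ^ n) \<and> a * b mod p ^ n = c.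
         \<mu> n a * \<nu> n b),
     one = (\<lambda>n a. if a = 1 mod p ^ n then 1 else 0),
     ring.zero = (\<lambda>n a. 0),
     add = (\<lambda>\<mu> \<nu> n a. \<mu> n a + \<nu> n a) \<rparr>"

definition dirac :: "nat \<Rightarrow> 'c::{ring_1, topological_space} \<Rightarrow> nat \<Rightarrow> nat \<Rightarrow> 'c" where
  "dirac p g n a = (if a = padic_residue p n g then 1 else 0)"

text \<open>The integral of a continuous function against a measure, as a limit of Riemann sums.\<close>

definition measure_integral ::
    "nat \<Rightarrow> ('c \<Rightarrow> 'c) \<Rightarrow> (nat \<Rightarrow> nat \<Rightarrow> 'c) \<Rightarrow> 'c::{comm_ring_1, metric_space}" where
  "measure_integral p \<phi> \<mu> =
     lim (\<lambda>n. \<Sum>a \<in> unit_residues (p ^ n). \<phi> (of_nat a) * \<mu> n a)"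

text \<open>The product \<open>([g] - [1])q\<close> in the total ring of fractions.\<close>

definition dirac_diff_mult ::
    "nat \<Rightarrow> 'c set \<Rightarrow> 'c \<Rightarrow> ((nat \<Rightarrow> nat \<Rightarrow> 'c) \<times> (nat \<Rightarrow> nat \<Rightarrow> 'c)) set \<Rightarrow>
      ((nat \<Rightarrow> nat \<Rightarrow> 'c::{comm_ring_1, metric_space}) \<times> (nat \<Rightarrow> nat \<Rightarrow> 'c)) set" where
  "dirac_diff_mult p L g q =
     (let \<Lambda> = iwasawa_algebra p L
      in to_fractions \<Lambda> (dirac p g \<ominus>\<^bsub>\<Lambda>\<^esub> dirac p 1) \<otimes>\<^bsub>total_fractions \<Lambda>\<^esub> q)"

definition pseudo_measure ::
    "nat \<Rightarrow> 'c::{comm_ring_1, metric_space} set \<Rightarrow>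
      ((nat \<Rightarrow> nat \<Rightarrow> 'c) \<times> (nat \<Rightarrow> nat \<Rightarrow> 'c)) set \<Rightarrow> bool" where
  "pseudo_measure p L q \<longleftrightarrow>
     q \<in> carrier (total_fractions (iwasawa_algebra p L)) \<and>
     (\<forall>g \<in> padic_units. dirac_diff_mult p L g q
        \<in> to_fractions (iwasawa_algebra p L) ` carrier (iwasawa_algebra p L))"

text \<open>
  For a non-trivial continuous character \<open>\<kappa>\<close>, the common value of
  \<open>(\<kappa>(g) - 1)\<^sup>-\<^sup>1 \<integral>\<kappa>\<cdot>([g] - [1])q\<close> over all \<open>g\<close> with \<open>\<kappa>(g) \<noteq> 1\<close>.
\<close>

definition pseudo_measure_integral ::
    "nat \<Rightarrow> 'c::{field, metric_space} set \<Rightarrow> ('c \<Rightarrow> 'c) \<Rightarrow>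
      ((nat \<Rightarrow> nat \<Rightarrow> 'c) \<times> (nat \<Rightarrow> nat \<Rightarrow> 'c)) set \<Rightarrow> 'c" where
  "pseudo_measure_integral p L \<kappa> q =
     (THE z. \<exists>g \<in> padic_units. \<kappa> g \<noteq> 1 \<and>
        (\<exists>\<mu> \<in> carrier (iwasawa_algebra p L).
           dirac_diff_mult p L g q = to_fractions (iwasawa_algebra p L) \<mu> \<and>
           z = inverse (\<kappa> g - 1) * measure_integral p \<kappa> \<mu>))"

definition is_kubota_leopoldt ::
    "(rat alg_closure \<Rightarrow> complex) \<Rightarrow> (rat alg_closure \<Rightarrow> 'c) \<Rightarrow> nat \<Rightarrow> 'c::{field, metric_space} set \<Rightarrow>
      ((nat \<Rightarrow> nat \<Rightarrow> 'c) \<times> (nat \<Rightarrow> nat \<Rightarrow> 'c)) set \<Rightarrow> bool" where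
  "is_kubota_leopoldt \<iota>\<^sub>C \<iota>\<^sub>p p L \<zeta>\<^sub>p \<longleftrightarrow>
     pseudo_measure p L \<zeta>\<^sub>p \<and>
     (\<forall>k::nat. k > 0 \<longrightarrow>
        pseudo_measure_integral p L (\<lambda>x. x ^ k) \<zeta>\<^sub>p =
        complex_to_padic \<iota>\<^sub>C \<iota>\<^sub>p ((1 - of_nat p ^ (k - 1)) * riemann_zeta (1 - of_nat k)))"

end

(*
  Let g = 1 + p^n and let [g] be its Dirac measure. The function (1 - chi(g) g^(1-s)) L(chi,s) is the
  Dirichlet series of a periodic sequence whose sums over arithmetic progressions of step p^n and
  length g vanish. A finite Euler summation in steps of p^n therefore continues it to the whole
  plane, and at s = 1-k it leaves a finite sum S(chi(x) x^(k-1)), where S is linear in the summand and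
  its only denominators are powers of g. The same applies to (1 - p^(-s)) (1 - g^(1-s)) zeta(s), so
  the interpolation property of zeta_p says that the measure ([g] - [1]) zeta_p has the moments
  -S(1_{p does not divide x} x^(k-1)) for all k > 0. As g is a p-adic unit, S is bounded for the
  p-adic supremum norm, and so is integration against a measure. By Mahler's argument chi is a uniform
  limit of polynomials on the natural numbers, hence the two functionals also agree on chi(x) x^k.
*)

theory Submission
  imports Defs "HOL-Number_Theory.Residues"
begin

section \<open>Euler summation\<close>

text \<open>The pseudo-measure is known only through its moments, and the polynomials that
  approximate chi may have coefficients of large p-adic size. Comparing moments term by term is
  therefore useless unless both sides are bounded by the values of the integrand and not by its
  coefficients. Formulas for L(chi,1-k) through Bernoulli numbers hide this bound; the finite sum S
  displays it. The choice g = 1 + p^n serves three ends: chi(g) = 1, so that chi(x) x^k and x^k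
  acquire the same factor 1 - g^k; this factor is not 0; and g is prime to p, so dividing by it
  costs nothing. The number J of summation steps must exceed k, but beyond that the value does not
  depend on it, so one J larger than the degree of a polynomial gives one functional for all its
  monomials. The exponents differ by one, k under the integral and k - 1 under S; a polynomial in
  place of chi(x) x^(k-1) is thus integrated after multiplication by x, and only moments with k > 0
  occur. Values move between C and C_p because S is a finite expression in roots of unity, formed in
  the algebraic closure of Q.\<close>

definition stride_sum :: "nat \<Rightarrow> nat \<Rightarrow> (nat \<Rightarrow> 'a::comm_monoid_add) \<Rightarrow> nat \<Rightarrow> 'a" where
  "stride_sum q g f m = (\<Sum>i<g. f (m + q * i))"

definition ramp_sum :: "nat \<Rightarrow> nat \<Rightarrow> (nat \<Rightarrow> 'a::comm_monoid_add) \<Rightarrow> nat \<Rightarrow> 'a" where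
  "ramp_sum q g f m = (\<Sum>i<g. \<Sum>l<i. f (m + q * l))"

text \<open>
  With \<open>E\<close> the shift by \<open>q\<close> one has \<open>g = \<Phi>(E) + (1 - E)R(E)\<close>, where \<open>\<Phi>(E) = 1 + E + \<dots> + E\<^sup>g\<^sup>-\<^sup>1\<close> is
  \<open>stride_sum\<close> and \<open>R(E)\<close> is \<open>ramp_sum\<close>.  Iterating this \<open>J\<close> times turns \<open>\<Sum>f\<close> into \<open>euler_sum q g J f\<close>
  plus \<open>g\<^sup>-\<^sup>J \<Sum>\<Phi>(E)\<^sup>J f\<close>.
\<close>

definition euler_sum :: "nat \<Rightarrow> nat \<Rightarrow> nat \<Rightarrow> (nat \<Rightarrow> 'a::field) \<Rightarrow> 'a" where
  "euler_sum q g J f =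
     (\<Sum>i<J. (\<Sum>a<q. ramp_sum q g ((stride_sum q g ^^ i) f) a) / of_nat g ^ Suc i)"

text \<open>The coefficients of the Dirichlet series \<open>(1 - g\<^sup>1\<^sup>-\<^sup>s)\<zeta>(s)\<close>.\<close>

definition smoothing :: "nat \<Rightarrow> nat \<Rightarrow> 'a::ring_1" where
  "smoothing g n = (if g dvd n then 1 - of_nat g else 1)"

definition step_diff :: "nat \<Rightarrow> (nat \<Rightarrow> 'a::minus) \<Rightarrow> nat \<Rightarrow> 'a" where
  "step_diff q f m = f (m + q) - f m"

section \<open>Identities and bounds for the shift by \<open>q\<close>\<close>

text \<open>Sum (1 - E)(1 + E + ... + E^(i-1)) = 1 - E^i over i < g, where E is the shift by
  \<open>q\<close>.\<close>

lemma stride_sum_ramp_sum: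
  fixes f :: "nat \<Rightarrow> 'a::comm_ring_1"
  shows "of_nat g * f m = stride_sum q g f m + (ramp_sum q g f m - ramp_sum q g f (m + q))"
proof -
  have tele: "(\<Sum>l<i. f (m + q * l)) - (\<Sum>l<i. f (m + q + q * l)) = f m - f (m + q * i)" for i
  proof -
    have "(\<Sum>l<i. f (m + q * l)) - (\<Sum>l<i. f (m + q + q * l))
        = - (\<Sum>l<i. f (m + q * Suc l) - f (m + q * l))"
      by (simp add: sum_subtractf algebra_simps)
    also have "\<dots> = f m - f (m + q * i)"
      by (subst sum_lessThan_telescope) simp
    finally show ?thesis .
  qed
  have "ramp_sum q g f m - ramp_sum q g f (m + q) = (\<Sum>i<g. f m - f (m + q * i))"
    unfolding ramp_sum_def by (simp only: sum_subtractf [symmetric] tele[symmetric])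
  then show ?thesis
    by (simp add: stride_sum_def sum_subtractf)
qed

text \<open>As \<open>q\<close> is invertible modulo \<open>g\<close>, exactly one of
  \<open>g\<close> consecutive terms of a progression of step \<open>q\<close> is divisible by
  \<open>g\<close>. It contributes 1 - g against g - 1 ones, while \<open>c\<close> is constant
  along the progression.\<close>

lemma stride_sum_smoothing:
  fixes c :: "nat \<Rightarrow> 'a::comm_ring_1"
  assumes "coprime g q" and "g > 0" and per: "\<And>a. c (a + q) = c a"
  shows "stride_sum q g (\<lambda>m. smoothing g (Suc m) * c (Suc m)) m = 0"
proof -
  have per': "c (a + q * i) = c a" for a i
  proof (induction i)
    case (Suc i)
    then show ?case using per[of "a + q * i"] by (simp add: algebra_simps)
  qed simp
  have "\<exists>!i. i < g \<and> [Suc m + q * i = 0] (mod g)"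
  proof -
    obtain y where y: "[q * y = 1] (mod g)"
      using cong_solve_coprime_nat[of q g] assms(1) by (auto simp: coprime_commute)
    \<comment> \<open>\<open>y\<close> inverts \<open>q\<close> modulo \<open>g\<close>, and
      \<open>g - 1\<close> plays the part of -1 in the natural numbers: \<open>i\<close> is -(m +
      1)/q reduced modulo \<open>g\<close>.\<close>
    define i where "i = (y * (g - 1) * Suc m) mod g"
    have "[Suc m + q * i = 0] (mod g)"
    proof -
      have "[q * i = q * (y * (g - 1) * Suc m)] (mod g)"
        unfolding i_def by (intro cong_mult cong_refl) (simp add: cong_def)
      also have "q * (y * (g - 1) * Suc m) = (q * y) * ((g - 1) * Suc m)"
        by (simp add: algebra_simps)
      also have "[\<dots> = 1 * ((g - 1) * Suc m)] (mod g)"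
        by (intro cong_mult cong_refl y)
      finally have "[Suc m + q * i = Suc m + 1 * ((g - 1) * Suc m)] (mod g)"
        by (intro cong_add cong_refl)
      also have "Suc m + 1 * ((g - 1) * Suc m) = g * Suc m"
        using \<open>g > 0\<close> by (cases g) (auto simp: algebra_simps)
      also have "[g * Suc m = 0] (mod g)" by (simp add: cong_def)
      finally show ?thesis .
    qed
    moreover have "i < g" unfolding i_def using \<open>g > 0\<close> by simp
    moreover have "j = j'" if "j < g" "j' < g" "[Suc m + q * j = 0] (mod g)" "[Suc m + q * j' = 0] (mod g)" for j j'
    proof -
      have "[Suc m + q * j = Suc m + q * j'] (mod g)" using that(3,4) cong_sym cong_trans by blast
      then have "[q * j = q * j'] (mod g)" using cong_add_lcancel_nat by blast
      then have "[j = j'] (mod g)" using assms(1) cong_mult_lcancel_nat[of q g] by (simp add: coprime_commute)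
      then show ?thesis using that(1,2) by (simp add: cong_def)
    qed
    ultimately show ?thesis by blast
  qed
  then obtain i0 where i0: "\<And>i. i < g \<Longrightarrow> g dvd (Suc m + q * i) \<longleftrightarrow> i = i0" "i0 < g"
    unfolding cong_0_iff by metis
  have "stride_sum q g (\<lambda>m. smoothing g (Suc m) * c (Suc m)) m
      = (\<Sum>i<g. smoothing g (Suc m + q * i) * c (Suc m))"
    unfolding stride_sum_def using per'[of "Suc m"] by (intro sum.cong) auto
  also have "\<dots> = (\<Sum>i<g. smoothing g (Suc m + q * i)) * c (Suc m)"
    by (simp add: sum_distrib_right)
  also have "(\<Sum>i<g. smoothing g (Suc m + q * i) :: 'a) = (\<Sum>i<g. 1 - (if i = i0 then of_nat g else 0))"
    by (intro sum.cong refl) (use i0 in \<open>auto simp: smoothing_def simp del: add_Suc\<close>)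
  also have "\<dots> = 0"
    using i0(2) by (simp add: sum_subtractf)
  finally show ?thesis by simp
qed

text \<open>Summation by parts: \<open>h (m + q * i)\<close> is \<open>h m\<close> plus a
  telescoping sum of differences, and the part with \<open>h m\<close> is killed by the vanishing
  sum of \<open>c\<close>. Thus one stride sum is traded for one difference of
  \<open>h\<close>.\<close>

lemma stride_sum_mult:
  fixes c h :: "nat \<Rightarrow> 'a::comm_ring_1"
  assumes "stride_sum q g c m = 0"
  shows "stride_sum q g (\<lambda>m. c m * h m) m =
    (\<Sum>i<g. \<Sum>l<i. c (m + q * i) * step_diff q h (m + q * l))"
proof -
  have tele: "(\<Sum>l<i. step_diff q h (m + q * l)) = h (m + q * i) - h m" for i
    using sum_lessThan_telescope[of "\<lambda>l. h (m + q * l)" i]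
    by (simp add: step_diff_def algebra_simps)
  have "(\<Sum>i<g. \<Sum>l<i. c (m + q * i) * step_diff q h (m + q * l))
      = (\<Sum>i<g. c (m + q * i) * (h (m + q * i) - h m))"
    by (simp only: sum_distrib_left[symmetric] tele)
  also have "\<dots> = stride_sum q g (\<lambda>m. c m * h m) m - stride_sum q g c m * h m"
    by (simp add: stride_sum_def right_diff_distrib sum_subtractf sum_distrib_right)
  finally show ?thesis using assms by simp
qed

lemma stride_sum_sum:
  "stride_sum q g (\<lambda>m. \<Sum>i\<in>I. f i m) = (\<lambda>m. \<Sum>i\<in>I. stride_sum q g (f i) m)"
  unfolding stride_sum_def by (rule ext, rule sum.swap)

lemma stride_sum_pow_sum:
  "(stride_sum q g ^^ J) (\<lambda>m. \<Sum>i\<in>I. f i m) = (\<lambda>m. \<Sum>i\<in>I. (stride_sum q g ^^ J) (f i) m)"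
  by (induction J) (simp_all add: stride_sum_sum)

lemma stride_sum_shift: "stride_sum q g (\<lambda>m. f (m + d)) = (\<lambda>m. stride_sum q g f (m + d))"
  by (auto simp: stride_sum_def add_ac)

lemma step_diff_pow_shift: "(step_diff q ^^ J) (\<lambda>m. f (m + d)) = (\<lambda>m. (step_diff q ^^ J) f (m + d))"
  by (induction J) (auto simp: step_diff_def add_ac)

text \<open>By \<open>stride_sum_mult\<close> each stride sum produces at most \<open>g * g\<close>
  terms of the same shape, with \<open>c\<close> shifted and \<open>h\<close> replaced by a shifted
  difference; hence the induction over all \<open>c\<close> and \<open>h\<close>. The bound
  \<open>D\<close> is asked for only from \<open>m\<close> on, so that a decaying \<open>h\<close>
  gives a bound decaying in \<open>m\<close>.\<close>

lemma norm_stride_sum_pow_le: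
  fixes c h :: "nat \<Rightarrow> 'a::{comm_ring_1, real_normed_algebra}"
  assumes "stride_sum q g c = (\<lambda>_. 0)" and "\<And>m. norm (c m) \<le> B"
    and "\<And>m'. m' \<ge> m \<Longrightarrow> norm ((step_diff q ^^ J) h m') \<le> D"
  shows "norm ((stride_sum q g ^^ J) (\<lambda>m. c m * h m) m) \<le> real (g * g) ^ J * (B * D)"
  using assms
proof (induction J arbitrary: c h)
  case 0
  have "norm (c m * h m) \<le> norm (c m) * norm (h m)" by (rule norm_mult_ineq)
  also have "\<dots> \<le> B * D"
    using 0(2)[of m] 0(3)[of m] by (intro mult_mono) (auto intro: order_trans[OF norm_ge_zero])
  finally show ?case by simp
next
  case (Suc J)
  have B: "B \<ge> 0" using Suc.prems(2)[of 0] norm_ge_zero order_trans by blast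
  have D: "D \<ge> 0" using Suc.prems(3)[of m] norm_ge_zero order_trans by blast
  have eq: "stride_sum q g (\<lambda>m. c m * h m) =
      (\<lambda>m. \<Sum>i<g. \<Sum>l<i. c (m + q * i) * step_diff q h (m + q * l))"
    using stride_sum_mult[of q g c _ h] Suc.prems(1) by (intro ext) simp
  have "norm ((stride_sum q g ^^ Suc J) (\<lambda>m. c m * h m) m) =
     norm (\<Sum>i<g. \<Sum>l<i. (stride_sum q g ^^ J) (\<lambda>m. c (m + q * i) * step_diff q h (m + q * l)) m)"
    unfolding funpow_Suc_right o_apply eq stride_sum_pow_sum ..
  also have "\<dots> \<le> (\<Sum>i<g. \<Sum>l<i. real (g * g) ^ J * (B * D))"
  proof (intro sum_norm_le)
    fix i l
    show "norm ((stride_sum q g ^^ J) (\<lambda>m. c (m + q * i) * step_diff q h (m + q * l)) m)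
        \<le> real (g * g) ^ J * (B * D)"
    proof (rule Suc.IH[where c = "\<lambda>m. c (m + q * i)" and h = "\<lambda>m. step_diff q h (m + q * l)"])
      show "stride_sum q g (\<lambda>m. c (m + q * i)) = (\<lambda>_. 0)"
        by (subst stride_sum_shift) (simp add: Suc.prems(1))
      show "norm (c (m + q * i)) \<le> B" for m by (rule Suc.prems)
      show "norm ((step_diff q ^^ J) (\<lambda>m. step_diff q h (m + q * l)) m') \<le> D" if "m' \<ge> m" for m'
        unfolding step_diff_pow_shift
        using Suc.prems(3)[of "m' + q * l"] that unfolding funpow_Suc_right o_apply by simp
    qed
  qed
  \<comment> \<open>The triangle l < i is enlarged to a square, which accounts for the factor
    \<open>g * g\<close>.\<close>
  also have "\<dots> \<le> (\<Sum>i<g. \<Sum>l<g. real (g * g) ^ J * (B * D))"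
    using B D by (intro sum_mono sum_mono2) auto
  also have "\<dots> = real (g * g) ^ Suc J * (B * D)" by simp
  finally show ?case .
qed

section \<open>Euler summation of convergent series\<close>

lemma summable_stride_sum:
  fixes f :: "nat \<Rightarrow> 'a::real_normed_vector"
  assumes "summable f"
  shows "summable (stride_sum q g f)" "summable (ramp_sum q g f)"
proof -
  have "summable (\<lambda>m. f (m + q * i))" for i
    using assms by (simp add: summable_iff_shift)
  then show "summable (stride_sum q g f)" "summable (ramp_sum q g f)"
    by (auto simp: stride_sum_def [abs_def] ramp_sum_def [abs_def] intro!: summable_sum)
qed

text \<open>Sum the identity of \<open>stride_sum_ramp_sum\<close> over \<open>m\<close>: its part
  (1 - E)R(E) telescopes and leaves the first \<open>q\<close> values of
  \<open>ramp_sum\<close>.\<close>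

lemma suminf_stride_sum:
  fixes f :: "nat \<Rightarrow> 'a::{real_normed_field}"
  assumes "summable f" "g > 0"
  shows "suminf f = ((\<Sum>a<q. ramp_sum q g f a) + suminf (stride_sum q g f)) / of_nat g"
proof -
  note s = summable_stride_sum[OF assms(1), of q g]
  have s': "summable (\<lambda>m. ramp_sum q g f (m + q))" using s(2) by (simp add: summable_iff_shift)
  have "of_nat g * suminf f = (\<Sum>m. of_nat g * f m)"
    using assms by (intro suminf_mult[symmetric])
  also have "\<dots> = suminf (stride_sum q g f) + (suminf (ramp_sum q g f) - (\<Sum>m. ramp_sum q g f (m + q)))"
    using s s' by (simp only: stride_sum_ramp_sum[of g f _ q] suminf_add suminf_diff summable_diff)
  also have "(\<Sum>m. ramp_sum q g f (m + q)) = suminf (ramp_sum q g f) - (\<Sum>a<q. ramp_sum q g f a)"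
    by (rule suminf_minus_initial_segment[OF s(2)])
  finally show ?thesis using assms(2) by (simp add: field_simps)
qed

text \<open>Convergence is asked for at level \<open>J\<close> only, so the equality also holds
  where the original series diverges.\<close>

lemma euler_sum_Suc_remainder:
  fixes f :: "nat \<Rightarrow> 'a::{real_normed_field}"
  assumes "summable ((stride_sum q g ^^ J) f)" "g > 0"
  shows "euler_sum q g J f + suminf ((stride_sum q g ^^ J) f) / of_nat g ^ J =
         euler_sum q g (Suc J) f + suminf ((stride_sum q g ^^ Suc J) f) / of_nat g ^ Suc J"
  using suminf_stride_sum[OF assms, of q] assms(2)
  by (simp add: euler_sum_def add_divide_distrib)

text \<open>\<open>H j\<close> stands for the j-th derivative of \<open>H 0\<close>, and each
  difference of step \<open>q\<close> costs a factor \<open>q\<close> by the mean value inequality.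
  The whole chain of derivatives is carried along because x -> H(x + q) - H(x) has such a chain
  again, which drives the induction.\<close>

lemma norm_step_diff_pow_le:
  fixes H :: "nat \<Rightarrow> real \<Rightarrow> 'a::real_normed_vector"
  assumes "\<And>j x. x > 0 \<Longrightarrow> (H j has_vector_derivative H (Suc j) x) (at x)"
    and "\<And>x. x \<ge> real (Suc m) \<Longrightarrow> norm (H J x) \<le> D"
  shows "norm ((step_diff q ^^ J) (\<lambda>m. H 0 (real (Suc m))) m) \<le> real q ^ J * D"
  using assms
proof (induction J arbitrary: H D)
  case (Suc J)
  define H' where "H' = (\<lambda>j x. H j (x + real q) - H j x)"
  have "norm ((step_diff q ^^ J) (\<lambda>m. H' 0 (real (Suc m))) m) \<le> real q ^ J * (real q * D)"
  proof (rule Suc.IH)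
    fix j :: nat and x :: real assume x: "x > 0"
    have "((\<lambda>y. H j (y + real q)) has_vector_derivative H (Suc j) (x + real q)) (at x)"
    proof -
      have "((H j \<circ> (\<lambda>y. y + real q)) has_vector_derivative 1 *\<^sub>R H (Suc j) (x + real q)) (at x)"
        by (rule vector_diff_chain_at) (use x in \<open>auto intro!: derivative_eq_intros Suc.prems(1)\<close>)
      then show ?thesis by (simp add: o_def)
    qed
    then show "(H' j has_vector_derivative H' (Suc j) x) (at x)"
      unfolding H'_def using Suc.prems(1)[OF x] by (intro has_vector_derivative_diff)
  next
    fix x assume x: "x \<ge> real (Suc m)"
    have "norm (H J (x + real q) - H J x) \<le> D * norm (x + real q - x)"
    proof (rule differentiable_bound[where f' = "\<lambda>y h. h *\<^sub>R H (Suc J) y" and S = "{x..x + real q}"])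
      show "(H J has_derivative (\<lambda>h. h *\<^sub>R H (Suc J) y)) (at y within {x..x + real q})"
        if "y \<in> {x..x + real q}" for y
        using Suc.prems(1)[of y J] that x
        by (auto simp: has_vector_derivative_def intro: has_derivative_at_withinI)
      show "onorm (\<lambda>h. h *\<^sub>R H (Suc J) y) \<le> D" if "y \<in> {x..x + real q}" for y
        using Suc.prems(2)[of y] that x by (intro onorm_le) (auto simp: mult.commute[of D] intro!: mult_left_mono)
    qed auto
    then show "norm (H' J x) \<le> real q * D" by (simp add: H'_def mult.commute)
  qed
  moreover have "step_diff q (\<lambda>m. H 0 (real (Suc m))) = (\<lambda>m. H' 0 (real (Suc m)))"
    by (auto simp: step_diff_def H'_def add_ac)
  ultimately show ?case
    by (simp add: funpow_Suc_right mult_ac del: funpow.simps)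
qed auto

section \<open>Linearity of the Euler sum\<close>

lemma stride_sum_pow_linear:
  fixes f h :: "nat \<Rightarrow> 'a::comm_ring_1"
  shows "(stride_sum q g ^^ i) (\<lambda>m. f m + h m) m = (stride_sum q g ^^ i) f m + (stride_sum q g ^^ i) h m"
    and "(stride_sum q g ^^ i) (\<lambda>m. c * f m) m = c * (stride_sum q g ^^ i) f m"
proof -
  show "(stride_sum q g ^^ i) (\<lambda>m. f m + h m) m = (stride_sum q g ^^ i) f m + (stride_sum q g ^^ i) h m"
    by (induction i arbitrary: m) (simp_all add: stride_sum_def[of _ _ "(_ ^^ _) _"] sum.distrib)
  show "(stride_sum q g ^^ i) (\<lambda>m. c * f m) m = c * (stride_sum q g ^^ i) f m"
    by (induction i arbitrary: m) (simp_all add: stride_sum_def[of _ _ "(_ ^^ _) _"] sum_distrib_left)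
qed

lemma euler_sum_add:
  "euler_sum q g J (\<lambda>m. f m + h m) = euler_sum q g J f + euler_sum q g J h"
  by (simp add: euler_sum_def ramp_sum_def stride_sum_pow_linear sum.distrib add_divide_distrib)

lemma euler_sum_cmult:
  "euler_sum q g J (\<lambda>m. c * f m) = c * euler_sum q g J f"
  by (simp add: euler_sum_def ramp_sum_def stride_sum_pow_linear sum_distrib_left)

lemma euler_sum_sum:
  "finite I \<Longrightarrow> euler_sum q g J (\<lambda>m. \<Sum>i\<in>I. f i m) = (\<Sum>i\<in>I. euler_sum q g J (f i))"
proof (induction I rule: finite_induct)
  case empty
  show ?case using euler_sum_cmult[of q g J 0 "\<lambda>_. 0"] by simp
qed (simp add: euler_sum_add)

section \<open>Analytic continuation of smoothed L-series\<close>

text \<open>Complete multiplicativity with values of norm at most 1, zero included, covers the three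
  cases in play: a Dirichlet character modulo p^n, the indicator of the numbers prime to p, and,
  with \<open>q = 1\<close>, the constant 1 of zeta.\<close>

locale periodic_multiplicative =
  fixes q g :: nat and \<psi> :: "nat \<Rightarrow> complex"
  assumes q_pos: "q > 0" and g_gt_1: "g > 1" and coprime_g_q: "coprime g q"
    and periodic: "\<And>a. \<psi> (a + q) = \<psi> a"
    and multiplicative: "\<And>a b. \<psi> (a * b) = \<psi> a * \<psi> b"
    and norm_le_1: "\<And>a. norm (\<psi> a) \<le> 1"
begin

definition smooth_term :: "complex \<Rightarrow> nat \<Rightarrow> complex" where
  "smooth_term s m = smoothing g (Suc m) * \<psi> (Suc m) * of_nat (Suc m) powr (-s)"

text \<open>The remainder series converges for Re s > 1 - J, so each \<open>J\<close> continues the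
  smoothed series to one more strip.\<close>

definition partial_cont :: "nat \<Rightarrow> complex \<Rightarrow> complex" where
  "partial_cont J s = euler_sum q g J (smooth_term s) +
     (\<Sum>m. (stride_sum q g ^^ J) (smooth_term s) m) / of_nat g ^ J"

text \<open>The ceiling guarantees Re s > 1 - J; every other such index gives the same
  value.\<close>

definition smooth_L :: "complex \<Rightarrow> complex" where
  "smooth_L s = partial_cont (nat \<lceil>2 - Re s\<rceil>) s"

text \<open>The two bounds on iterated sums and differences are applied to x^(-s), whose J-th
  derivative is the product times x^(-s-J). The hypothesis makes the real power non-increasing, so
  that its value at m + 1 bounds it from there on. The product is kept explicit because its zeros
  matter at s = 1 - k.\<close>

lemma norm_stride_smooth_term_le:
  assumes "Re s + real J \<ge> 0"
  shows "norm ((stride_sum q g ^^ J) (smooth_term s) m) \<le>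
    real (g * g) ^ J * ((1 + real g) * (real q ^ J *
      (norm (\<Prod>i<J. - s - of_nat i) * real (Suc m) powr (- (Re s + real J)))))"
proof -
  define H where "H = (\<lambda>j x. (\<Prod>i<j. - s - of_nat i) * complex_of_real x powr (- s - of_nat j))"
  define h where "h = (\<lambda>m. H 0 (real (Suc m)))"
  have deriv: "(H j has_vector_derivative H (Suc j) x) (at x)" if "x > 0" for j x
  proof -
    have "((\<lambda>z. (\<Prod>i<j. - s - of_nat i) * z powr (- s - of_nat j)) has_field_derivative H (Suc j) x)
        (at (complex_of_real x))"
      unfolding H_def using that
      by (auto intro!: derivative_eq_intros simp: complex_nonpos_Reals_iff algebra_simps)
    from has_vector_derivative_real_field[OF this] show ?thesis by (simp add: H_def)
  qed
  have bound: "norm ((step_diff q ^^ J) h m') \<le> real q ^ J *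
      (norm (\<Prod>i<J. - s - of_nat i) * real (Suc m) powr (- (Re s + real J)))" if "m' \<ge> m" for m'
    unfolding h_def
  proof (rule norm_step_diff_pow_le[where H = H, OF deriv])
    fix x assume x: "x \<ge> real (Suc m')"
    then have "x \<ge> real (Suc m)" using that by linarith
    then have "x powr (- (Re s + real J)) \<le> real (Suc m) powr (- (Re s + real J))"
      using assms by (intro powr_mono2') auto
    moreover have "norm (complex_of_real x powr (- s - of_nat J)) = x powr (- (Re s + real J))"
      using x by (subst norm_powr_real_powr) (auto simp: algebra_simps)
    ultimately show "norm (H J x) \<le> norm (\<Prod>i<J. - s - of_nat i) * real (Suc m) powr (- (Re s + real J))"
      unfolding H_def norm_mult by (intro mult_left_mono) auto
  qed
  have "norm ((stride_sum q g ^^ J) (\<lambda>m. (smoothing g (Suc m) * \<psi> (Suc m)) * h m) m) \<le>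
    real (g * g) ^ J * ((1 + real g) * (real q ^ J *
      (norm (\<Prod>i<J. - s - of_nat i) * real (Suc m) powr (- (Re s + real J)))))"
  proof (rule norm_stride_sum_pow_le[OF _ _ bound])
    show "stride_sum q g (\<lambda>m. smoothing g (Suc m) * \<psi> (Suc m)) = (\<lambda>_. 0)"
      using stride_sum_smoothing[OF coprime_g_q, of \<psi>] g_gt_1 periodic by auto
    show "norm (smoothing g (Suc m) * \<psi> (Suc m)) \<le> 1 + real g" for m
    proof -
      have "norm (smoothing g (Suc m) :: complex) \<le> 1 + real g"
        using norm_triangle_ineq4[of "1::complex" "of_nat g"] by (auto simp: smoothing_def)
      then show ?thesis unfolding norm_mult
        using norm_le_1[of "Suc m"] mult_mono[of _ "1 + real g" "norm (\<psi> (Suc m))" 1] by simp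
    qed
  qed
  then show ?thesis by (simp add: h_def H_def smooth_term_def [abs_def])
qed

text \<open>At s = 1 - k the function x^(-s) is a polynomial of degree k - 1, so
  \<open>J \<ge> k\<close> differences kill it: the factor i = k - 1 of the product is 0.\<close>

lemma stride_smooth_term_eq_0:
  assumes "J \<ge> k" "k > 0"
  shows "(stride_sum q g ^^ J) (smooth_term (1 - of_nat k)) m = 0"
proof -
  have "(\<Prod>i<J. - (1 - of_nat k :: complex) - of_nat i) = 0"
    using assms by (auto intro!: bexI[of _ "k - 1"] simp: prod_zero_iff of_nat_diff)
  with norm_stride_smooth_term_le[of "1 - of_nat k" J m] assms
  have "norm ((stride_sum q g ^^ J) (smooth_term (1 - of_nat k)) m) \<le> 0"
    by (simp only: norm_zero mult_zero_left mult_zero_right) simp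
  then show ?thesis by simp
qed

text \<open>Weierstrass test: near each point of the half plane the terms are dominated by a
  constant times (m + 1)^(-(1 + d)).\<close>

lemma partial_cont_summable_holomorphic:
  "Re s > 1 - real J \<Longrightarrow> summable ((stride_sum q g ^^ J) (smooth_term s))"
  "partial_cont J holomorphic_on {s. Re s > 1 - real J}"
proof -
  define S where "S = {s. Re s > 1 - real J}"
  have S: "open S" unfolding S_def by (rule open_halfspace_Re_gt)
  have hol: "(\<lambda>s. (stride_sum q g ^^ i) (smooth_term s) m) field_differentiable (at s)" for i m s
  proof (induction i arbitrary: m)
    case 0
    have "(\<lambda>s. smooth_term s m) holomorphic_on UNIV"
      unfolding smooth_term_def by (intro holomorphic_intros) (simp del: of_nat_Suc)
    then show ?case
      by (simp add: holomorphic_on_imp_differentiable_at)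
  next
    case (Suc i)
    then show ?case
      unfolding funpow.simps o_apply stride_sum_def[of _ _ "(stride_sum q g ^^ i) _"]
      by (intro field_differentiable_sum) auto
  qed
  obtain G where G: "\<And>s. s \<in> S \<Longrightarrow> (stride_sum q g ^^ J) (smooth_term s) sums G s"
     "\<And>s. s \<in> S \<Longrightarrow> G field_differentiable (at s)"
  proof (rule series_differentiable_comparison_complex[of S "\<lambda>m s. (stride_sum q g ^^ J) (smooth_term s) m"])
    show "open S" by fact
    show "(\<lambda>s. (stride_sum q g ^^ J) (smooth_term s) m) field_differentiable (at s)" for m s by (rule hol)
    fix s assume s: "s \<in> S"
    \<comment> \<open>Half the distance from \<open>s\<close> to the boundary line, so that Re y + J
      stays above 1 + d for \<open>y\<close> in the ball.\<close>
    define d where "d = (Re s - (1 - real J)) / 2"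
    have d: "d > 0" using s by (simp add: d_def S_def)
    define K where "K = real (g * g) ^ J * ((1 + real g) * (real q ^ J * (\<Prod>i<J. norm s + d + real i)))"
    \<comment> \<open>The comparison theorem expects its majorant as a complex series with
      nonnegative real terms.\<close>
    define h where "h = (\<lambda>m. complex_of_real (K * real (Suc m) powr (- (1 + d))))"
    have K: "K \<ge> 0" unfolding K_def using d by (intro mult_nonneg_nonneg prod_nonneg) auto
    have "summable (\<lambda>m. real (Suc m) powr (- (1 + d)))"
      using d by (subst summable_Suc_iff) (simp add: summable_real_powr_iff)
    then have 1: "summable h" unfolding h_def summable_of_real_iff
      by (intro summable_of_real summable_mult)
    have 2: "range h \<subseteq> \<real>\<^sub>\<ge>\<^sub>0" using K by (auto simp: h_def simp del: of_real_mult)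
    have 3: "norm ((stride_sum q g ^^ J) (smooth_term y) m) \<le> norm (h m)" if y: "y \<in> ball s d" for y m
    proof -
      have "\<bar>Re s - Re y\<bar> \<le> norm (s - y)" using abs_Re_le_cmod[of "s - y"] by simp
      then have Re: "Re y + real J > 1 + d" using y by (simp add: d_def dist_norm) argo
      have ny: "norm y \<le> norm s + d" using y norm_triangle_sub[of y s] by (simp add: dist_norm norm_minus_commute)
      have "norm ((stride_sum q g ^^ J) (smooth_term y) m) \<le>
          real (g * g) ^ J * ((1 + real g) * (real q ^ J *
          (norm (\<Prod>i<J. - y - of_nat i) * real (Suc m) powr (- (Re y + real J)))))"
        using Re d by (intro norm_stride_smooth_term_le) simp
      also have "\<dots> \<le> real (g * g) ^ J * ((1 + real g) * (real q ^ J *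
          ((\<Prod>i<J. norm s + d + real i) * real (Suc m) powr (- (1 + d)))))"
      proof (intro mult_left_mono mult_mono)
        show "norm (\<Prod>i<J. - y - of_nat i) \<le> (\<Prod>i<J. norm s + d + real i)"
          unfolding prod_norm[symmetric]
        proof (intro prod_mono conjI norm_ge_zero)
          fix i show "norm (- y - of_nat i) \<le> norm s + d + real i"
            using norm_triangle_ineq4[of "-y" "of_nat i"] ny by simp
        qed
        show "real (Suc m) powr (- (Re y + real J)) \<le> real (Suc m) powr (- (1 + d))"
          using Re by (intro powr_mono) auto
      qed (use d in \<open>auto intro!: prod_nonneg\<close>)
      also have "\<dots> = K * real (Suc m) powr (- (1 + d))" by (simp add: K_def mult_ac)
      also have "\<dots> = norm (h m)"
        unfolding h_def norm_of_real using K by (intro abs_of_nonneg [symmetric] mult_nonneg_nonneg) auto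
      finally show ?thesis .
    qed
    show "\<exists>d h. 0 < d \<and> summable h \<and> range h \<subseteq> \<real>\<^sub>\<ge>\<^sub>0 \<and>
        (\<forall>\<^sub>F m in sequentially. \<forall>y\<in>ball s d \<inter> S. cmod ((stride_sum q g ^^ J) (smooth_term y) m) \<le> cmod (h m))"
      using d 1 2 3 by (intro exI[of _ d] exI[of _ h]) auto
  qed blast
  show "summable ((stride_sum q g ^^ J) (smooth_term s))" if "Re s > 1 - real J" for s
    using G(1)[of s] that by (auto simp: S_def sums_iff)
  have "(\<lambda>s. euler_sum q g J (smooth_term s) + G s / of_nat g ^ J) field_differentiable (at s)" if "s \<in> S" for s
    unfolding euler_sum_def ramp_sum_def using g_gt_1
    by (intro field_differentiable_add field_differentiable_sum field_differentiable_divide hol G(2) that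
      field_differentiable_const) auto
  then have "(\<lambda>s. euler_sum q g J (smooth_term s) + G s / of_nat g ^ J) holomorphic_on S"
    using S by (simp add: holomorphic_on_def field_differentiable_at_within)
  then have "partial_cont J holomorphic_on S"
    by (rule holomorphic_transform) (use G(1) in \<open>auto simp: partial_cont_def sums_iff\<close>)
  then show "partial_cont J holomorphic_on {s. Re s > 1 - real J}" by (simp add: S_def)
qed

lemma partial_cont_add:
  assumes "Re s > 1 - real J"
  shows "partial_cont (J + i) s = partial_cont J s"
proof (induction i)
  case (Suc i)
  have "partial_cont (J + i) s = partial_cont (Suc (J + i)) s"
    unfolding partial_cont_def
    by (rule euler_sum_Suc_remainder) (use assms g_gt_1 partial_cont_summable_holomorphic(1)[of "J + i" s] in auto)
  then show ?case using Suc by simp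
qed simp

text \<open>Both indices are raised to their sum, where the two values meet.\<close>

lemma smooth_L_eq_partial_cont:
  assumes "Re s > 1 - real J"
  shows "smooth_L s = partial_cont J s"
proof -
  define J' where "J' = nat \<lceil>2 - Re s\<rceil>"
  have "Re s > 1 - real J'" unfolding J'_def by linarith
  then have "partial_cont (J' + J) s = partial_cont J' s" by (rule partial_cont_add)
  moreover have "partial_cont (J + J') s = partial_cont J s" using assms by (rule partial_cont_add)
  ultimately show ?thesis by (simp add: smooth_L_def J'_def add.commute)
qed

text \<open>The index inside \<open>smooth_L\<close> jumps with Re s, but around any point one fixed
  \<open>J\<close> gives the same function on an open half plane.\<close>

lemma holomorphic_smooth_L: "smooth_L holomorphic_on UNIV"
proof -
  have "smooth_L field_differentiable (at s)" for s
  proof -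
    obtain J :: nat where J: "real J > 1 - Re s" using reals_Archimedean2 by blast
    have "smooth_L holomorphic_on {s. Re s > 1 - real J}"
      by (rule holomorphic_transform[OF partial_cont_summable_holomorphic(2)[of J]])
        (simp add: smooth_L_eq_partial_cont)
    then show ?thesis
      by (rule holomorphic_on_imp_differentiable_at) (use J in \<open>auto simp: open_halfspace_Re_gt\<close>)
  qed
  then show ?thesis by (simp add: holomorphic_on_def field_differentiable_at_within)
qed

text \<open>The remainder vanishes termwise. \<open>J\<close> stays free above \<open>k\<close>,
  which later permits one common \<open>J\<close> for many exponents; the inequality is strict
  because 1 - k must lie in the open half plane Re s > 1 - J.\<close>

lemma smooth_L_nonpos_int:
  assumes "k > 0" "J > k"
  shows "smooth_L (1 - of_nat k) =
    euler_sum q g J (\<lambda>m. smoothing g (Suc m) * \<psi> (Suc m) * of_nat (Suc m) ^ (k - 1))"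
proof -
  have eq: "smooth_term (1 - of_nat k) = (\<lambda>m. smoothing g (Suc m) * \<psi> (Suc m) * of_nat (Suc m) ^ (k - 1))"
  proof
    fix m
    have "of_nat (Suc m) powr (- (1 - of_nat k) :: complex) = of_nat (Suc m) powr of_nat (k - 1)"
      using assms(1) by (simp add: of_nat_diff)
    also have "\<dots> = of_nat (Suc m) ^ (k - 1)"
      by (simp add: powr_nat' del: of_nat_Suc)
    finally show "smooth_term (1 - of_nat k) m = smoothing g (Suc m) * \<psi> (Suc m) * of_nat (Suc m) ^ (k - 1)"
      by (simp add: smooth_term_def)
  qed
  have "smooth_L (1 - of_nat k) = partial_cont J (1 - of_nat k)"
    using assms by (intro smooth_L_eq_partial_cont) simp
  also have "\<dots> = euler_sum q g J (smooth_term (1 - of_nat k))"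
    using assms by (simp add: partial_cont_def stride_smooth_term_eq_0)
  finally show ?thesis unfolding eq .
qed

section \<open>Comparison with the Dirichlet series for Re s > 1\<close>

lemma summable_dirichlet_series:
  assumes "Re s > 1"
  shows "summable (\<lambda>m. \<psi> (Suc m) / of_nat (Suc m) powr s)"
proof (rule summable_comparison_test)
  show "summable (\<lambda>m. real (Suc m) powr (- Re s))"
    using assms by (subst summable_Suc_iff) (simp add: summable_real_powr_iff)
  have "norm (\<psi> (Suc m) / of_nat (Suc m) powr s) \<le> real (Suc m) powr (- Re s)" for m
  proof -
    have "norm (of_nat (Suc m) powr s :: complex) = real (Suc m) powr Re s"
      by (subst norm_powr_real_powr) (auto simp del: of_nat_Suc)
    then show ?thesis
      using norm_le_1[of "Suc m"]
      by (simp add: norm_divide powr_minus divide_simps del: of_nat_Suc)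
  qed
  then show "\<exists>N. \<forall>m\<ge>N. norm (\<psi> (Suc m) / of_nat (Suc m) powr s) \<le> real (Suc m) powr (- Re s)" by blast
qed

lemma sums_multiples:
  assumes "Re s > 1" and "d > 0"
  shows "(\<lambda>m. if d dvd Suc m then \<psi> (Suc m) / of_nat (Suc m) powr s else 0) sums
    (\<psi> d / of_nat d powr s * (\<Sum>m. \<psi> (Suc m) / of_nat (Suc m) powr s))"
proof -
  define f where "f = (\<lambda>m. if d dvd Suc m then \<psi> (Suc m) / of_nat (Suc m) powr s else 0)"
  \<comment> \<open>The term with index m belongs to the integer m + 1, so the multiple d (j + 1)
    sits at index d (j + 1) - 1.\<close>
  define r where "r = (\<lambda>j. d * Suc j - 1)"
  have Suc_r: "Suc (r j) = d * Suc j" for j using assms(2) by (simp add: r_def)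
  have "strict_mono r"
  proof (rule strict_monoI)
    fix i j :: nat assume "i < j"
    then have "Suc (r i) < Suc (r j)" unfolding Suc_r using assms(2) by simp
    then show "r i < r j" by simp
  qed
  moreover have "f m = 0" if "m \<notin> range r" for m
  proof -
    have "\<not> d dvd Suc m"
    proof
      assume "d dvd Suc m"
      then obtain j where j: "Suc m = d * j" by (auto elim: dvdE)
      then obtain j' where "j = Suc j'" by (cases j) auto
      then have "m = r j'" using j Suc_r[of j'] by simp
      then show False using that by blast
    qed
    then show ?thesis by (simp add: f_def)
  qed
  moreover have "(\<lambda>j. f (r j)) sums (\<psi> d / of_nat d powr s * (\<Sum>m. \<psi> (Suc m) / of_nat (Suc m) powr s))"
  proof -
    have "f (r j) = \<psi> d / of_nat d powr s * (\<psi> (Suc j) / of_nat (Suc j) powr s)" for j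
    proof -
      have "of_nat (d * Suc j) powr s = of_nat d powr s * (of_nat (Suc j) powr s :: complex)"
        unfolding of_nat_mult by (rule powr_times_real) (auto simp del: of_nat_Suc)
      then show ?thesis unfolding f_def Suc_r by (simp add: multiplicative del: mult_Suc_right of_nat_Suc)
    qed
    then show ?thesis using sums_mult[OF summable_sums[OF summable_dirichlet_series[OF assms(1)]]] by presburger
  qed
  ultimately have "f sums (\<psi> d / of_nat d powr s * (\<Sum>m. \<psi> (Suc m) / of_nat (Suc m) powr s))"
    using sums_mono_reindex by blast
  then show ?thesis by (simp add: f_def)
qed

text \<open>Smoothing subtracts \<open>g\<close> times the subseries over the multiples of
  \<open>g\<close>, and by multiplicativity that subseries is \<psi>(g) g^(-s) times the whole
  series.\<close>

lemma smooth_L_eq_suminf: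
  assumes "Re s > 1"
  shows "smooth_L s = (1 - \<psi> g * of_nat g powr (1 - s)) * (\<Sum>m. \<psi> (Suc m) / of_nat (Suc m) powr s)"
proof -
  define D where "D = (\<Sum>m. \<psi> (Suc m) / of_nat (Suc m) powr s)"
  have "(\<lambda>m. \<psi> (Suc m) / of_nat (Suc m) powr s) sums D"
    unfolding D_def by (rule summable_sums[OF summable_dirichlet_series[OF assms]])
  from sums_diff[OF this sums_mult[OF sums_multiples[OF assms, of g], of "of_nat g"]]
  have "(\<lambda>m. \<psi> (Suc m) / of_nat (Suc m) powr s -
      of_nat g * (if g dvd Suc m then \<psi> (Suc m) / of_nat (Suc m) powr s else 0)) sums
    (D - of_nat g * (\<psi> g / of_nat g powr s * D))"
    using g_gt_1 by (simp add: D_def)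
  also have "(\<lambda>m. \<psi> (Suc m) / of_nat (Suc m) powr s -
      of_nat g * (if g dvd Suc m then \<psi> (Suc m) / of_nat (Suc m) powr s else 0)) = smooth_term s"
    by (auto simp: smooth_term_def smoothing_def powr_minus divide_inverse algebra_simps simp del: of_nat_Suc)
  also have "D - of_nat g * (\<psi> g / of_nat g powr s * D) = (1 - \<psi> g * of_nat g powr (1 - s)) * D"
    using g_gt_1 by (simp add: powr_diff algebra_simps)
  finally have "suminf (smooth_term s) = (1 - \<psi> g * of_nat g powr (1 - s)) * D" by (simp add: sums_iff)
  \<comment> \<open>Here \<open>J = 0\<close> is admissible: the Euler sum is empty and the
    remainder is the series itself.\<close>
  moreover have "smooth_L s = suminf (smooth_term s)"
    using smooth_L_eq_partial_cont[of 0 s] assms by (simp add: partial_cont_def euler_sum_def)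
  ultimately show ?thesis by (simp add: D_def)
qed

text \<open>\<open>dirichlet_L\<close> is a description that quantifies over domains, so one
  admissible domain has to be exhibited and every other one must give the same value. The candidate
  divides the entire function \<open>smooth_L\<close> by its smoothing factor
  \<open>E\<close>.\<close>

lemma dirichlet_L_nonpos_int:
  assumes "\<psi> g = 1" and "k > 0"
  shows "dirichlet_L \<psi> (1 - of_nat k) = smooth_L (1 - of_nat k) / (1 - of_nat g ^ k)"
proof -
  define E where "E = (\<lambda>s::complex. 1 - of_nat g powr (1 - s))"
  have E_hol: "E holomorphic_on UNIV"
    unfolding E_def using g_gt_1 by (auto intro!: holomorphic_intros)
  have E_k: "E (1 - of_nat k) = 1 - of_nat g ^ k"
    using g_gt_1 by (simp add: E_def powr_nat')
  have "real g ^ k \<noteq> 1" using g_gt_1 assms(2) by (metis less_irrefl of_nat_1 of_nat_less_iff one_less_power)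
  then have "(of_nat g :: complex) ^ k \<noteq> 1"
    by (metis of_real_eq_1_iff of_real_of_nat_eq of_real_power)
  then have Ek_nz: "E (1 - of_nat k) \<noteq> 0" unfolding E_k by simp
  \<comment> \<open>At a zero of \<open>E\<close> the number g^(1-s) has norm 1, so all zeros lie on
    the line Re s = 1, outside the half plane of convergence.\<close>
  have zero_Re: "Re s = 1" if "E s = 0" for s
  proof -
    have "real g powr (1 - Re s) = norm (of_nat g powr (1 - s) :: complex)"
      by (subst norm_powr_real_powr) auto
    also have "\<dots> = 1" using that by (simp add: E_def)
    finally have "real g powr (1 - Re s) = real g powr 0" using g_gt_1 by simp
    then show ?thesis using g_gt_1 by (subst (asm) powr_inj) auto
  qed
  define A where "A = UNIV - {s. E s = 0}"
  define f where "f = (\<lambda>s. smooth_L s / E s)"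
  have "closed {s. E s = 0}"
    by (rule closed_Collect_eq) (use holomorphic_on_imp_continuous_on[OF E_hol] in auto)
  then have "open A" unfolding A_def by auto
  \<comment> \<open>A nonconstant entire function has countably many zeros, and the plane stays
    connected when a countable set is removed.\<close>
  have "countable {s. E s = 0}"
  proof -
    have "\<not> E constant_on UNIV"
    proof
      assume "E constant_on UNIV"
      then have "E (1 - of_nat k) = E 1" unfolding constant_on_def by auto
      then show False using Ek_nz g_gt_1 by (simp add: E_def)
    qed
    from holomorphic_countable_zeros[OF E_hol open_UNIV connected_UNIV _ this] show ?thesis by simp
  qed
  then have "connected A" unfolding A_def
    by (intro connected_open_diff_countable) auto
  have "{s. Re s > 1} \<subseteq> A" using zero_Re by (force simp: A_def)
  have f_hol: "f holomorphic_on A" unfolding f_def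
    by (intro holomorphic_on_divide holomorphic_on_subset[OF holomorphic_smooth_L] holomorphic_on_subset[OF E_hol])
       (auto simp: A_def)
  have f_sums: "(\<lambda>m. \<psi> (Suc m) / of_nat (Suc m) powr w) sums f w" if "Re w > 1" for w
  proof -
    have "E w \<noteq> 0" using zero_Re that by force
    then have "f w = (\<Sum>m. \<psi> (Suc m) / of_nat (Suc m) powr w)"
      using smooth_L_eq_suminf[OF that] assms(1) by (simp add: f_def E_def)
    then show ?thesis using summable_sums[OF summable_dirichlet_series[OF that]] by simp
  qed
  have "dirichlet_L \<psi> (1 - of_nat k) = f (1 - of_nat k)"
    unfolding dirichlet_L_def
  proof (rule the_equality)
    show "\<exists>A fa. open A \<and> connected A \<and> {w. 1 < Re w} \<subseteq> A \<and> 1 - of_nat k \<in> A \<and> fa holomorphic_on A \<and>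
           (\<forall>w. 1 < Re w \<longrightarrow> (\<lambda>m. \<psi> (Suc m) / of_nat (Suc m) powr w) sums fa w) \<and> f (1 - of_nat k) = fa (1 - of_nat k)"
      by (intro exI[of _ A] exI[of _ f])
        (use \<open>open A\<close> \<open>connected A\<close> \<open>{s. Re s > 1} \<subseteq> A\<close> f_hol f_sums Ek_nz in \<open>auto simp: A_def\<close>)
  next
    fix z
    assume "\<exists>A f. open A \<and> connected A \<and> {w. 1 < Re w} \<subseteq> A \<and> 1 - of_nat k \<in> A \<and> f holomorphic_on A \<and>
           (\<forall>w. 1 < Re w \<longrightarrow> (\<lambda>m. \<psi> (Suc m) / of_nat (Suc m) powr w) sums f w) \<and> z = f (1 - of_nat k)"
    then obtain B h where B: "open B" "connected B" "{w. 1 < Re w} \<subseteq> B" "1 - of_nat k \<in> B" "h holomorphic_on B"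
      and sums: "\<And>w. 1 < Re w \<Longrightarrow> (\<lambda>m. \<psi> (Suc m) / of_nat (Suc m) powr w) sums h w" and z: "z = h (1 - of_nat k)"
      by blast
    \<comment> \<open>The quotient \<open>f\<close> may have poles in the foreign domain
      \<open>B\<close>, so the identity theorem is applied to the cleared form h E -
      smooth_L.\<close>
    have "h (1 - of_nat k) * E (1 - of_nat k) - smooth_L (1 - of_nat k) = 0"
    proof (rule analytic_continuation_open[of "{w. 1 < Re w}" B "\<lambda>w. h w * E w - smooth_L w" "\<lambda>_. 0"])
      show "{w. 1 < Re w} \<noteq> {}" by (auto intro!: exI[of _ 2])
      show "(\<lambda>w. h w * E w - smooth_L w) holomorphic_on B"
        by (intro holomorphic_intros B holomorphic_on_subset[OF holomorphic_smooth_L] holomorphic_on_subset[OF E_hol]) auto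
      show "h w * E w - smooth_L w = 0" if "w \<in> {w. 1 < Re w}" for w
        using smooth_L_eq_suminf[of w] sums[of w] that assms(1) by (simp add: sums_iff E_def)
    qed (use B in \<open>auto simp: open_halfspace_Re_gt\<close>)
    then show "z = f (1 - of_nat k)" using Ek_nz by (simp add: z f_def field_simps)
  qed
  then show ?thesis by (simp add: f_def E_k)
qed

end

text \<open>The two functions are built with different strides, 1 and \<open>q\<close>, so they are
  compared through their Dirichlet series: for Re w > 1 dropping the multiples of \<open>p\<close>
  produces the Euler factor, and the identity theorem extends this. As \<open>p\<close> does not
  divide \<open>g\<close>, both sides carry the same smoothing factor.\<close>

lemma smooth_L_remove_prime:
  assumes zeta: "periodic_multiplicative 1 g (\<lambda>_. 1)"
    and triv: "periodic_multiplicative q g (\<lambda>a. if p dvd a then 0 else 1)"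
    and "p > 0" and "\<not> p dvd g"
  shows "periodic_multiplicative.smooth_L q g (\<lambda>a. if p dvd a then 0 else 1) s =
     (1 - of_nat p powr (-s)) * periodic_multiplicative.smooth_L 1 g (\<lambda>_. 1) s"
proof -
  interpret Z: periodic_multiplicative 1 g "\<lambda>_. 1" by fact
  interpret T: periodic_multiplicative q g "\<lambda>a. if p dvd a then 0 else 1" by fact
  have "T.smooth_L s - (1 - of_nat p powr (-s)) * Z.smooth_L s = 0"
  proof (rule analytic_continuation_open[of "{w. 1 < Re w}" UNIV
      "\<lambda>w. T.smooth_L w - (1 - of_nat p powr (-w)) * Z.smooth_L w" "\<lambda>_. 0"])
    show "{w. 1 < Re w} \<noteq> {}" by (auto intro!: exI[of _ 2])
    show "(\<lambda>w. T.smooth_L w - (1 - of_nat p powr (-w)) * Z.smooth_L w) holomorphic_on UNIV"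
      using \<open>p > 0\<close> by (intro holomorphic_intros T.holomorphic_smooth_L Z.holomorphic_smooth_L) auto
    fix w assume "w \<in> {w. 1 < Re w}"
    then have w: "Re w > 1" by simp
    define D where "D = (\<Sum>m. 1 / of_nat (Suc m) powr w :: complex)"
    have "(\<lambda>m. 1 / of_nat (Suc m) powr w - (if p dvd Suc m then 1 / of_nat (Suc m) powr w else 0)) sums
      (D - 1 / of_nat p powr w * D)"
      unfolding D_def using Z.sums_multiples[OF w \<open>p > 0\<close>]
      by (intro sums_diff summable_sums Z.summable_dirichlet_series[OF w]) simp
    also have "(\<lambda>m. 1 / of_nat (Suc m) powr w - (if p dvd Suc m then 1 / of_nat (Suc m) powr w else 0)) =
       (\<lambda>m. (if p dvd Suc m then 0 else 1) / of_nat (Suc m) powr w :: complex)"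
      by auto
    finally have "(\<Sum>m. (if p dvd Suc m then 0 else 1) / of_nat (Suc m) powr w) = (1 - of_nat p powr (-w)) * D"
      by (simp add: sums_iff powr_minus field_simps)
    then show "T.smooth_L w - (1 - of_nat p powr (-w)) * Z.smooth_L w = 0"
      unfolding T.smooth_L_eq_suminf[OF w] Z.smooth_L_eq_suminf[OF w] using \<open>\<not> p dvd g\<close> by (simp add: D_def)
  qed (auto simp: open_halfspace_Re_gt)
  then show ?thesis by simp
qed

section \<open>The p-adic absolute value\<close>

locale complex_padic_field =
  fixes p :: nat and ty :: "'c::{alg_closed_field, field_char_0, complete_space} itself"
  assumes is_complex_padic_field: "is_complex_padic_field p ty"
begin

abbreviation vabs :: "'c \<Rightarrow> real" where "vabs \<equiv> padic_abs"

lemma prime_p: "Factorial_Ring.prime p"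
  and dist_eq_vabs: "dist x y = vabs (x - y)"
  and vabs_mult: "vabs (x * y) = vabs x * vabs y"
  and vabs_add_le_max: "vabs (x + y) \<le> max (vabs x) (vabs y)"
  and vabs_p: "vabs (of_nat p) = 1 / real p"
  using is_complex_padic_field by (simp_all add: is_complex_padic_field_def)

lemma p_gt_1: "p > 1"
  using prime_p by (rule prime_gt_1_nat)

lemma vabs_nonneg [simp]: "vabs x \<ge> 0"
  by (simp add: padic_abs_def)

lemma vabs_eq_0_iff [simp]: "vabs x = 0 \<longleftrightarrow> x = 0"
  by (simp add: padic_abs_def)

lemma vabs_0 [simp]: "vabs 0 = 0" by simp

lemma vabs_1 [simp]: "vabs 1 = 1"
  using vabs_mult[of 1 1] vabs_eq_0_iff[of 1] by auto

lemma vabs_minus [simp]: "vabs (- x) = vabs x"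
proof -
  have "vabs (-1) * vabs (-1) = 1" using vabs_mult[of "-1" "-1"] by simp
  then have "vabs (-1) = 1" using vabs_nonneg[of "-1"] by (simp add: square_eq_1_iff)
  then show ?thesis using vabs_mult[of "-1" x] by simp
qed

lemma vabs_minus_commute: "vabs (x - y) = vabs (y - x)"
  using vabs_minus[of "x - y"] by simp

lemma vabs_add_le: "vabs x \<le> B \<Longrightarrow> vabs y \<le> B \<Longrightarrow> vabs (x + y) \<le> B"
  using vabs_add_le_max[of x y] by linarith

lemma vabs_diff_le: "vabs x \<le> B \<Longrightarrow> vabs y \<le> B \<Longrightarrow> vabs (x - y) \<le> B"
  using vabs_add_le[of x B "- y"] by simp

lemma vabs_diff_trans: "vabs (x - y) \<le> B \<Longrightarrow> vabs (y - z) \<le> B \<Longrightarrow> vabs (x - z) \<le> B"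
  using vabs_add_le[of "x - y" B "y - z"] by simp

lemma vabs_sum_le: "B \<ge> 0 \<Longrightarrow> (\<And>i. i \<in> I \<Longrightarrow> vabs (f i) \<le> B) \<Longrightarrow> vabs (sum f I) \<le> B"
  by (induction I rule: infinite_finite_induct) (auto intro: vabs_add_le)

lemma vabs_mult_le: "vabs x \<le> A \<Longrightarrow> vabs y \<le> B \<Longrightarrow> vabs (x * y) \<le> A * B"
  unfolding vabs_mult using order_trans[OF vabs_nonneg[of x]] by (intro mult_mono) auto

lemma vabs_mult_le_1: "vabs x \<le> 1 \<Longrightarrow> vabs y \<le> B \<Longrightarrow> vabs (x * y) \<le> B"
  using vabs_mult_le[of x 1 y B] by simp

lemma vabs_power: "vabs (x ^ n) = vabs x ^ n"
  by (induction n) (auto simp: vabs_mult)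

lemma vabs_inverse: "vabs (inverse x) = inverse (vabs x)"
proof (cases "x = 0")
  case False
  then have "vabs x * vabs (inverse x) = 1" by (simp flip: vabs_mult)
  then show ?thesis by (metis inverse_unique)
qed simp

lemma vabs_divide: "vabs (x / y) = vabs x / vabs y"
  by (simp add: divide_inverse vabs_mult vabs_inverse)

lemma vabs_of_nat_le_1: "vabs (of_nat n) \<le> 1"
  by (induction n) (auto intro: vabs_add_le)

lemma vabs_of_int_le_1: "vabs (of_int z) \<le> 1"
  using vabs_of_nat_le_1 by (cases z rule: int_cases2) auto

text \<open>In a Bezout relation u z + v p = 1 the second summand has absolute value at most 1/p, so
  by the ultrametric inequality the first one must reach 1.\<close>

lemma vabs_of_int_eq_1:
  assumes "\<not> int p dvd z"
  shows "vabs (of_int z) = 1"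
proof (rule antisym[OF vabs_of_int_le_1])
  have "coprime z (int p)"
    using prime_imp_coprime[of "int p" z] assms prime_p by (simp add: coprime_commute)
  then obtain u v where "u * z + v * int p = 1" using bezout_int[of z "int p"] by auto
  then have "(1 :: 'c) = of_int u * of_int z + of_int v * of_nat p"
    by (metis of_int_1 of_int_add of_int_mult of_int_of_nat_eq)
  then have "1 \<le> max (vabs (of_int u * of_int z)) (vabs (of_int v * of_nat p))"
    by (metis vabs_1 vabs_add_le_max)
  moreover have "vabs (of_int v * of_nat p) \<le> 1 / real p"
    using vabs_mult_le[OF vabs_of_int_le_1 order_refl, of v "of_nat p"] vabs_p by simp
  moreover have "1 / real p < 1" using p_gt_1 by simp
  ultimately have "1 \<le> vabs (of_int u * of_int z)" by linarith
  also have "\<dots> \<le> vabs (of_int z)" by (rule vabs_mult_le_1[OF vabs_of_int_le_1 order_refl])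
  finally show "1 \<le> vabs (of_int z)" .
qed

lemma vabs_of_nat_eq_1: "\<not> p dvd n \<Longrightarrow> vabs (of_nat n) = 1"
  using vabs_of_int_eq_1[of "int n"] by simp

lemma vabs_p_power: "vabs (of_nat (p ^ n)) = (1 / real p) ^ n"
  by (simp add: vabs_power vabs_p)

text \<open>The exact power of \<open>p\<close> in \<open>z\<close> determines the absolute value.
  This is the dictionary between congruences and inequalities.\<close>

lemma vabs_of_int_le_iff: "vabs (of_int z) \<le> (1 / real p) ^ n \<longleftrightarrow> int p ^ n dvd z"
proof
  assume "int p ^ n dvd z"
  then obtain w where "z = int p ^ n * w" by (elim dvdE)
  then have "vabs (of_int z) = vabs (of_nat (p ^ n)) * vabs (of_int w)"
    by (simp add: vabs_mult vabs_power)
  also have "\<dots> \<le> vabs (of_nat (p ^ n)) * 1" by (intro mult_left_mono vabs_of_int_le_1) simp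
  finally show "vabs (of_int z) \<le> (1 / real p) ^ n" by (simp only: vabs_p_power mult_1_right)
next
  assume le: "vabs (of_int z) \<le> (1 / real p) ^ n"
  show "int p ^ n dvd z"
  proof (cases "z = 0")
    case False
    have "\<not> is_unit (int p)" using p_gt_1 by auto
    then obtain w where w: "z = int p ^ multiplicity (int p) z * w" "\<not> int p dvd w"
      using False multiplicity_decompose' by metis
    define m where "m = multiplicity (int p) z"
    have "vabs (of_int z) = vabs (of_nat (p ^ m)) * vabs (of_int w)"
      by (subst w(1)) (simp add: vabs_mult vabs_power m_def)
    then have "(1 / real p) ^ m \<le> (1 / real p) ^ n"
      using le unfolding vabs_of_int_eq_1[OF w(2)] vabs_p_power by simp
    then have "n \<le> m" using p_gt_1 by (subst (asm) power_decreasing_iff) auto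
    then show ?thesis using w(1) unfolding m_def by (metis dvd_mult2 le_imp_power_dvd)
  qed simp
qed

lemma vabs_of_nat_diff_le_iff:
  "vabs (of_nat a - of_nat b) \<le> (1 / real p) ^ n \<longleftrightarrow> [a = b] (mod p ^ n)"
proof -
  have "vabs (of_nat a - of_nat b) = vabs (of_int (int a - int b))" by simp
  also have "\<dots> \<le> (1 / real p) ^ n \<longleftrightarrow> [a = b] (mod p ^ n)"
    unfolding vabs_of_int_le_iff by (simp add: cong_iff_dvd_diff flip: cong_int_iff)
  finally show ?thesis .
qed

section \<open>Limits in the p-adic field\<close>

lemma inverse_p_power_tendsto: "(\<lambda>n. (1 / real p) ^ n) \<longlonglongrightarrow> 0"
  using p_gt_1 by (intro LIMSEQ_power_zero) simp

lemma ex_inverse_p_power_less: "e > 0 \<Longrightarrow> \<exists>n. (1 / real p) ^ n < e"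
  using p_gt_1 real_arch_pow_inv[of e "1 / real p"] by simp

lemma tendsto_iff_vabs: "(f \<longlonglongrightarrow> l) \<longleftrightarrow> (\<lambda>n. vabs (f n - l)) \<longlonglongrightarrow> 0"
  by (subst tendsto_dist_iff) (simp add: dist_eq_vabs)

lemma tendsto_vabsI: "(\<And>n. vabs (f n - l) \<le> h n) \<Longrightarrow> h \<longlonglongrightarrow> 0 \<Longrightarrow> f \<longlonglongrightarrow> l"
  unfolding tendsto_iff_vabs by (rule real_tendsto_sandwich[OF _ _ tendsto_const]) auto

text \<open>The sort of \<open>'c\<close> supplies a metric but says nothing on continuity of the
  ring operations, so the limit laws are drawn from the absolute value.\<close>

lemma tendsto_padic_add:
  fixes f g :: "nat \<Rightarrow> 'c"
  assumes "f \<longlonglongrightarrow> l" "g \<longlonglongrightarrow> m"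
  shows "(\<lambda>n. f n + g n) \<longlonglongrightarrow> l + m"
proof (rule tendsto_vabsI)
  show "vabs (f n + g n - (l + m)) \<le> vabs (f n - l) + vabs (g n - m)" for n
    using vabs_add_le_max[of "f n - l" "g n - m"] vabs_nonneg[of "f n - l"] vabs_nonneg[of "g n - m"]
    unfolding add_diff_add by linarith
  show "(\<lambda>n. vabs (f n - l) + vabs (g n - m)) \<longlonglongrightarrow> 0"
    using tendsto_add[of "\<lambda>n. vabs (f n - l)" 0 sequentially] assms unfolding tendsto_iff_vabs by fastforce
qed

lemma tendsto_padic_cmult:
  fixes f :: "nat \<Rightarrow> 'c"
  assumes "f \<longlonglongrightarrow> l"
  shows "(\<lambda>n. c * f n) \<longlonglongrightarrow> c * l"
proof (rule tendsto_vabsI)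
  show "vabs (c * f n - c * l) \<le> vabs c * vabs (f n - l)" for n
    by (simp add: vabs_mult flip: right_diff_distrib)
  show "(\<lambda>n. vabs c * vabs (f n - l)) \<longlonglongrightarrow> 0"
    using assms unfolding tendsto_iff_vabs by (rule tendsto_mult_right_zero)
qed

lemma tendsto_padic_mult:
  fixes f g :: "nat \<Rightarrow> 'c"
  assumes "f \<longlonglongrightarrow> l" "g \<longlonglongrightarrow> m" "\<And>n. vabs (g n) \<le> 1"
  shows "(\<lambda>n. f n * g n) \<longlonglongrightarrow> l * m"
proof (rule tendsto_vabsI)
  show "vabs (f n * g n - l * m) \<le> vabs (f n - l) + vabs l * vabs (g n - m)" for n
  proof -
    have "f n * g n - l * m = g n * (f n - l) + l * (g n - m)" by (simp add: algebra_simps)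
    also have "vabs \<dots> \<le> max (vabs (g n * (f n - l))) (vabs (l * (g n - m)))" by (rule vabs_add_le_max)
    also have "\<dots> \<le> vabs (f n - l) + vabs l * vabs (g n - m)"
      using vabs_mult_le_1[OF assms(3)[of n] order_refl, of "f n - l"]
        vabs_nonneg[of "f n - l"] vabs_nonneg[of "l * (g n - m)"] unfolding vabs_mult by linarith
    finally show ?thesis .
  qed
  have "(\<lambda>n. vabs l * vabs (g n - m)) \<longlonglongrightarrow> 0"
    using assms(2) unfolding tendsto_iff_vabs by (rule tendsto_mult_right_zero)
  then show "(\<lambda>n. vabs (f n - l) + vabs l * vabs (g n - m)) \<longlonglongrightarrow> 0"
    using tendsto_add[of "\<lambda>n. vabs (f n - l)" 0 sequentially] assms(1) unfolding tendsto_iff_vabs by fastforce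
qed

lemma vabs_le_limit:
  assumes "f \<longlonglongrightarrow> l" "\<And>n. vabs (f n) \<le> B"
  shows "vabs l \<le> B"
proof -
  have "(\<lambda>n. dist (f n) 0) \<longlonglongrightarrow> dist l 0" by (intro tendsto_dist assms tendsto_const)
  then have "(\<lambda>n. vabs (f n)) \<longlonglongrightarrow> vabs l" by (simp add: dist_eq_vabs)
  then show ?thesis by (rule LIMSEQ_le_const2) (use assms(2) in auto)
qed

section \<open>p-adic integers, residues and units\<close>

lemma padic_integers_iff: "x \<in> (padic_integers :: 'c set) \<longleftrightarrow> (\<forall>e>0. \<exists>z. vabs (x - of_int z) < e)"
  unfolding padic_integers_def closure_approachable
  by (auto simp: Ints_def dist_eq_vabs vabs_minus_commute[of x])

lemma of_int_in_padic_integers [simp]: "of_int z \<in> (padic_integers :: 'c set)"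
  unfolding padic_integers_iff by (auto intro!: exI[of _ z])

lemma of_nat_in_padic_integers [simp]: "of_nat z \<in> (padic_integers :: 'c set)"
  using of_int_in_padic_integers[of "int z"] by simp

lemma vabs_padic_integer_le_1: "x \<in> padic_integers \<Longrightarrow> vabs x \<le> 1"
proof -
  assume "x \<in> padic_integers"
  then obtain z where "vabs (x - of_int z) < 1" unfolding padic_integers_iff by force
  then have "vabs (x - of_int z + of_int z) \<le> 1" by (intro vabs_add_le vabs_of_int_le_1) simp
  then show ?thesis by simp
qed

lemma padic_integer_approx:
  assumes "x \<in> padic_integers"
  obtains a where "a < p ^ n" "vabs (x - of_nat a) \<le> (1 / real p) ^ n"
proof -
  have "(1 / real p) ^ n > 0" using p_gt_1 by simp
  then obtain z where z: "vabs (x - of_int z) < (1 / real p) ^ n"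
    using assms unfolding padic_integers_iff by blast
  define a where "a = nat (z mod int (p ^ n))"
  have pos: "int (p ^ n) > 0" using p_gt_1 by simp
  then have a: "int a = z mod int (p ^ n)" unfolding a_def by simp
  have "a < p ^ n" using pos a pos_mod_bound[OF pos, of z] by linarith
  moreover have "vabs (of_int (z - int a)) \<le> (1 / real p) ^ n"
    unfolding vabs_of_int_le_iff a by (simp add: minus_mod_eq_mult_div)
  then have "vabs (x - of_nat a) \<le> (1 / real p) ^ n"
    using z vabs_diff_trans[of x "of_int z" _ "of_nat a"] by simp
  ultimately show ?thesis by (rule that)
qed

lemma padic_integer_divide:
  assumes "x \<in> padic_integers" "vabs (x - of_nat a) \<le> (1 / real p) ^ n"
  shows "\<exists>z\<in>padic_integers. x - of_nat a = of_nat (p ^ n) * z"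
proof (intro bexI)
  have nz: "(of_nat (p ^ n) :: 'c) \<noteq> 0" using p_gt_1 by simp
  then show "x - of_nat a = of_nat (p ^ n) * ((x - of_nat a) / of_nat (p ^ n))" by simp
  show "(x - of_nat a) / of_nat (p ^ n) \<in> padic_integers"
    unfolding padic_integers_iff
  proof (intro allI impI)
    fix e :: real assume "e > 0"
    have pn: "(1 / real p) ^ n > 0" using p_gt_1 by simp
    \<comment> \<open>The first bound survives division by p^n; the second makes \<open>w\<close>
      congruent to \<open>a\<close> modulo p^n, so that (w - a)/p^n is an integer near the
      quotient.\<close>
    then obtain w where w: "vabs (x - of_int w) < min (e * (1 / real p) ^ n) ((1 / real p) ^ n)"
      using assms(1) \<open>e > 0\<close> unfolding padic_integers_iff by (metis mult_pos_pos min_less_iff_conj)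
    then have "vabs (of_int (w - int a)) \<le> (1 / real p) ^ n"
      using vabs_diff_trans[of "of_int w" x "(1 / real p) ^ n" "of_nat a"] assms(2)
      by (simp add: vabs_minus_commute[of "of_int w"])
    then obtain v where "w - int a = int p ^ n * v" unfolding vabs_of_int_le_iff by (elim dvdE)
    then have "(of_int w :: 'c) = of_nat a + of_nat (p ^ n) * of_int v"
      by (metis diff_add_cancel add.commute of_int_add of_int_mult of_int_of_nat_eq of_nat_power)
    then have "(x - of_nat a) / of_nat (p ^ n) - of_int v = (x - of_int w) / of_nat (p ^ n)"
      using nz by (simp add: field_simps)
    then have "vabs ((x - of_nat a) / of_nat (p ^ n) - of_int v) < e"
      using w pn by (simp add: vabs_divide vabs_p_power pos_divide_less_eq del: of_nat_power)
    then show "\<exists>z. vabs ((x - of_nat a) / of_nat (p ^ n) - of_int z) < e" by blast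
  qed
qed

text \<open>Turns the description in \<open>padic_residue\<close> into an inequality: two candidates
  within p^(-n) of \<open>x\<close> are congruent modulo p^n, hence equal in the given
  range.\<close>

lemma padic_residue_eqI:
  assumes "x \<in> padic_integers" "a < p ^ n" "vabs (x - of_nat a) \<le> (1 / real p) ^ n"
  shows "padic_residue p n x = a"
  unfolding padic_residue_def
proof (rule the_equality)
  show "a < p ^ n \<and> (\<exists>z\<in>padic_integers. x - of_nat a = of_nat (p ^ n) * z)"
    using assms padic_integer_divide by blast
  fix b assume b: "b < p ^ n \<and> (\<exists>z\<in>padic_integers. x - of_nat b = of_nat (p ^ n) * z)"
  then obtain z where "z \<in> padic_integers" "x - of_nat b = of_nat (p ^ n) * z" by blast
  then have "vabs (x - of_nat b) \<le> (1 / real p) ^ n * 1"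
    using vabs_mult_le[OF order_refl vabs_padic_integer_le_1, of z "of_nat (p ^ n)"] by (simp only: vabs_p_power)
  then have "vabs (of_nat b - of_nat a) \<le> (1 / real p) ^ n"
    using vabs_diff_trans[of "of_nat b" x _ "of_nat a"] assms(3) by (simp add: vabs_minus_commute[of x])
  then show "b = a" using b assms(2) unfolding vabs_of_nat_diff_le_iff by (simp add: cong_def)
qed

lemma padic_residue:
  assumes "x \<in> (padic_integers :: 'c set)"
  shows "padic_residue p n x < p ^ n" "vabs (x - of_nat (padic_residue p n x)) \<le> (1 / real p) ^ n"
  using padic_integer_approx[OF assms, of n] padic_residue_eqI[OF assms, of _ n] by metis+

lemma padic_residue_of_nat: "padic_residue p n (of_nat a :: 'c) = a mod p ^ n"
  using p_gt_1 by (intro padic_residue_eqI) (auto simp: vabs_of_nat_diff_le_iff cong_def)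

lemma padic_residue_1: "padic_residue p n (1 :: 'c) = 1 mod p ^ n"
  using padic_residue_of_nat[of n 1] by simp

lemma padic_residue_mod:
  assumes "x \<in> (padic_integers :: 'c set)" "n \<le> m"
  shows "padic_residue p m x mod p ^ n = padic_residue p n x"
proof (rule padic_residue_eqI[OF assms(1), symmetric])
  have "vabs (x - of_nat (padic_residue p m x)) \<le> (1 / real p) ^ n"
    by (rule order_trans[OF padic_residue(2)[OF assms(1)] power_decreasing[OF assms(2)]]) (use p_gt_1 in auto)
  moreover have "vabs (of_nat (padic_residue p m x) - of_nat (padic_residue p m x mod p ^ n)) \<le> (1 / real p) ^ n"
    unfolding vabs_of_nat_diff_le_iff by (simp add: cong_def)
  ultimately show "vabs (x - of_nat (padic_residue p m x mod p ^ n)) \<le> (1 / real p) ^ n"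
    by (rule vabs_diff_trans)
qed (use p_gt_1 in auto)

lemma padic_unitD:
  assumes "x \<in> (padic_units :: 'c set)"
  shows "x \<in> padic_integers" "coprime (padic_residue p n x) (p ^ n)"
proof -
  show x: "x \<in> padic_integers" using assms by (simp add: padic_units_def)
  obtain y where y: "y \<in> padic_integers" "x * y = 1" using assms by (auto simp: padic_units_def)
  let ?a = "padic_residue p n x" and ?b = "padic_residue p n y"
  \<comment> \<open>The residues of a unit and of its inverse are inverse to each other modulo
    p^n.\<close>
  have "of_nat (?a * ?b) - of_nat 1 = of_nat ?b * (of_nat ?a - x) + x * (of_nat ?b - y)"
    using y(2) by (simp add: algebra_simps)
  also have "vabs \<dots> \<le> (1 / real p) ^ n"
    using padic_residue(2)[OF x, of n] padic_residue(2)[OF y(1), of n]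
    by (intro vabs_add_le vabs_mult_le_1 vabs_of_nat_le_1 vabs_padic_integer_le_1 x)
      (simp_all only: vabs_minus_commute)
  finally have "[?a * ?b = 1] (mod p ^ n)" unfolding vabs_of_nat_diff_le_iff .
  then show "coprime (padic_residue p n x) (p ^ n)"
    using coprime_iff_invertible_nat by auto
qed

text \<open>The geometric series for 1/(1 + p^n) has integer partial sums, so the inverse lies in
  the closure of the integers.\<close>

lemma one_plus_p_power_in_padic_units:
  assumes "n > 0"
  shows "(of_nat (1 + p ^ n) :: 'c) \<in> padic_units"
proof -
  define P where "P = (of_nat (p ^ n) :: 'c)"
  have "vabs P < 1" unfolding P_def vabs_p_power using p_gt_1 assms by (simp add: power_less_one_iff)
  have "vabs (1 + P) = 1"
  proof -
    have "\<not> p dvd 1 + p ^ n" using assms prime_p by (metis dvd_add_left_iff dvd_power not_prime_unit)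
    from vabs_of_nat_eq_1[OF this] show ?thesis by (simp add: P_def)
  qed
  then have nz: "1 + P \<noteq> 0" by auto
  have "inverse (1 + P) \<in> padic_integers"
    unfolding padic_integers_iff
  proof (intro allI impI)
    fix e :: real assume "e > 0"
    then obtain m where m: "vabs P ^ m < e"
      using real_arch_pow_inv[OF _ \<open>vabs P < 1\<close>] by blast
    define z where "z = (\<Sum>i<m. (- int (p ^ n)) ^ i)"
    have "of_int z = (\<Sum>i<m. (- P) ^ i)" by (simp add: z_def P_def)
    then have "(1 + P) * of_int z = 1 - (- P) ^ m"
      using one_diff_power_eq[of "- P" m] by simp
    then have "inverse (1 + P) - of_int z = (- P) ^ m / (1 + P)"
      using nz by (simp add: field_simps)
    then have "vabs (inverse (1 + P) - of_int z) = vabs P ^ m"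
      by (simp add: vabs_divide vabs_power \<open>vabs (1 + P) = 1\<close>)
    then show "\<exists>z. vabs (inverse (1 + P) - of_int z) < e" using m by (intro exI[of _ z]) simp
  qed
  moreover have "of_nat (1 + p ^ n) = 1 + P" by (simp add: P_def)
  ultimately show ?thesis using nz of_nat_in_padic_integers[of "1 + p ^ n"]
    unfolding padic_units_def by (metis (mono_tags, lifting) mem_Collect_eq right_inverse)
qed

end

section \<open>Polynomial approximation of periodic functions\<close>

text \<open>Binomial expansion of (E - 1)^m with E the shift by 1; the induction step is Pascal's
  rule.\<close>

lemma step_diff_pow_eq:
  fixes f :: "nat \<Rightarrow> 'a::comm_ring_1"
  shows "(step_diff 1 ^^ m) f x = (\<Sum>j\<le>m. (-1) ^ (m - j) * of_nat (m choose j) * f (x + j))"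
proof (induction m arbitrary: x)
  case (Suc m)
  have "(\<Sum>j\<le>Suc m. (-1) ^ (Suc m - j) * of_nat (Suc m choose j) * f (x + j)) =
      (-1) ^ Suc m * f x + (\<Sum>j\<le>m. (-1) ^ (m - j) * of_nat (Suc m choose Suc j) * f (x + Suc j))"
    by (subst sum.atMost_Suc_shift) simp
  also have "(\<Sum>j\<le>m. (-1) ^ (m - j) * of_nat (Suc m choose Suc j) * f (x + Suc j)) =
      (\<Sum>j\<le>m. (-1) ^ (m - j) * of_nat (m choose j) * f (Suc x + j)) +
      (\<Sum>j\<le>m. (-1) ^ (m - j) * of_nat (m choose Suc j) * f (x + Suc j))"
    by (simp add: algebra_simps sum.distrib)
  also have "(\<Sum>j\<le>m. (-1) ^ (m - j) * of_nat (m choose Suc j) * f (x + Suc j)) =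
      (\<Sum>j<m. (-1) ^ (m - j) * of_nat (m choose Suc j) * f (x + Suc j))"
    by (simp add: lessThan_Suc_atMost[symmetric] binomial_eq_0)
  also have "\<dots> = - (\<Sum>j<m. (-1) ^ (m - Suc j) * of_nat (m choose Suc j) * f (x + Suc j))"
    unfolding sum_negf[symmetric]
    by (intro sum.cong refl) (simp add: Suc_diff_Suc[symmetric])
  also have "\<dots> = (-1) ^ m * f x - (\<Sum>j\<le>m. (-1) ^ (m - j) * of_nat (m choose j) * f (x + j))"
    by (simp add: sum.atMost_shift)
  finally show ?case using Suc.IH[of x] Suc.IH[of "Suc x"] by (simp add: step_diff_def)
qed simp

text \<open>From j C(p^N, j) = p^N C(p^N - 1, j - 1): if \<open>p\<close> did not divide the
  coefficient, p^N would divide \<open>j\<close>.\<close>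

lemma prime_dvd_prime_power_choose:
  fixes p :: nat
  assumes "Factorial_Ring.prime p" "0 < j" "j < p ^ N"
  shows "p dvd (p ^ N choose j)"
proof (rule ccontr)
  assume "\<not> p dvd (p ^ N choose j)"
  then have "coprime (p ^ N) (p ^ N choose j)"
    using assms(1) by (simp add: prime_imp_coprime)
  moreover have "p ^ N dvd j * (p ^ N choose j)"
    using times_binomial_minus1_eq[OF assms(2), of "p ^ N"] by simp
  ultimately have "p ^ N dvd j" by (simp add: coprime_dvd_mult_left_iff)
  then show False using assms(2,3) by (auto dest: dvd_imp_le)
qed

lemma ex_poly_binomial:
  "\<exists>P :: 'a::field_char_0 poly. \<forall>x. poly P (of_nat x) = of_nat (x choose j)"
proof (induction j)
  case 0
  show ?case by (intro exI[of _ 1]) simp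
next
  case (Suc j)
  then obtain P :: "'a poly" where P: "\<And>x. poly P (of_nat x) = of_nat (x choose j)" by blast
  \<comment> \<open>C(x, j + 1) = C(x, j) (x - j)/(j + 1).\<close>
  have "poly (Polynomial.smult (1 / of_nat (Suc j)) (P * [:- of_nat j, 1:])) (of_nat x) = of_nat (x choose Suc j)" for x
  proof -
    have "of_nat x * of_nat (x choose j) =
        (of_nat j * of_nat (x choose j) + of_nat (Suc j) * of_nat (x choose Suc j) :: 'a)"
      unfolding binomial_gbinomial by (rule gbinomial_mult_1)
    then have "of_nat (x choose j) * (of_nat x - of_nat j) / of_nat (Suc j) = (of_nat (x choose Suc j) :: 'a)"
      by (simp add: divide_eq_eq del: of_nat_Suc) (simp add: algebra_simps)
    moreover have "poly [:- of_nat j, 1:] (of_nat x) = (of_nat x - of_nat j :: 'a)" by simp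
    ultimately show ?thesis by (simp only: poly_smult poly_mult P) (simp only: divide_inverse mult_1_left mult_ac)
  qed
  then show ?case by blast
qed

context complex_padic_field
begin

text \<open>The difference is the remainder in Newton's forward difference formula. By Pascal's rule
  the remainder of order J + 1 at x + 1 is the one at x plus the remainder of order J of the
  differenced function at x. So an induction on \<open>J\<close> over all \<open>f\<close> contains
  one on \<open>x\<close>, and the ultrametric inequality keeps the bound at
  \<open>e\<close>.\<close>

lemma vabs_diff_newton_le:
  fixes f :: "nat \<Rightarrow> 'c"
  assumes "\<And>x. vabs ((step_diff 1 ^^ J) f x) \<le> e"
  shows "vabs (f x - (\<Sum>j<J. (step_diff 1 ^^ j) f 0 * of_nat (x choose j))) \<le> e"
  using assms
proof (induction J arbitrary: f x)
  case (Suc J)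
  note IH = Suc.IH and prems = Suc.prems
  have e: "e \<ge> 0" using Suc.prems[of 0] vabs_nonneg order_trans by blast
  show ?case
  proof (induction x)
    case 0
    \<comment> \<open>At 0 only the term j = 0 survives, and the remainder is 0.\<close>
    show ?case using e by (subst sum.lessThan_Suc_shift) simp
  next
    case (Suc x)
    have "(\<Sum>j<Suc J. (step_diff 1 ^^ j) f 0 * of_nat (Suc x choose j)) =
        (\<Sum>j<Suc J. (step_diff 1 ^^ j) f 0 * of_nat (x choose j)) +
        (\<Sum>j<J. (step_diff 1 ^^ j) (step_diff 1 f) 0 * of_nat (x choose j))"
      unfolding sum.lessThan_Suc_shift
      by (simp add: sum.distrib algebra_simps funpow_Suc_right del: funpow.simps)
    then have "f (Suc x) - (\<Sum>j<Suc J. (step_diff 1 ^^ j) f 0 * of_nat (Suc x choose j)) =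
        (f x - (\<Sum>j<Suc J. (step_diff 1 ^^ j) f 0 * of_nat (x choose j))) +
        (step_diff 1 f x - (\<Sum>j<J. (step_diff 1 ^^ j) (step_diff 1 f) 0 * of_nat (x choose j)))"
      by (simp add: step_diff_def)
    moreover have "vabs ((step_diff 1 f) x - (\<Sum>j<J. (step_diff 1 ^^ j) (step_diff 1 f) 0 * of_nat (x choose j))) \<le> e"
      by (rule IH[of "step_diff 1 f" x]) (use prems in \<open>simp add: funpow_Suc_right del: funpow.simps\<close>)
    ultimately show ?case using Suc.IH by (simp only: vabs_add_le)
  qed
qed simp

text \<open>In (E - 1)^q with q = p^N the inner binomial coefficients are divisible by
  \<open>p\<close>, and the two outer terms cancel by periodicity, having opposite signs since
  \<open>q\<close> is odd.\<close>

lemma vabs_step_diff_periodic_le: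
  fixes f :: "nat \<Rightarrow> 'c"
  assumes "odd p" and per: "\<And>x. f (x + p ^ N) = f x" and "\<And>x. vabs (f x) \<le> B"
  shows "vabs ((step_diff 1 ^^ (p ^ N)) f x) \<le> B / real p"
proof -
  define q where "q = p ^ N"
  have q: "q > 0" "odd q" using p_gt_1 assms(1) by (auto simp: q_def)
  have B: "B \<ge> 0" using assms(3)[of 0] vabs_nonneg order_trans by blast
  have "{..q} = insert 0 (insert q {0<..<q})" using q by auto
  then have "(step_diff 1 ^^ q) f x = f (x + q) - f x +
      (\<Sum>j\<in>{0<..<q}. (-1) ^ (q - j) * of_nat (q choose j) * f (x + j))"
    using q unfolding step_diff_pow_eq by simp
  also have "\<dots> = (\<Sum>j\<in>{0<..<q}. (-1) ^ (q - j) * of_nat (q choose j) * f (x + j))"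
    using per[of x] by (simp add: q_def)
  also have "vabs \<dots> \<le> B / real p"
  proof (rule vabs_sum_le)
    fix j assume "j \<in> {0<..<q}"
    then have "p dvd (q choose j)"
      using prime_dvd_prime_power_choose[OF prime_p, of j N] by (simp add: q_def)
    then have "vabs (of_int (int (q choose j))) \<le> (1 / real p) ^ 1"
      unfolding vabs_of_int_le_iff by simp
    then have "vabs ((-1) ^ (q - j) * (of_nat (q choose j) * f (x + j))) \<le> 1 * (1 / real p * B)"
      by (intro vabs_mult_le assms) (simp_all add: vabs_power)
    then show "vabs ((-1) ^ (q - j) * of_nat (q choose j) * f (x + j)) \<le> B / real p"
      by (simp add: mult.assoc)
  qed (use B in simp)
  finally show ?thesis by (simp add: q_def)
qed

text \<open>Differences of a periodic function are periodic, so the gain of 1/p can be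
  repeated.\<close>

lemma vabs_step_diff_periodic_pow_le:
  fixes f :: "nat \<Rightarrow> 'c"
  assumes "odd p" and per: "\<And>x. f (x + p ^ N) = f x" and "\<And>x. vabs (f x) \<le> B"
  shows "vabs ((step_diff 1 ^^ (p ^ N * M)) f x) \<le> B * (1 / real p) ^ M"
  using per assms(3)
proof (induction M arbitrary: f B x)
  case (Suc M)
  have "vabs ((step_diff 1 ^^ (p ^ N * M)) ((step_diff 1 ^^ (p ^ N)) f) x) \<le> B / real p * (1 / real p) ^ M"
  proof (rule Suc.IH)
    show "(step_diff 1 ^^ (p ^ N)) f (x + p ^ N) = (step_diff 1 ^^ (p ^ N)) f x" for x
      using fun_cong[OF step_diff_pow_shift[of "p ^ N" 1 f "p ^ N"], of x] Suc.prems(1) by simp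
    show "vabs ((step_diff 1 ^^ (p ^ N)) f x) \<le> B / real p" for x
      by (rule vabs_step_diff_periodic_le) (fact assms(1) Suc.prems)+
  qed
  moreover have "p ^ N * Suc M = p ^ N * M + p ^ N" by simp
  ultimately show ?case by (simp only: funpow_add o_apply) simp
qed simp

lemma periodic_poly_approx:
  fixes f :: "nat \<Rightarrow> 'c"
  assumes "odd p" and per: "\<And>x. f (x + p ^ N) = f x" and bd: "\<And>x. vabs (f x) \<le> 1" and "e > 0"
  obtains P :: "'c poly" where "\<And>x. vabs (f x - poly P (of_nat x)) \<le> e"
proof -
  obtain M where M: "(1 / real p) ^ M < e" using ex_inverse_p_power_less \<open>e > 0\<close> by blast
  \<comment> \<open>Differences of this order are at most p^(-M), hence below \<open>e\<close>, and
    Newton's formula is cut off there.\<close>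
  define J where "J = p ^ N * M"
  obtain b :: "nat \<Rightarrow> 'c poly" where b: "\<And>j x. poly (b j) (of_nat x) = of_nat (x choose j)"
    using ex_poly_binomial[where 'a = 'c] by metis
  define P where "P = (\<Sum>j<J. Polynomial.smult ((step_diff 1 ^^ j) f 0) (b j))"
  have "vabs ((step_diff 1 ^^ J) f x) \<le> e" for x
    using vabs_step_diff_periodic_pow_le[of f N 1 M x, OF assms(1) per bd] M by (simp add: J_def)
  from vabs_diff_newton_le[OF this] have "vabs (f x - poly P (of_nat x)) \<le> e" for x
    by (simp add: P_def poly_sum b)
  then show ?thesis by (rule that)
qed

lemma vabs_smoothing_le_1: "vabs (smoothing g m) \<le> 1"
  unfolding smoothing_def by (auto intro: vabs_diff_le vabs_of_nat_le_1)

text \<open>All divisions are by powers of \<open>g\<close>, which have absolute value 1. The bound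
  is uniform in \<open>J\<close>, which has to grow with the degree of the approximating
  polynomial.\<close>

lemma vabs_euler_sum_le:
  fixes f :: "nat \<Rightarrow> 'c"
  assumes "vabs (of_nat g) = 1" and f: "\<And>m. vabs (f m) \<le> B"
  shows "vabs (euler_sum q g J f) \<le> B"
proof -
  have B: "B \<ge> 0" using f[of 0] vabs_nonneg order_trans by blast
  have "vabs ((stride_sum q g ^^ i) f m) \<le> B" for i m
    by (induction i arbitrary: m) (auto simp: stride_sum_def[of _ _ "(_ ^^ _) _"] intro!: vabs_sum_le f B)
  then show ?thesis unfolding euler_sum_def ramp_sum_def
    using assms(1) by (auto intro!: vabs_sum_le B simp: vabs_divide vabs_mult vabs_power)
qed

end

section \<open>Field embeddings and Dirichlet characters\<close>

context
  fixes \<sigma> :: "'a::field \<Rightarrow> 'b::field"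
  assumes emb: "field_embedding \<sigma>"
begin

lemma field_embedding_add: "\<sigma> (x + y) = \<sigma> x + \<sigma> y"
  and field_embedding_mult: "\<sigma> (x * y) = \<sigma> x * \<sigma> y"
  and field_embedding_1: "\<sigma> 1 = 1"
  using emb unfolding field_embedding_def ring_hom_def ring_of_type_algebra_def by auto

lemma field_embedding_0: "\<sigma> 0 = 0"
  using field_embedding_add[of 0 0] by (metis add_0_right add_left_cancel)

lemma field_embedding_minus: "\<sigma> (- x) = - \<sigma> x"
  using field_embedding_add[of x "- x"] by (simp add: field_embedding_0 eq_neg_iff_add_eq_0 add.commute)

lemma field_embedding_diff: "\<sigma> (x - y) = \<sigma> x - \<sigma> y"
  using field_embedding_add[of x "- y"] by (simp add: field_embedding_minus)

lemma field_embedding_inverse: "\<sigma> (inverse x) = inverse (\<sigma> x)"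
proof (cases "x = 0")
  case False
  then have "\<sigma> x * \<sigma> (inverse x) = 1" by (simp add: field_embedding_1 flip: field_embedding_mult)
  then show ?thesis by (metis inverse_unique)
qed (simp add: field_embedding_0)

lemma field_embedding_divide: "\<sigma> (x / y) = \<sigma> x / \<sigma> y"
  by (simp add: divide_inverse field_embedding_mult field_embedding_inverse)

lemma field_embedding_eq_0_iff: "\<sigma> x = 0 \<longleftrightarrow> x = 0"
  by (metis field_embedding_0 field_embedding_1 field_embedding_mult mult_zero_left right_inverse zero_neq_one)

lemma field_embedding_inj: "inj \<sigma>"
  by (intro injI) (metis field_embedding_diff field_embedding_eq_0_iff right_minus_eq)

lemma field_embedding_of_nat: "\<sigma> (of_nat n) = of_nat n"
  by (induction n) (simp_all add: field_embedding_0 field_embedding_1 field_embedding_add)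

lemma field_embedding_power: "\<sigma> (x ^ n) = \<sigma> x ^ n"
  by (induction n) (simp_all add: field_embedding_1 field_embedding_mult)

lemma field_embedding_sum: "\<sigma> (sum f I) = (\<Sum>i\<in>I. \<sigma> (f i))"
  by (induction I rule: infinite_finite_induct) (simp_all add: field_embedding_0 field_embedding_add)

lemma field_embedding_smoothing: "\<sigma> (smoothing g m) = smoothing g m"
  by (simp add: smoothing_def field_embedding_diff field_embedding_1 field_embedding_of_nat)

lemma field_embedding_euler_sum: "\<sigma> (euler_sum q g J f) = euler_sum q g J (\<lambda>m. \<sigma> (f m))"
proof -
  have "\<sigma> ((stride_sum q g ^^ i) f m) = (stride_sum q g ^^ i) (\<lambda>m. \<sigma> (f m)) m" for i m
    by (induction i arbitrary: m) (simp_all add: stride_sum_def[of _ _ "(_ ^^ _) _"] field_embedding_sum)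
  then show ?thesis
    by (simp add: euler_sum_def ramp_sum_def field_embedding_sum field_embedding_divide
        field_embedding_mult field_embedding_power field_embedding_of_nat)
qed

end

text \<open>Over an algebraically closed source \<open>P\<close> splits, and linear factors are
  removed one at a time. The aim is to place roots of unity in the range of the embedding, where
  \<open>complex_to_padic\<close> has a meaning.\<close>

lemma root_in_range_field_embedding:
  fixes \<sigma> :: "'a::alg_closed_field \<Rightarrow> 'b::field"
  assumes emb: "field_embedding \<sigma>" and "P \<noteq> 0" and "poly (map_poly \<sigma> P) z = 0"
  shows "z \<in> range \<sigma>"
  using assms(2,3)
proof (induction "Polynomial.degree P" arbitrary: P rule: less_induct)
  case less
  note [simp] = field_embedding_0[OF emb] field_embedding_1[OF emb] field_embedding_eq_0_iff[OF emb]
  have diff: "map_poly \<sigma> (A - B) = map_poly \<sigma> A - map_poly \<sigma> B" for A B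
    by (intro poly_eqI) (simp add: coeff_map_poly field_embedding_diff[OF emb])
  have smult: "map_poly \<sigma> (Polynomial.smult c A) = Polynomial.smult (\<sigma> c) (map_poly \<sigma> A)" for c A
    by (intro poly_eqI) (simp add: coeff_map_poly field_embedding_mult[OF emb])
  show ?case
  proof (cases "Polynomial.degree P = 0")
    case True
    then obtain c where "P = [:c:]" by (elim degree_eq_zeroE)
    then show ?thesis using less.prems by (simp add: map_poly_pCons)
  next
    case False
    then obtain r where "poly P r = 0" using alg_closed_imp_poly_has_root[of P] by auto
    then obtain Q where Q: "P = [:- r, 1:] * Q" unfolding poly_eq_0_iff_dvd by (elim dvdE)
    then have "Q \<noteq> 0" using less.prems(1) by auto
    have "map_poly \<sigma> P = Polynomial.smult (- \<sigma> r) (map_poly \<sigma> Q) + pCons 0 (map_poly \<sigma> Q)"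
      unfolding Q by (simp add: diff smult map_poly_pCons)
    then have "poly (map_poly \<sigma> P) z = - \<sigma> r * poly (map_poly \<sigma> Q) z + z * poly (map_poly \<sigma> Q) z"
      by simp
    also have "\<dots> = (z - \<sigma> r) * poly (map_poly \<sigma> Q) z" by (simp add: left_diff_distrib)
    finally have "(z - \<sigma> r) * poly (map_poly \<sigma> Q) z = 0"
      using less.prems(2) by (simp only:)
    then show ?thesis
    proof (cases "z = \<sigma> r")
      case False
      have "Polynomial.degree Q < Polynomial.degree P" unfolding Q using \<open>Q \<noteq> 0\<close> by (subst degree_mult_eq) auto
      moreover have "poly (map_poly \<sigma> Q) z = 0"
        using False \<open>(z - \<sigma> r) * poly (map_poly \<sigma> Q) z = 0\<close> by simp
      ultimately show ?thesis using less.hyps \<open>Q \<noteq> 0\<close> by blast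
    qed simp
  qed
qed

lemma root_of_unity_in_range_field_embedding:
  fixes \<sigma> :: "'a::alg_closed_field \<Rightarrow> 'b::field"
  assumes emb: "field_embedding \<sigma>" and "z ^ m = 1" "m > 0"
  shows "z \<in> range \<sigma>"
proof (rule root_in_range_field_embedding[OF emb])
  show "Polynomial.monom 1 m - 1 \<noteq> (0 :: 'a poly)"
    using \<open>m > 0\<close> by (auto simp: poly_eq_iff coeff_pCons dest!: spec[of _ m])
  have "map_poly \<sigma> (Polynomial.monom 1 m - 1) = Polynomial.monom 1 m - 1"
    using field_embedding_0[OF emb] field_embedding_1[OF emb] field_embedding_diff[OF emb]
    by (intro poly_eqI) (simp add: coeff_map_poly)
  then show "poly (map_poly \<sigma> (Polynomial.monom 1 m - 1)) z = 0"
    using assms(2) by (simp add: poly_monom)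
qed

lemma complex_to_padic_embedding:
  "field_embedding \<iota>\<^sub>C \<Longrightarrow> complex_to_padic \<iota>\<^sub>C \<iota>\<^sub>p (\<iota>\<^sub>C x) = \<iota>\<^sub>p x"
  by (simp add: complex_to_padic_def field_embedding_inj)

section \<open>Values of Dirichlet characters: zero or roots of unity\<close>

lemma dirichlet_character_1: "dirichlet_character m chi \<Longrightarrow> chi 1 = 1"
proof -
  assume chi: "dirichlet_character m chi"
  then have "chi (1 * 1) = chi 1 * chi 1" "chi 1 \<noteq> 0"
    unfolding dirichlet_character_def by (blast, auto)
  then show ?thesis by simp
qed

lemma dirichlet_character_mod: "dirichlet_character m chi \<Longrightarrow> chi (a mod m) = chi a"
proof -
  assume chi: "dirichlet_character m chi"
  have "chi (b + m * i) = chi b" for b i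
  proof (induction i)
    case (Suc i)
    have "chi (b + m * i + m) = chi (b + m * i)" using chi unfolding dirichlet_character_def by blast
    then show ?case using Suc by (simp add: algebra_simps)
  qed simp
  from this[of "a mod m" "a div m"] show ?thesis by simp
qed

lemma dirichlet_character_power_totient:
  assumes chi: "dirichlet_character m chi" and "coprime a m"
  shows "chi a ^ totient m = 1"
proof -
  have "chi (a ^ i) = chi a ^ i" for i
    using chi dirichlet_character_1[OF chi] unfolding dirichlet_character_def by (induction i) auto
  then have "chi a ^ totient m = chi (a ^ totient m mod m)" by (simp add: dirichlet_character_mod[OF chi])
  also have "a ^ totient m mod m = 1 mod m" using euler_theorem[OF assms(2)] by (simp add: cong_def)
  finally show ?thesis by (simp only: dirichlet_character_mod[OF chi] dirichlet_character_1[OF chi])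
qed

lemma norm_dirichlet_character_le_1:
  assumes chi: "dirichlet_character m chi"
  shows "norm (chi a) \<le> 1"
proof (cases "coprime a m")
  case True
  have "m > 0" using chi by (simp add: dirichlet_character_def)
  have "norm (chi a) ^ totient m = 1"
    using dirichlet_character_power_totient[OF chi True] by (metis norm_one norm_power)
  moreover have "totient m > 0" using \<open>m > 0\<close> by simp
  ultimately show ?thesis by (metis not_le one_less_power order_less_irrefl)
next
  case False
  then have "chi a = 0" using chi unfolding dirichlet_character_def by blast
  then show ?thesis by simp
qed

lemma dirichlet_character_in_range:
  fixes \<iota> :: "'a::alg_closed_field \<Rightarrow> complex"
  assumes chi: "dirichlet_character m chi" and "field_embedding \<iota>"
  shows "chi a \<in> range \<iota>"
proof (cases "coprime a m")
  case True
  have "m > 0" using chi by (simp add: dirichlet_character_def)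
  then show ?thesis
    using root_of_unity_in_range_field_embedding[OF assms(2) dirichlet_character_power_totient[OF chi True]] by simp
next
  case False
  then have "chi a = \<iota> 0" using chi by (simp add: dirichlet_character_def field_embedding_0[OF assms(2)])
  then show ?thesis by simp
qed

section \<open>The Iwasawa algebra and its total ring of fractions\<close>

context cring
begin

lemma one_regular: "\<one> \<in> regular_elements R"
  by (simp add: regular_elements_def)

lemma mult_regular:
  "s \<in> regular_elements R \<Longrightarrow> t \<in> regular_elements R \<Longrightarrow> s \<otimes> t \<in> regular_elements R"
proof -
  assume s: "s \<in> regular_elements R" and t: "t \<in> regular_elements R"
  then have st: "s \<in> carrier R" "t \<in> carrier R" by (simp_all add: regular_elements_def)
  have "a = \<zero>" if "a \<in> carrier R" "a \<otimes> (s \<otimes> t) = \<zero>" for a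
  proof -
    have "(a \<otimes> s) \<otimes> t = \<zero>" using that st by (simp add: m_assoc)
    then have "a \<otimes> s = \<zero>" using t that st by (simp add: regular_elements_def)
    then show ?thesis using s that by (simp add: regular_elements_def)
  qed
  then show ?thesis using st by (simp add: regular_elements_def)
qed

lemma regular_cancel:
  assumes "s \<in> regular_elements R" "a \<in> carrier R" "b \<in> carrier R" "a \<otimes> s = b \<otimes> s"
  shows "a = b"
proof -
  have s: "s \<in> carrier R" using assms(1) by (simp add: regular_elements_def)
  have "(a \<ominus> b) \<otimes> s = a \<otimes> s \<ominus> b \<otimes> s" using assms(2,3) s by (simp add: a_minus_def l_distr l_minus)
  also have "\<dots> = \<zero>" using assms(2-4) s by (simp add: r_right_minus_eq)
  finally have "(a \<ominus> b) \<otimes> s = \<zero>" .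
  then have "a \<ominus> b = \<zero>" using assms by (simp add: regular_elements_def)
  then show ?thesis using assms(2,3) by (simp add: r_right_minus_eq)
qed

text \<open>The product of two classes is a union over representatives, so it contains the pair (x
  a, s); being equal to the class of \<mu>/1, it yields the equation through the equivalence
  relation.\<close>

lemma to_fractions_mult_eq:
  assumes x: "x \<in> carrier R" and a: "a \<in> carrier R" and s: "s \<in> regular_elements R"
    and eq: "to_fractions R x \<otimes>\<^bsub>total_fractions R\<^esub> fraction R a s = to_fractions R \<mu>"
    and \<mu>: "\<mu> \<in> carrier R"
  shows "x \<otimes> a = \<mu> \<otimes> s"
proof -
  have s': "s \<in> carrier R" using s by (simp add: regular_elements_def)
  have refl: "(b, t) \<in> fraction R b t" if "b \<in> carrier R" "t \<in> regular_elements R" for b t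
    using that by (simp add: fraction_def fraction_rel_def)
  have "(x \<otimes> a, \<one> \<otimes> s) \<in> fraction R (x \<otimes> a) (\<one> \<otimes> s)"
    by (intro refl m_closed mult_regular one_regular x a s)
  then have "(x \<otimes> a, \<one> \<otimes> s) \<in> to_fractions R x \<otimes>\<^bsub>total_fractions R\<^esub> fraction R a s"
    unfolding total_fractions_def to_fractions_def ring.simps monoid.simps
    by (intro UN_I[OF refl[OF x one_regular]]) (unfold prod.case, intro UN_I[OF refl[OF a s]], unfold prod.case)
  then have "(x \<otimes> a, \<one> \<otimes> s) \<in> fraction R \<mu> \<one>"
    unfolding eq by (simp add: to_fractions_def)
  then have "\<mu> \<otimes> (\<one> \<otimes> s) = (x \<otimes> a) \<otimes> \<one>"
    by (simp add: fraction_def fraction_rel_def)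
  then show ?thesis using x a s' by simp
qed

text \<open>With q = a/s the hypotheses read x a = \<mu> s and y a = \<nu> s, and the regular
  element \<open>s\<close> cancels. For x = [g] - [1] and y = [h] - [1] this relates the two
  measures that a pseudo-measure yields at g and h.\<close>

lemma to_fractions_mult_cross:
  assumes q: "q \<in> carrier (total_fractions R)"
    and x: "x \<in> carrier R" and y: "y \<in> carrier R" and \<mu>: "\<mu> \<in> carrier R" and \<nu>: "\<nu> \<in> carrier R"
    and "to_fractions R x \<otimes>\<^bsub>total_fractions R\<^esub> q = to_fractions R \<mu>"
    and "to_fractions R y \<otimes>\<^bsub>total_fractions R\<^esub> q = to_fractions R \<nu>"
  shows "x \<otimes> \<nu> = y \<otimes> \<mu>"
proof -
  from q have "q \<in> (carrier R \<times> regular_elements R) // fraction_rel R"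
    by (simp add: total_fractions_def)
  then obtain z where "z \<in> carrier R \<times> regular_elements R" "q = fraction_rel R `` {z}"
    by (rule quotientE)
  then obtain a s where as: "q = fraction R a s" "a \<in> carrier R" "s \<in> regular_elements R"
    by (cases z) (simp add: fraction_def)
  then have s: "s \<in> carrier R" by (simp add: regular_elements_def)
  have 1: "x \<otimes> a = \<mu> \<otimes> s" "y \<otimes> a = \<nu> \<otimes> s"
    by (rule to_fractions_mult_eq[OF x as(2,3) assms(6)[unfolded as(1)] \<mu>])
      (rule to_fractions_mult_eq[OF y as(2,3) assms(7)[unfolded as(1)] \<nu>])
  have "(x \<otimes> \<nu>) \<otimes> s = x \<otimes> (y \<otimes> a)" using x \<nu> s 1 by (simp add: m_assoc)
  also have "\<dots> = y \<otimes> (x \<otimes> a)" using x y as by (simp add: m_lcomm)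
  also have "\<dots> = (y \<otimes> \<mu>) \<otimes> s" using y \<mu> s 1 by (simp add: m_assoc)
  finally show ?thesis
    by (rule regular_cancel[OF as(3) m_closed[OF x \<nu>] m_closed[OF y \<mu>]])
qed

end

section \<open>The inverse limit of the group rings as a commutative ring\<close>

lemma finite_unit_residues [simp]: "finite (unit_residues m)"
  unfolding unit_residues_def by simp

lemma unit_residues_mult: "a \<in> unit_residues m \<Longrightarrow> b \<in> unit_residues m \<Longrightarrow> a * b mod m \<in> unit_residues m"
  unfolding unit_residues_def by (auto simp: coprime_mod_left_iff coprime_commute[of m])

lemma unit_residues_mod:
  assumes "b \<in> unit_residues (p ^ Suc n)"
  shows "b mod p ^ n \<in> unit_residues (p ^ n)"
proof -
  have "coprime b (p ^ n)" "p ^ n > 0"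
    using assms by (auto simp: unit_residues_def intro: gr0I)
  then show ?thesis
    using coprime_mod_left_iff[of "p ^ n" b] by (simp add: unit_residues_def del: coprime_power_right_iff)
qed

locale iwasawa = complex_padic_field p ty
  for p :: nat and ty :: "'c::{alg_closed_field, field_char_0, complete_space} itself" +
  fixes L :: "'c set"
  assumes finite_padic_extension: "finite_padic_extension L"
begin

abbreviation \<Lambda> :: "(nat \<Rightarrow> nat \<Rightarrow> 'c) ring" where "\<Lambda> \<equiv> iwasawa_algebra p L"
abbreviation U :: "nat \<Rightarrow> nat set" where "U n \<equiv> unit_residues (p ^ n)"
abbreviation OL :: "'c set" where "OL \<equiv> valuation_ring L"

text \<open>The form \<open>1 mod p ^ n\<close> covers n = 0, where the only representative is
  0.\<close>

lemma one_mod_in_U: "1 mod p ^ n \<in> U n"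
proof -
  have "coprime (1 mod p ^ n) (p ^ n)" using p_gt_1 by (subst coprime_mod_left_iff) auto
  moreover have "1 mod p ^ n < p ^ n" using p_gt_1 by (intro mod_less_divisor) simp
  ultimately show ?thesis unfolding unit_residues_def by blast
qed

lemma valuation_ring_closed:
  "0 \<in> OL" "1 \<in> OL" "x \<in> OL \<Longrightarrow> y \<in> OL \<Longrightarrow> x + y \<in> OL"
  "x \<in> OL \<Longrightarrow> y \<in> OL \<Longrightarrow> x * y \<in> OL" "x \<in> OL \<Longrightarrow> - x \<in> OL"
proof -
  interpret K: field "ring_of_type_algebra :: 'c ring" by (rule field_from_type_algebra)
  have "subfield L ring_of_type_algebra"
    using finite_padic_extension by (simp add: finite_padic_extension_def)
  then have "subring L ring_of_type_algebra"
    by (simp add: subfield_def subdomain_def subcring_def)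
  note L' = subringE[OF this]
  have L: "0 \<in> L" "1 \<in> L" "x \<in> L \<Longrightarrow> y \<in> L \<Longrightarrow> x + y \<in> L"
      "x \<in> L \<Longrightarrow> y \<in> L \<Longrightarrow> x * y \<in> L" for x y
    using L'(2,3) L'(6,7)[of x y] by (simp_all add: ring_of_type_algebra_def)
  have Lm: "- x \<in> L" if "x \<in> L" for x
  proof -
    have "\<ominus>\<^bsub>ring_of_type_algebra\<^esub> x \<in> L" by (rule L'(5)[OF that])
    moreover have "\<ominus>\<^bsub>ring_of_type_algebra\<^esub> x = - x"
      by (rule K.minus_equality) (auto simp: ring_of_type_algebra_def)
    ultimately show ?thesis by simp
  qed
  show "0 \<in> OL" "1 \<in> OL" "x \<in> OL \<Longrightarrow> y \<in> OL \<Longrightarrow> x + y \<in> OL"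
    "x \<in> OL \<Longrightarrow> y \<in> OL \<Longrightarrow> x * y \<in> OL" "x \<in> OL \<Longrightarrow> - x \<in> OL"
    using L Lm by (auto simp: valuation_ring_def intro: vabs_add_le vabs_mult_le_1)
qed

lemma valuation_ring_sum: "(\<And>i. i \<in> I \<Longrightarrow> f i \<in> OL) \<Longrightarrow> sum f I \<in> OL"
  by (induction I rule: infinite_finite_induct) (auto intro: valuation_ring_closed)

text \<open>Sums over fibres become sums over all of \<open>U (Suc n)\<close> with an indicator, so
  that summations can be exchanged; \<open>mult_apply\<close> does the same for convolution.\<close>

lemma carrier_iff:
  "\<mu> \<in> carrier \<Lambda> \<longleftrightarrow> (\<forall>n a. a \<in> U n \<longrightarrow> \<mu> n a \<in> OL) \<and> (\<forall>n a. a \<notin> U n \<longrightarrow> \<mu> n a = 0) \<and>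
     (\<forall>n a. a \<in> U n \<longrightarrow> \<mu> n a = (\<Sum>b\<in>U (Suc n). if b mod p ^ n = a then \<mu> (Suc n) b else 0))"
proof -
  have "(\<Sum>b | b \<in> U (Suc n) \<and> b mod p ^ n = a. \<mu> (Suc n) b) =
      (\<Sum>b\<in>U (Suc n). if b mod p ^ n = a then \<mu> (Suc n) b else 0)" for n a
    by (simp add: sum.inter_filter)
  then show ?thesis unfolding iwasawa_algebra_def by auto
qed

lemma carrierD:
  assumes "\<mu> \<in> carrier \<Lambda>"
  shows "\<mu> n a \<in> OL" "a \<notin> U n \<Longrightarrow> \<mu> n a = 0" "vabs (\<mu> n a) \<le> 1"
proof -
  show "a \<notin> U n \<Longrightarrow> \<mu> n a = 0" using assms by (simp add: carrier_iff)
  show "\<mu> n a \<in> OL" using assms valuation_ring_closed(1) unfolding carrier_iff by (cases "a \<in> U n") auto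
  then show "vabs (\<mu> n a) \<le> 1" by (simp add: valuation_ring_def)
qed

text \<open>Compatibility in integrated form: a function of the residue modulo p^n may be integrated
  at level n or n + 1.\<close>

lemma sum_Suc_level:
  assumes "\<mu> \<in> carrier \<Lambda>"
  shows "(\<Sum>b\<in>U (Suc n). F (b mod p ^ n) * \<mu> (Suc n) b) = (\<Sum>a\<in>U n. F a * \<mu> n a)"
proof -
  have "(\<Sum>a\<in>U n. F a * \<mu> n a) =
      (\<Sum>a\<in>U n. \<Sum>b\<in>U (Suc n). if b mod p ^ n = a then F a * \<mu> (Suc n) b else 0)"
  proof (rule sum.cong[OF refl])
    fix a assume "a \<in> U n"
    then have "\<mu> n a = (\<Sum>b\<in>U (Suc n). if b mod p ^ n = a then \<mu> (Suc n) b else 0)"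
      using assms unfolding carrier_iff by blast
    then show "F a * \<mu> n a = (\<Sum>b\<in>U (Suc n). if b mod p ^ n = a then F a * \<mu> (Suc n) b else 0)"
      by (simp add: sum_distrib_left if_distrib cong: if_cong)
  qed
  also have "\<dots> = (\<Sum>b\<in>U (Suc n). \<Sum>a\<in>U n. if b mod p ^ n = a then F a * \<mu> (Suc n) b else 0)"
    by (rule sum.swap)
  also have "\<dots> = (\<Sum>b\<in>U (Suc n). F (b mod p ^ n) * \<mu> (Suc n) b)"
    using unit_residues_mod by (intro sum.cong refl) simp
  finally show ?thesis ..
qed

lemma carrier_compat:
  "\<mu> \<in> carrier \<Lambda> \<Longrightarrow> a \<in> U n \<Longrightarrow> \<mu> n a = (\<Sum>b\<in>U (Suc n). if b mod p ^ n = a then \<mu> (Suc n) b else 0)"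
  unfolding carrier_iff by blast

lemma mult_apply:
  "(\<mu> \<otimes>\<^bsub>\<Lambda>\<^esub> \<nu>) n c = (\<Sum>a\<in>U n. \<Sum>b\<in>U n. if a * b mod p ^ n = c then \<mu> n a * \<nu> n b else 0)"
proof -
  have eq: "{(a, b). a \<in> U n \<and> b \<in> U n \<and> a * b mod p ^ n = c} =
      {x \<in> U n \<times> U n. fst x * snd x mod p ^ n = c}"
    by auto
  have "(\<mu> \<otimes>\<^bsub>\<Lambda>\<^esub> \<nu>) n c = (\<Sum>x\<in>U n \<times> U n. if fst x * snd x mod p ^ n = c then \<mu> n (fst x) * \<nu> n (snd x) else 0)"
    unfolding sum.inter_filter[OF finite_cartesian_product[OF finite_unit_residues finite_unit_residues], symmetric] eq[symmetric]
    by (simp add: iwasawa_algebra_def case_prod_unfold)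
  then show ?thesis by (simp add: sum.cartesian_product case_prod_unfold)
qed

text \<open>Convolution is the push-forward of the product measure along multiplication.\<close>

lemma sum_mult:
  "(\<Sum>c\<in>U n. F c * (\<mu> \<otimes>\<^bsub>\<Lambda>\<^esub> \<nu>) n c) = (\<Sum>a\<in>U n. \<Sum>b\<in>U n. F (a * b mod p ^ n) * (\<mu> n a * \<nu> n b))"
proof -
  have "(\<Sum>c\<in>U n. F c * (\<mu> \<otimes>\<^bsub>\<Lambda>\<^esub> \<nu>) n c) =
      (\<Sum>c\<in>U n. \<Sum>a\<in>U n. \<Sum>b\<in>U n. if a * b mod p ^ n = c then F c * (\<mu> n a * \<nu> n b) else 0)"
    unfolding mult_apply sum_distrib_left by (intro sum.cong refl) simp
  also have "\<dots> = (\<Sum>a\<in>U n. \<Sum>b\<in>U n. \<Sum>c\<in>U n. if a * b mod p ^ n = c then F c * (\<mu> n a * \<nu> n b) else 0)"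
    by (subst sum.swap) (intro sum.cong refl sum.swap)
  also have "\<dots> = (\<Sum>a\<in>U n. \<Sum>b\<in>U n. F (a * b mod p ^ n) * (\<mu> n a * \<nu> n b))"
    by (intro sum.cong refl) (simp add: unit_residues_mult)
  finally show ?thesis .
qed

lemma mult_closed:
  assumes \<mu>: "\<mu> \<in> carrier \<Lambda>" and \<nu>: "\<nu> \<in> carrier \<Lambda>"
  shows "\<mu> \<otimes>\<^bsub>\<Lambda>\<^esub> \<nu> \<in> carrier \<Lambda>"
  unfolding carrier_iff
proof (intro conjI allI impI)
  fix n a
  show "(\<mu> \<otimes>\<^bsub>\<Lambda>\<^esub> \<nu>) n a \<in> OL"
    unfolding mult_apply by (intro valuation_ring_sum) (auto intro: valuation_ring_closed carrierD \<mu> \<nu>)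
  show "(\<mu> \<otimes>\<^bsub>\<Lambda>\<^esub> \<nu>) n a = 0" if "a \<notin> U n"
    unfolding mult_apply using that unit_residues_mult by (intro sum.neutral ballI) auto
  \<comment> \<open>The indicator of the class of \<open>a\<close> modulo p^n. It sees a product
    only through the residues of its factors modulo p^n, so each factor can be lifted to level n + 1
    separately.\<close>
  define F where "F = (\<lambda>c. if c mod p ^ n = a then 1 else (0 :: 'c))"
  have F_mod: "F (c mod p ^ Suc n) = F c" "F (c mod p ^ n) = F c" for c
    by (simp_all add: F_def mod_mod_cancel)
  assume "a \<in> U n"
  then have "a < p ^ n" by (simp add: unit_residues_def)
  have "(\<mu> \<otimes>\<^bsub>\<Lambda>\<^esub> \<nu>) n a = (\<Sum>a\<in>U n. \<Sum>b\<in>U n. F (a * b) * (\<mu> n a * \<nu> n b))"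
    unfolding mult_apply F_def by (intro sum.cong refl) simp
  also have "\<dots> = (\<Sum>a\<in>U n. (\<Sum>b\<in>U n. F (a * b) * \<nu> n b) * \<mu> n a)"
    by (simp add: sum_distrib_left sum_distrib_right mult_ac)
  also have "\<dots> = (\<Sum>a\<in>U (Suc n). (\<Sum>b\<in>U n. F (a mod p ^ n * b) * \<nu> n b) * \<mu> (Suc n) a)"
    by (rule sum_Suc_level[OF \<mu>, symmetric])
  also have "\<dots> = (\<Sum>a\<in>U (Suc n). (\<Sum>b\<in>U (Suc n). F (a mod p ^ n * (b mod p ^ n)) * \<nu> (Suc n) b) * \<mu> (Suc n) a)"
    by (subst sum_Suc_level[OF \<nu>, symmetric]) simp
  also have "\<dots> = (\<Sum>a\<in>U (Suc n). \<Sum>b\<in>U (Suc n). F (a * b mod p ^ Suc n) * (\<mu> (Suc n) a * \<nu> (Suc n) b))"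
  proof -
    have "F (a mod p ^ n * (b mod p ^ n)) = F (a * b)" for a b
      using F_mod(2)[of "a mod p ^ n * (b mod p ^ n)"] F_mod(2)[of "a * b"] by (simp only: mod_mult_eq)
    then show ?thesis unfolding F_mod by (simp add: sum_distrib_left sum_distrib_right mult_ac)
  qed
  also have "\<dots> = (\<Sum>b\<in>U (Suc n). F b * (\<mu> \<otimes>\<^bsub>\<Lambda>\<^esub> \<nu>) (Suc n) b)"
    by (rule sum_mult[symmetric])
  also have "\<dots> = (\<Sum>b\<in>U (Suc n). if b mod p ^ n = a then (\<mu> \<otimes>\<^bsub>\<Lambda>\<^esub> \<nu>) (Suc n) b else 0)"
    by (intro sum.cong refl) (simp add: F_def)
  finally show "(\<mu> \<otimes>\<^bsub>\<Lambda>\<^esub> \<nu>) n a = (\<Sum>b\<in>U (Suc n). if b mod p ^ n = a then (\<mu> \<otimes>\<^bsub>\<Lambda>\<^esub> \<nu>) (Suc n) b else 0)" .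
qed

lemma add_apply: "(\<mu> \<oplus>\<^bsub>\<Lambda>\<^esub> \<nu>) n a = \<mu> n a + \<nu> n a"
  and zero_apply: "\<zero>\<^bsub>\<Lambda>\<^esub> n a = 0"
  and one_apply: "\<one>\<^bsub>\<Lambda>\<^esub> n a = (if a = 1 mod p ^ n then 1 else 0)"
  by (simp_all add: iwasawa_algebra_def)

text \<open>A coherent sequence of residues is a point of the unit group; this handles the unit
  element and \<open>dirac\<close> together.\<close>

lemma delta_in_carrier:
  assumes "\<And>n. r n \<in> U n" "\<And>n. r (Suc n) mod p ^ n = r n"
  shows "(\<lambda>n a. if a = r n then 1 else 0) \<in> carrier \<Lambda>"
  unfolding carrier_iff
proof (intro conjI allI impI)
  fix n a assume "a \<in> U n"
  have "(\<Sum>b\<in>U (Suc n). if b mod p ^ n = a then if b = r (Suc n) then 1 else 0 else 0) =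
      (\<Sum>b\<in>U (Suc n). if b = r (Suc n) then if r n = a then 1 else (0 :: 'c) else 0)"
    using assms(2) by (intro sum.cong refl) auto
  also have "\<dots> = (if r n = a then 1 else 0)" using assms(1) by (simp del: power_Suc)
  finally show "(if a = r n then 1 else 0) =
      (\<Sum>b\<in>U (Suc n). if b mod p ^ n = a then if b = r (Suc n) then 1 else 0 else (0 :: 'c))"
    by auto
qed (use assms(1) valuation_ring_closed in auto)

lemma one_in_carrier: "\<one>\<^bsub>\<Lambda>\<^esub> \<in> carrier \<Lambda>"
proof -
  have "1 mod p ^ Suc n mod p ^ n = 1 mod p ^ n" for n by (simp add: mod_mod_cancel)
  from delta_in_carrier[OF one_mod_in_U this] show ?thesis
    by (simp only: iwasawa_algebra_def monoid.simps)
qed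

lemma dirac_in_carrier: "g \<in> padic_units \<Longrightarrow> dirac p g \<in> carrier \<Lambda>"
  using delta_in_carrier[of "\<lambda>n. padic_residue p n g"] padic_unitD[of g] padic_residue(1)[of g]
    padic_residue_mod[of g]
  by (simp add: dirac_def [abs_def] unit_residues_def)

lemma add_closed:
  assumes \<mu>: "\<mu> \<in> carrier \<Lambda>" and \<nu>: "\<nu> \<in> carrier \<Lambda>"
  shows "\<mu> \<oplus>\<^bsub>\<Lambda>\<^esub> \<nu> \<in> carrier \<Lambda>"
  unfolding carrier_iff add_apply
proof (intro conjI allI impI)
  fix n a
  assume "a \<in> U n"
  then have "\<mu> n a + \<nu> n a = (\<Sum>b\<in>U (Suc n). if b mod p ^ n = a then \<mu> (Suc n) b else 0) +
      (\<Sum>b\<in>U (Suc n). if b mod p ^ n = a then \<nu> (Suc n) b else 0)"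
    using carrier_compat[OF \<mu>] carrier_compat[OF \<nu>] by presburger
  then show "\<mu> n a + \<nu> n a = (\<Sum>b\<in>U (Suc n). if b mod p ^ n = a then \<mu> (Suc n) b + \<nu> (Suc n) b else 0)"
    unfolding sum.distrib[symmetric] by (simp cong: if_cong del: power_Suc) (auto intro!: sum.cong)
qed (auto intro: valuation_ring_closed simp: carrierD[OF \<mu>] carrierD[OF \<nu>])

lemma uminus_closed:
  assumes \<mu>: "\<mu> \<in> carrier \<Lambda>"
  shows "(\<lambda>n a. - \<mu> n a) \<in> carrier \<Lambda>"
  unfolding carrier_iff
proof (intro conjI allI impI)
  fix n a
  assume "a \<in> U n"
  then have "- \<mu> n a = - (\<Sum>b\<in>U (Suc n). if b mod p ^ n = a then \<mu> (Suc n) b else 0)"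
    using carrier_compat[OF \<mu>] by presburger
  then show "- \<mu> n a = (\<Sum>b\<in>U (Suc n). if b mod p ^ n = a then - \<mu> (Suc n) b else 0)"
    unfolding sum_negf[symmetric] by (simp only: if_distrib[of uminus] minus_zero)
qed (auto intro: valuation_ring_closed simp: carrierD[OF \<mu>])

lemma zero_in_carrier: "\<zero>\<^bsub>\<Lambda>\<^esub> \<in> carrier \<Lambda>"
  unfolding carrier_iff zero_apply by (auto intro: valuation_ring_closed)

lemma mult_commute: "\<mu> \<otimes>\<^bsub>\<Lambda>\<^esub> \<nu> = \<nu> \<otimes>\<^bsub>\<Lambda>\<^esub> \<mu>"
proof (intro ext)
  fix n c
  show "(\<mu> \<otimes>\<^bsub>\<Lambda>\<^esub> \<nu>) n c = (\<nu> \<otimes>\<^bsub>\<Lambda>\<^esub> \<mu>) n c"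
    unfolding mult_apply by (subst sum.swap) (intro sum.cong refl, simp only: mult.commute)
qed

text \<open>Both sides are the sum over all triples with product congruent to \<open>d\<close>,
  reached from either side by \<open>sum_mult\<close>.\<close>

lemma mult_assoc: "(\<mu> \<otimes>\<^bsub>\<Lambda>\<^esub> \<nu>) \<otimes>\<^bsub>\<Lambda>\<^esub> \<xi> = \<mu> \<otimes>\<^bsub>\<Lambda>\<^esub> (\<nu> \<otimes>\<^bsub>\<Lambda>\<^esub> \<xi>)"
proof (intro ext)
  fix n d
  have "((\<mu> \<otimes>\<^bsub>\<Lambda>\<^esub> \<nu>) \<otimes>\<^bsub>\<Lambda>\<^esub> \<xi>) n d =
      (\<Sum>c\<in>U n. (\<Sum>e\<in>U n. if c * e mod p ^ n = d then \<xi> n e else 0) * (\<mu> \<otimes>\<^bsub>\<Lambda>\<^esub> \<nu>) n c)"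
    unfolding mult_apply[of "\<mu> \<otimes>\<^bsub>\<Lambda>\<^esub> \<nu>"] sum_distrib_right by (intro sum.cong refl) simp
  also have "\<dots> = (\<Sum>a\<in>U n. \<Sum>b\<in>U n. (\<Sum>e\<in>U n. if (a * b mod p ^ n) * e mod p ^ n = d then \<xi> n e else 0) * (\<mu> n a * \<nu> n b))"
    by (rule sum_mult)
  also have "\<dots> = (\<Sum>a\<in>U n. \<Sum>b\<in>U n. \<Sum>e\<in>U n. (if a * (b * e mod p ^ n) mod p ^ n = d then \<mu> n a else 0) * (\<nu> n b * \<xi> n e))"
    unfolding sum_distrib_right
    by (intro sum.cong refl) (simp add: mod_mult_left_eq mod_mult_right_eq mult_ac)
  also have "\<dots> = (\<Sum>a\<in>U n. \<Sum>c\<in>U n. (if a * c mod p ^ n = d then \<mu> n a else 0) * (\<nu> \<otimes>\<^bsub>\<Lambda>\<^esub> \<xi>) n c)"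
    by (intro sum.cong refl sum_mult[symmetric])
  also have "\<dots> = (\<mu> \<otimes>\<^bsub>\<Lambda>\<^esub> (\<nu> \<otimes>\<^bsub>\<Lambda>\<^esub> \<xi>)) n d"
    unfolding mult_apply[of \<mu>] by (intro sum.cong refl) simp
  finally show "((\<mu> \<otimes>\<^bsub>\<Lambda>\<^esub> \<nu>) \<otimes>\<^bsub>\<Lambda>\<^esub> \<xi>) n d = (\<mu> \<otimes>\<^bsub>\<Lambda>\<^esub> (\<nu> \<otimes>\<^bsub>\<Lambda>\<^esub> \<xi>)) n d" .
qed

lemma mult_one:
  assumes "\<mu> \<in> carrier \<Lambda>"
  shows "\<one>\<^bsub>\<Lambda>\<^esub> \<otimes>\<^bsub>\<Lambda>\<^esub> \<mu> = \<mu>"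
proof (intro ext)
  fix n c
  define e where "e = 1 mod p ^ n"
  have e: "e \<in> U n" unfolding e_def by (rule one_mod_in_U)
  have "(\<one>\<^bsub>\<Lambda>\<^esub> \<otimes>\<^bsub>\<Lambda>\<^esub> \<mu>) n c = (\<Sum>a\<in>U n. if a = e then (\<Sum>b\<in>U n. if a * b mod p ^ n = c then \<mu> n b else 0) else 0)"
    unfolding mult_apply one_apply e_def[symmetric]
    by (intro sum.cong refl) (simp cong: if_cong)
  also have "\<dots> = (\<Sum>b\<in>U n. if e * b mod p ^ n = c then \<mu> n b else 0)"
    using e by simp
  also have "\<dots> = (\<Sum>b\<in>U n. if b = c then \<mu> n b else 0)"
  proof (intro sum.cong refl)
    fix b assume "b \<in> U n"
    then have "e * b mod p ^ n = b" unfolding e_def mod_mult_left_eq by (simp add: unit_residues_def)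
    then show "(if e * b mod p ^ n = c then \<mu> n b else 0) = (if b = c then \<mu> n b else 0)" by simp
  qed
  also have "\<dots> = \<mu> n c" using carrierD(2)[OF assms] by auto
  finally show "(\<one>\<^bsub>\<Lambda>\<^esub> \<otimes>\<^bsub>\<Lambda>\<^esub> \<mu>) n c = \<mu> n c" .
qed

lemma cring_iwasawa_algebra: "cring \<Lambda>"
proof (rule cringI)
  show "abelian_group \<Lambda>"
  proof (rule abelian_groupI)
    fix \<mu> assume "\<mu> \<in> carrier \<Lambda>"
    then show "\<exists>\<nu>\<in>carrier \<Lambda>. \<nu> \<oplus>\<^bsub>\<Lambda>\<^esub> \<mu> = \<zero>\<^bsub>\<Lambda>\<^esub>"
      by (intro bexI[OF _ uminus_closed]) (auto simp: fun_eq_iff add_apply zero_apply)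
  qed (auto simp: fun_eq_iff add_apply zero_apply add_ac intro: add_closed zero_in_carrier)
  show "comm_monoid \<Lambda>"
    by (rule comm_monoidI) (auto intro: mult_closed one_in_carrier mult_assoc mult_one mult_commute)
  show "(\<mu> \<oplus>\<^bsub>\<Lambda>\<^esub> \<nu>) \<otimes>\<^bsub>\<Lambda>\<^esub> \<xi> = \<mu> \<otimes>\<^bsub>\<Lambda>\<^esub> \<xi> \<oplus>\<^bsub>\<Lambda>\<^esub> \<nu> \<otimes>\<^bsub>\<Lambda>\<^esub> \<xi>" for \<mu> \<nu> \<xi>
  proof (intro ext)
    fix n a
    show "((\<mu> \<oplus>\<^bsub>\<Lambda>\<^esub> \<nu>) \<otimes>\<^bsub>\<Lambda>\<^esub> \<xi>) n a = (\<mu> \<otimes>\<^bsub>\<Lambda>\<^esub> \<xi> \<oplus>\<^bsub>\<Lambda>\<^esub> \<nu> \<otimes>\<^bsub>\<Lambda>\<^esub> \<xi>) n a"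
      unfolding add_apply mult_apply sum.distrib[symmetric] by (intro sum.cong refl) (simp add: distrib_right)
  qed
qed

lemma diff_apply:
  assumes "\<mu> \<in> carrier \<Lambda>" "\<nu> \<in> carrier \<Lambda>"
  shows "(\<mu> \<ominus>\<^bsub>\<Lambda>\<^esub> \<nu>) n a = \<mu> n a - \<nu> n a"
proof -
  interpret cring \<Lambda> by (rule cring_iwasawa_algebra)
  have "\<ominus>\<^bsub>\<Lambda>\<^esub> \<nu> = (\<lambda>n a. - \<nu> n a)"
  proof (rule minus_equality)
    show "(\<lambda>n a. - \<nu> n a) \<oplus>\<^bsub>\<Lambda>\<^esub> \<nu> = \<zero>\<^bsub>\<Lambda>\<^esub>" by (simp add: fun_eq_iff add_apply zero_apply)
  qed (intro assms(2) uminus_closed)+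
  then show ?thesis by (simp add: a_minus_def add_apply)
qed

end

section \<open>Integration of characters\<close>

context iwasawa
begin

text \<open>\<open>measure_integral\<close> samples its integrand at natural numbers only, so
  integrands are kept as functions on them.\<close>

definition nat_integral :: "(nat \<Rightarrow> 'c) \<Rightarrow> (nat \<Rightarrow> nat \<Rightarrow> 'c) \<Rightarrow> 'c" where
  "nat_integral \<phi> \<mu> = lim (\<lambda>m. \<Sum>a\<in>U m. \<phi> a * \<mu> m a)"

text \<open>Uniform continuity for the p-adic topology on the natural numbers, which are dense in
  the p-adic integers.\<close>

definition p_uniform :: "(nat \<Rightarrow> 'c) \<Rightarrow> bool" where
  "p_uniform \<phi> \<longleftrightarrow> (\<forall>e>0. \<exists>N. \<forall>a b. [a = b] (mod p ^ N) \<longrightarrow> vabs (\<phi> a - \<phi> b) \<le> e)"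

lemma p_uniformD:
  assumes "p_uniform \<phi>" "e > 0"
  shows "\<exists>N. \<forall>m\<ge>N. \<forall>a b. [a = b] (mod p ^ m) \<longrightarrow> vabs (\<phi> a - \<phi> b) \<le> e"
proof -
  obtain N where N: "\<And>a b. [a = b] (mod p ^ N) \<Longrightarrow> vabs (\<phi> a - \<phi> b) \<le> e"
    using assms unfolding p_uniform_def by blast
  have "vabs (\<phi> a - \<phi> b) \<le> e" if "m \<ge> N" "[a = b] (mod p ^ m)" for a b m
    using N cong_dvd_modulus_nat[OF that(2) le_imp_power_dvd[OF that(1)]] by blast
  then show ?thesis by blast
qed

lemma p_uniform_periodic: "(\<And>a. \<phi> (a mod p ^ N) = \<phi> a) \<Longrightarrow> p_uniform \<phi>"
  unfolding p_uniform_def cong_def by (metis diff_self order_less_imp_le vabs_0)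

lemma vabs_power_diff_le:
  assumes "vabs x \<le> 1" "vabs y \<le> 1"
  shows "vabs (x ^ k - y ^ k) \<le> vabs (x - y)"
proof (induction k)
  case (Suc k)
  have "x ^ Suc k - y ^ Suc k = x * (x ^ k - y ^ k) + y ^ k * (x - y)"
    by (simp add: algebra_simps)
  moreover have "vabs (x * (x ^ k - y ^ k)) \<le> vabs (x - y)"
    by (rule vabs_mult_le_1[OF assms(1) Suc])
  moreover have "vabs (y ^ k * (x - y)) \<le> vabs (x - y)"
    using assms(2) by (intro vabs_mult_le_1) (simp_all add: vabs_power power_le_one)
  ultimately show ?case by (simp only: vabs_add_le)
qed simp

lemma p_uniform_power: "p_uniform (\<lambda>a. of_nat a ^ k)"
  unfolding p_uniform_def
proof (intro allI impI)
  fix e :: real assume "e > 0"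
  then obtain N where N: "(1 / real p) ^ N < e" using ex_inverse_p_power_less by blast
  have "vabs (of_nat a ^ k - of_nat b ^ k) \<le> e" if "[a = b] (mod p ^ N)" for a b
    using vabs_power_diff_le[OF vabs_of_nat_le_1 vabs_of_nat_le_1, of a k b] that N
    unfolding vabs_of_nat_diff_le_iff[symmetric] by linarith
  then show "\<exists>N. \<forall>a b. [a = b] (mod p ^ N) \<longrightarrow> vabs (of_nat a ^ k - of_nat b ^ k) \<le> e" by blast
qed

lemma p_uniform_add:
  assumes "p_uniform \<phi>" "p_uniform \<psi>"
  shows "p_uniform (\<lambda>a. \<phi> a + \<psi> a)"
  unfolding p_uniform_def
proof (intro allI impI)
  fix e :: real assume "e > 0"
  obtain M where M: "\<And>a b m. m \<ge> M \<Longrightarrow> [a = b] (mod p ^ m) \<Longrightarrow> vabs (\<phi> a - \<phi> b) \<le> e"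
    using p_uniformD[OF assms(1) \<open>e > 0\<close>] by blast
  obtain N where N: "\<And>a b m. m \<ge> N \<Longrightarrow> [a = b] (mod p ^ m) \<Longrightarrow> vabs (\<psi> a - \<psi> b) \<le> e"
    using p_uniformD[OF assms(2) \<open>e > 0\<close>] by blast
  have "vabs (\<phi> a + \<psi> a - (\<phi> b + \<psi> b)) \<le> e" if "[a = b] (mod p ^ max M N)" for a b
    unfolding add_diff_add using M[OF _ that] N[OF _ that] by (intro vabs_add_le) auto
  then show "\<exists>N. \<forall>a b. [a = b] (mod p ^ N) \<longrightarrow> vabs (\<phi> a + \<psi> a - (\<phi> b + \<psi> b)) \<le> e" by blast
qed

lemma p_uniform_mult:
  assumes "p_uniform \<phi>" "p_uniform \<psi>" "\<And>a. vabs (\<phi> a) \<le> 1" "\<And>a. vabs (\<psi> a) \<le> 1"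
  shows "p_uniform (\<lambda>a. \<phi> a * \<psi> a)"
  unfolding p_uniform_def
proof (intro allI impI)
  fix e :: real assume "e > 0"
  obtain M where M: "\<And>a b m. m \<ge> M \<Longrightarrow> [a = b] (mod p ^ m) \<Longrightarrow> vabs (\<phi> a - \<phi> b) \<le> e"
    using p_uniformD[OF assms(1) \<open>e > 0\<close>] by blast
  obtain N where N: "\<And>a b m. m \<ge> N \<Longrightarrow> [a = b] (mod p ^ m) \<Longrightarrow> vabs (\<psi> a - \<psi> b) \<le> e"
    using p_uniformD[OF assms(2) \<open>e > 0\<close>] by blast
  have "vabs (\<phi> a * \<psi> a - \<phi> b * \<psi> b) \<le> e" if "[a = b] (mod p ^ max M N)" for a b
  proof -
    have "\<phi> a * \<psi> a - \<phi> b * \<psi> b = \<psi> a * (\<phi> a - \<phi> b) + \<phi> b * (\<psi> a - \<psi> b)"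
      by (simp add: algebra_simps)
    also have "vabs \<dots> \<le> e"
      using M[OF _ that] N[OF _ that] by (intro vabs_add_le vabs_mult_le_1 assms) auto
    finally show ?thesis .
  qed
  then show "\<exists>N. \<forall>a b. [a = b] (mod p ^ N) \<longrightarrow> vabs (\<phi> a * \<psi> a - \<phi> b * \<psi> b) \<le> e" by blast
qed

lemma p_uniform_cmult:
  assumes "p_uniform \<phi>"
  shows "p_uniform (\<lambda>a. c * \<phi> a)"
  unfolding p_uniform_def
proof (intro allI impI)
  fix e :: real assume e: "e > 0"
  \<comment> \<open>Adding 1 makes the divisor positive when c = 0 as well.\<close>
  have c: "vabs c + 1 > 0" using vabs_nonneg[of c] by linarith
  then have "e / (vabs c + 1) > 0" using e by simp
  then obtain N where N: "\<And>a b m. m \<ge> N \<Longrightarrow> [a = b] (mod p ^ m) \<Longrightarrow> vabs (\<phi> a - \<phi> b) \<le> e / (vabs c + 1)"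
    using p_uniformD[OF assms] by blast
  have "vabs (c * \<phi> a - c * \<phi> b) \<le> e" if "[a = b] (mod p ^ N)" for a b
  proof -
    have "vabs (c * \<phi> a - c * \<phi> b) \<le> (vabs c + 1) * (e / (vabs c + 1))"
      unfolding right_diff_distrib[symmetric] by (intro vabs_mult_le N[OF order_refl that]) simp
    then show ?thesis using c by simp
  qed
  then show "\<exists>N. \<forall>a b. [a = b] (mod p ^ N) \<longrightarrow> vabs (c * \<phi> a - c * \<phi> b) \<le> e" by blast
qed

lemma p_uniform_sum: "(\<And>i. i \<in> I \<Longrightarrow> p_uniform (f i)) \<Longrightarrow> p_uniform (\<lambda>a. \<Sum>i\<in>I. f i a)"
proof (induction I rule: infinite_finite_induct)
  case (insert i I)
  then show ?case using p_uniform_add[of "f i" "\<lambda>a. \<Sum>i\<in>I. f i a"] by simp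
qed (simp_all add: p_uniform_periodic[of _ 0])

section \<open>The integral as a limit of Riemann sums\<close>

lemma tendsto_vabs_leI:
  fixes f :: "nat \<Rightarrow> 'c"
  assumes "\<And>e. e > 0 \<Longrightarrow> \<exists>N. \<forall>m\<ge>N. vabs (f m - l) \<le> e"
  shows "f \<longlonglongrightarrow> l"
  unfolding lim_sequentially dist_eq_vabs
proof (intro allI impI)
  fix e :: real assume "e > 0"
  then have "e / 2 > 0" by simp
  then obtain N where "\<forall>m\<ge>N. vabs (f m - l) \<le> e / 2" using assms by blast
  then show "\<exists>N. \<forall>m\<ge>N. vabs (f m - l) < e" using \<open>e > 0\<close> by (intro exI[of _ N]) force
qed

text \<open>Consecutive sums differ by no more than the oscillation of \<open>\<phi>\<close> on
  residue classes modulo p^m, and in an ultrametric space small consecutive differences already give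
  a Cauchy sequence.\<close>

lemma nat_integral_tendsto:
  assumes \<phi>: "p_uniform \<phi>" and \<mu>: "\<mu> \<in> carrier \<Lambda>"
  shows "(\<lambda>m. \<Sum>a\<in>U m. \<phi> a * \<mu> m a) \<longlonglongrightarrow> nat_integral \<phi> \<mu>"
proof -
  define S where "S = (\<lambda>m. \<Sum>a\<in>U m. \<phi> a * \<mu> m a)"
  have "Cauchy S"
  proof (rule metric_CauchyI)
    fix e :: real assume e: "e > 0"
    obtain N where N: "\<And>a b m. m \<ge> N \<Longrightarrow> [a = b] (mod p ^ m) \<Longrightarrow> vabs (\<phi> a - \<phi> b) \<le> e / 2"
      using p_uniformD[OF \<phi> half_gt_zero[OF e]] by blast
    have step: "vabs (S (Suc m) - S m) \<le> e / 2" if "m \<ge> N" for m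
    proof -
      have "S (Suc m) - S m = (\<Sum>b\<in>U (Suc m). (\<phi> b - \<phi> (b mod p ^ m)) * \<mu> (Suc m) b)"
        unfolding S_def sum_Suc_level[OF \<mu>, where F = \<phi> and n = m, symmetric] by (simp only: left_diff_distrib sum_subtractf)
      also have "vabs \<dots> \<le> e / 2 * 1"
        using e N[OF that] by (intro vabs_sum_le vabs_mult_le carrierD[OF \<mu>]) (auto simp: cong_def)
      finally show ?thesis by simp
    qed
    have "vabs (S (N + i) - S N) \<le> e / 2" for i
    proof (induction i)
      case (Suc i)
      show ?case using vabs_diff_trans[OF step[of "N + i"] Suc] by simp
    qed (use e in simp)
    then have "vabs (S m - S N) \<le> e / 2" if "m \<ge> N" for m
      using le_add_diff_inverse[OF that] by metis
    then have "vabs (S m - S m') \<le> e / 2" if "m \<ge> N" "m' \<ge> N" for m m'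
      using vabs_diff_trans[of "S m" "S N" "e / 2" "S m'"] that by (simp add: vabs_minus_commute[of "S N"])
    then have "dist (S m) (S m') < e" if "m \<ge> N" "m' \<ge> N" for m m'
      unfolding dist_eq_vabs using that e by force
    then show "\<exists>M. \<forall>m\<ge>M. \<forall>m'\<ge>M. dist (S m) (S m') < e" by blast
  qed
  then have "convergent S" by (rule Cauchy_convergent)
  then have "S \<longlonglongrightarrow> lim S" by (simp add: convergent_LIMSEQ_iff)
  then show ?thesis by (simp add: S_def nat_integral_def)
qed

lemma nat_integral_eqI:
  "(\<lambda>m. \<Sum>a\<in>U m. \<phi> a * \<mu> m a) \<longlonglongrightarrow> l \<Longrightarrow> nat_integral \<phi> \<mu> = l"
  unfolding nat_integral_def by (rule limI)

lemma nat_integral_add: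
  assumes "p_uniform \<phi>" "p_uniform \<psi>" "\<mu> \<in> carrier \<Lambda>"
  shows "nat_integral (\<lambda>a. \<phi> a + \<psi> a) \<mu> = nat_integral \<phi> \<mu> + nat_integral \<psi> \<mu>"
  using tendsto_padic_add[OF nat_integral_tendsto[OF assms(1,3)] nat_integral_tendsto[OF assms(2,3)]]
  by (intro nat_integral_eqI) (simp add: distrib_right sum.distrib)

lemma nat_integral_cmult:
  assumes "p_uniform \<phi>" "\<mu> \<in> carrier \<Lambda>"
  shows "nat_integral (\<lambda>a. c * \<phi> a) \<mu> = c * nat_integral \<phi> \<mu>"
  using tendsto_padic_cmult[OF nat_integral_tendsto[OF assms], of c]
  by (intro nat_integral_eqI) (simp add: sum_distrib_left mult.assoc)

lemma nat_integral_sum: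
  assumes "finite I" "\<And>i. i \<in> I \<Longrightarrow> p_uniform (f i)" "\<mu> \<in> carrier \<Lambda>"
  shows "nat_integral (\<lambda>a. \<Sum>i\<in>I. f i a) \<mu> = (\<Sum>i\<in>I. nat_integral (f i) \<mu>)"
  using assms(1,2)
proof (induction I rule: finite_induct)
  case empty
  show ?case by (rule nat_integral_eqI) simp
next
  case (insert i I)
  then show ?case
    using nat_integral_add[OF _ p_uniform_sum assms(3), of "f i" I f] by simp
qed

lemma vabs_nat_integral_le:
  assumes "p_uniform \<phi>" "\<mu> \<in> carrier \<Lambda>" "\<And>a. vabs (\<phi> a) \<le> B"
  shows "vabs (nat_integral \<phi> \<mu>) \<le> B"
proof (rule vabs_le_limit[OF nat_integral_tendsto[OF assms(1,2)]])
  fix m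
  have "B \<ge> 0" using assms(3)[of 0] vabs_nonneg order_trans by blast
  then have "vabs (\<Sum>a\<in>U m. \<phi> a * \<mu> m a) \<le> B * 1"
    by (intro vabs_sum_le vabs_mult_le assms carrierD(3)[OF assms(2)]) simp
  then show "vabs (\<Sum>a\<in>U m. \<phi> a * \<mu> m a) \<le> B" by simp
qed

text \<open>Convolution evaluates \<kappa> at reduced products a b mod p^m, the product of the
  integrals at a b itself; uniform continuity makes the discrepancy \<open>D\<close> tend to
  0.\<close>

lemma nat_integral_mult:
  assumes \<kappa>: "p_uniform \<kappa>" "\<And>a b. \<kappa> (a * b) = \<kappa> a * \<kappa> b" "\<And>a. vabs (\<kappa> a) \<le> 1"
    and \<mu>: "\<mu> \<in> carrier \<Lambda>" and \<nu>: "\<nu> \<in> carrier \<Lambda>"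
  shows "nat_integral \<kappa> (\<mu> \<otimes>\<^bsub>\<Lambda>\<^esub> \<nu>) = nat_integral \<kappa> \<mu> * nat_integral \<kappa> \<nu>"
proof (rule nat_integral_eqI)
  define D where "D = (\<lambda>m. \<Sum>a\<in>U m. \<Sum>b\<in>U m. (\<kappa> (a * b mod p ^ m) - \<kappa> (a * b)) * (\<mu> m a * \<nu> m b))"
  have "D \<longlonglongrightarrow> 0"
  proof (rule tendsto_vabs_leI)
    fix e :: real assume e: "e > 0"
    obtain N where N: "\<And>a b m. m \<ge> N \<Longrightarrow> [a = b] (mod p ^ m) \<Longrightarrow> vabs (\<kappa> a - \<kappa> b) \<le> e"
      using p_uniformD[OF \<kappa>(1) e] by blast
    have "vabs (D m - 0) \<le> e * (1 * 1)" if "m \<ge> N" for m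
      unfolding D_def diff_0_right
      by (intro vabs_sum_le vabs_mult_le N[OF that] carrierD \<mu> \<nu>) (use e in \<open>auto simp: cong_def\<close>)
    then show "\<exists>N. \<forall>m\<ge>N. vabs (D m - 0) \<le> e" by auto
  qed
  moreover have "vabs (\<Sum>a\<in>U m. \<kappa> a * \<nu> m a) \<le> 1" for m
    by (intro vabs_sum_le vabs_mult_le_1 \<kappa> carrierD \<nu>) simp
  ultimately have "(\<lambda>m. D m + (\<Sum>a\<in>U m. \<kappa> a * \<mu> m a) * (\<Sum>b\<in>U m. \<kappa> b * \<nu> m b)) \<longlonglongrightarrow>
      0 + nat_integral \<kappa> \<mu> * nat_integral \<kappa> \<nu>"
    by (intro tendsto_padic_add tendsto_padic_mult nat_integral_tendsto \<kappa> \<mu> \<nu>)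
  moreover have "D m + (\<Sum>a\<in>U m. \<kappa> a * \<mu> m a) * (\<Sum>b\<in>U m. \<kappa> b * \<nu> m b) =
      (\<Sum>c\<in>U m. \<kappa> c * (\<mu> \<otimes>\<^bsub>\<Lambda>\<^esub> \<nu>) m c)" for m
    unfolding sum_mult D_def sum_product sum.distrib[symmetric]
    by (intro sum.cong refl) (simp add: \<kappa>(2) algebra_simps)
  ultimately show "(\<lambda>m. \<Sum>c\<in>U m. \<kappa> c * (\<mu> \<otimes>\<^bsub>\<Lambda>\<^esub> \<nu>) m c) \<longlonglongrightarrow> nat_integral \<kappa> \<mu> * nat_integral \<kappa> \<nu>"
    by simp
qed

lemma one_in_padic_units: "(1 :: 'c) \<in> padic_units"
  using of_nat_in_padic_integers[of 1] by (auto simp: padic_units_def intro!: bexI[of _ 1])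

text \<open>\<open>c\<close> is the value at \<open>g\<close> of the continuous extension of
  \<kappa>.\<close>

lemma nat_integral_dirac_diff:
  assumes "p_uniform \<kappa>" and g: "g \<in> padic_units" and "\<kappa> 1 = 1"
    and lim: "(\<lambda>m. \<kappa> (padic_residue p m g)) \<longlonglongrightarrow> c"
  shows "nat_integral \<kappa> (dirac p g \<ominus>\<^bsub>\<Lambda>\<^esub> dirac p 1) = c - 1"
proof (rule nat_integral_eqI)
  have dirac: "(\<Sum>a\<in>U m. \<kappa> a * dirac p h m a) = \<kappa> (padic_residue p m h)" if h: "h \<in> padic_units" for h :: 'c and m
  proof -
    have "padic_residue p m h \<in> U m"
      using padic_unitD[OF h] padic_residue(1) by (simp add: unit_residues_def)
    moreover have "(\<Sum>a\<in>U m. \<kappa> a * dirac p h m a) = (\<Sum>a\<in>U m. if a = padic_residue p m h then \<kappa> a else 0)"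
      by (intro sum.cong refl) (simp add: dirac_def)
    ultimately show ?thesis by simp
  qed
  \<comment> \<open>At m = 0 the residue of 1 is 0, so the limit is taken from m = 1 on.\<close>
  have "(\<lambda>m. \<kappa> (1 mod p ^ m)) \<longlonglongrightarrow> 1"
  proof (rule LIMSEQ_offset[of _ 1])
    have "1 mod p ^ (m + 1) = 1" for m using p_gt_1 by (simp add: one_less_mult)
    then show "(\<lambda>m. \<kappa> (1 mod p ^ (m + 1))) \<longlonglongrightarrow> 1" using assms(3) by simp
  qed
  from tendsto_padic_add[OF lim tendsto_padic_cmult[OF this, of "-1"]]
  have "(\<lambda>m. \<kappa> (padic_residue p m g) - \<kappa> (1 mod p ^ m)) \<longlonglongrightarrow> c - 1" by simp
  moreover have "(\<Sum>a\<in>U m. \<kappa> a * (dirac p g \<ominus>\<^bsub>\<Lambda>\<^esub> dirac p 1) m a) =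
      \<kappa> (padic_residue p m g) - \<kappa> (1 mod p ^ m)" for m
    using dirac[OF g, of m] dirac[OF one_in_padic_units, of m]
    by (simp only: diff_apply[OF dirac_in_carrier[OF g] dirac_in_carrier[OF one_in_padic_units]]
      right_diff_distrib sum_subtractf padic_residue_1)
  ultimately show "(\<lambda>m. \<Sum>a\<in>U m. \<kappa> a * (dirac p g \<ominus>\<^bsub>\<Lambda>\<^esub> dirac p 1) m a) \<longlonglongrightarrow> c - 1"
    by simp
qed

end

section \<open>Integrals of twisted powers against pseudo-measures\<close>

text \<open>Instantiated both by the p-adic image of chi and by the constant 1, whose twists are the
  powers x^k of the interpolation property.\<close>

locale finite_level_character = iwasawa p ty L
  for p :: nat and ty :: "'c::{alg_closed_field, field_char_0, complete_space} itself" and L +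
  fixes n :: nat and \<psi> :: "nat \<Rightarrow> 'c"
  assumes \<psi>_mult: "\<psi> (a * b) = \<psi> a * \<psi> b" and \<psi>_1: "\<psi> 1 = 1"
    and \<psi>_mod: "\<psi> (a mod p ^ n) = \<psi> a" and vabs_\<psi>_le_1: "vabs (\<psi> a) \<le> 1"
begin

definition twist :: "nat \<Rightarrow> 'c \<Rightarrow> 'c" where
  "twist k x = \<psi> (padic_residue p n x) * x ^ k"

lemma twist_of_nat: "twist k (of_nat a) = \<psi> a * of_nat a ^ k"
  by (simp add: twist_def padic_residue_of_nat \<psi>_mod)

lemma vabs_of_nat_power_le_1: "vabs (of_nat a ^ k) \<le> 1"
  by (simp add: vabs_power power_le_one vabs_of_nat_le_1)

lemma p_uniform_twist: "p_uniform (\<lambda>a. \<psi> a * of_nat a ^ k)"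
  by (intro p_uniform_mult p_uniform_periodic[of _ n] p_uniform_power \<psi>_mod vabs_\<psi>_le_1 vabs_of_nat_power_le_1)

lemma nat_integral_twist_dirac_diff:
  assumes g: "g \<in> padic_units"
  shows "nat_integral (\<lambda>a. \<psi> a * of_nat a ^ k) (dirac p g \<ominus>\<^bsub>\<Lambda>\<^esub> dirac p 1) = twist k g - 1"
proof (rule nat_integral_dirac_diff[OF p_uniform_twist g])
  show "\<psi> 1 * of_nat 1 ^ k = 1" by (simp only: \<psi>_1) simp
  have gi: "g \<in> padic_integers" using g by (rule padic_unitD)
  have "(\<lambda>m. of_nat (padic_residue p m g) ^ k) \<longlonglongrightarrow> g ^ k"
  proof (rule tendsto_vabsI[OF _ inverse_p_power_tendsto])
    fix m
    have "vabs (of_nat (padic_residue p m g) ^ k - g ^ k) \<le> vabs (of_nat (padic_residue p m g) - g)"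
      by (intro vabs_power_diff_le vabs_of_nat_le_1 vabs_padic_integer_le_1 gi)
    then show "vabs (of_nat (padic_residue p m g) ^ k - g ^ k) \<le> (1 / real p) ^ m"
      using padic_residue(2)[OF gi, of m] vabs_minus_commute[of g] by simp
  qed
  from tendsto_padic_cmult[OF this]
  have "(\<lambda>m. \<psi> (padic_residue p n g) * of_nat (padic_residue p m g) ^ k) \<longlonglongrightarrow> twist k g"
    by (simp add: twist_def)
  \<comment> \<open>From level n on, the residues of \<open>g\<close> all have the same image under
    \<psi>.\<close>
  moreover have "\<psi> (padic_residue p n g) * of_nat (padic_residue p m g) ^ k =
      \<psi> (padic_residue p m g) * of_nat (padic_residue p m g) ^ k" if "n \<le> m" for m
    unfolding padic_residue_mod[OF gi that, symmetric] \<psi>_mod ..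
  then have "\<forall>\<^sub>F m in sequentially. \<psi> (padic_residue p n g) * of_nat (padic_residue p m g) ^ k =
      \<psi> (padic_residue p m g) * of_nat (padic_residue p m g) ^ k"
    by (rule eventually_sequentiallyI)
  ultimately show "(\<lambda>m. \<psi> (padic_residue p m g) * of_nat (padic_residue p m g) ^ k) \<longlonglongrightarrow> twist k g"
    by (rule Lim_transform_eventually)
qed

text \<open>Resolves the description in \<open>pseudo_measure_integral\<close>: for points g and h,
  \<open>to_fractions_mult_cross\<close> gives ([g] - [1]) \<mu> = ([h] - [1]) \<nu>, and
  integrating both sides multiplicatively makes the two quotients agree.\<close>

lemma pseudo_measure_integral_twist:
  assumes \<zeta>: "\<zeta> \<in> carrier (total_fractions \<Lambda>)" and g: "g \<in> padic_units" and "twist k g \<noteq> 1"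
    and \<nu>: "\<nu> \<in> carrier \<Lambda>" and \<nu>_eq: "dirac_diff_mult p L g \<zeta> = to_fractions \<Lambda> \<nu>"
  shows "pseudo_measure_integral p L (twist k) \<zeta> =
    inverse (twist k g - 1) * nat_integral (\<lambda>a. \<psi> a * of_nat a ^ k) \<nu>"
proof -
  interpret cring \<Lambda> by (rule cring_iwasawa_algebra)
  let ?\<kappa> = "\<lambda>a. \<psi> a * of_nat a ^ k"
  let ?d = "\<lambda>h. dirac p h \<ominus>\<^bsub>\<Lambda>\<^esub> dirac p 1"
  have d: "?d h \<in> carrier \<Lambda>" if "h \<in> padic_units" for h
    by (intro minus_closed dirac_in_carrier one_in_padic_units that)
  have int: "measure_integral p (twist k) \<mu> = nat_integral ?\<kappa> \<mu>" for \<mu>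
    by (simp add: measure_integral_def nat_integral_def twist_of_nat)
  have mult: "nat_integral ?\<kappa> (?d h \<otimes>\<^bsub>\<Lambda>\<^esub> \<mu>) = (twist k h - 1) * nat_integral ?\<kappa> \<mu>"
    if "h \<in> padic_units" "\<mu> \<in> carrier \<Lambda>" for h \<mu>
  proof -
    have "nat_integral ?\<kappa> (?d h \<otimes>\<^bsub>\<Lambda>\<^esub> \<mu>) = nat_integral ?\<kappa> (?d h) * nat_integral ?\<kappa> \<mu>"
      by (rule nat_integral_mult[OF p_uniform_twist _ _ d[OF that(1)] that(2)])
        (simp_all add: \<psi>_mult power_mult_distrib vabs_mult_le_1 vabs_\<psi>_le_1 vabs_of_nat_power_le_1)
    then show ?thesis by (simp only: nat_integral_twist_dirac_diff[OF that(1)])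
  qed
  show ?thesis
    unfolding pseudo_measure_integral_def
  proof (rule the_equality)
    show "\<exists>h\<in>padic_units. twist k h \<noteq> 1 \<and> (\<exists>\<mu>\<in>carrier \<Lambda>. dirac_diff_mult p L h \<zeta> = to_fractions \<Lambda> \<mu> \<and>
        inverse (twist k g - 1) * nat_integral ?\<kappa> \<nu> = inverse (twist k h - 1) * measure_integral p (twist k) \<mu>)"
      unfolding int by (intro bexI[OF _ g] bexI[OF _ \<nu>] conjI assms(3) \<nu>_eq refl)
  next
    fix z
    assume "\<exists>h\<in>padic_units. twist k h \<noteq> 1 \<and> (\<exists>\<mu>\<in>carrier \<Lambda>. dirac_diff_mult p L h \<zeta> = to_fractions \<Lambda> \<mu> \<and>
        z = inverse (twist k h - 1) * measure_integral p (twist k) \<mu>)"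
    then obtain h \<mu> where h: "h \<in> padic_units" "twist k h \<noteq> 1" and \<mu>: "\<mu> \<in> carrier \<Lambda>"
      and \<mu>_eq: "dirac_diff_mult p L h \<zeta> = to_fractions \<Lambda> \<mu>"
      and z: "z = inverse (twist k h - 1) * nat_integral ?\<kappa> \<mu>"
      unfolding int by blast
    have "?d g \<otimes>\<^bsub>\<Lambda>\<^esub> \<mu> = ?d h \<otimes>\<^bsub>\<Lambda>\<^esub> \<nu>"
      using \<nu>_eq \<mu>_eq unfolding dirac_diff_mult_def Let_def
      by (rule to_fractions_mult_cross[OF \<zeta> d[OF g] d[OF h(1)] \<nu> \<mu>])
    moreover have cancel: "inverse H * x = inverse G * y" if "G * x = H * y" "G \<noteq> 0" "H \<noteq> 0" for G H x y :: 'c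
      using that by (simp add: field_simps)
    ultimately have "(twist k g - 1) * nat_integral ?\<kappa> \<mu> = (twist k h - 1) * nat_integral ?\<kappa> \<nu>"
      using mult[OF g \<mu>] mult[OF h(1) \<nu>] by simp
    then show "z = inverse (twist k g - 1) * nat_integral ?\<kappa> \<nu>"
      unfolding z using h(2) \<open>twist k g \<noteq> 1\<close> by (intro cancel) auto
  qed
qed

text \<open>
  Both the integral and the Euler sum are bounded functionals of the locally constant factor \<open>\<psi>\<close>,
  which is a uniform limit of polynomials.
\<close>

lemma nat_integral_twist_eq_euler_sum:
  assumes "odd p" and \<psi>_0: "\<And>a. p dvd a \<Longrightarrow> \<psi> a = 0" and g: "\<not> p dvd g"
    and \<nu>: "\<nu> \<in> carrier \<Lambda>" and "k > 0"
    and moments: "\<And>i J. J > Suc i \<Longrightarrow> nat_integral (\<lambda>a. of_nat a ^ Suc i) \<nu> =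
      - euler_sum q g J (\<lambda>m. smoothing g (Suc m) * ((if p dvd Suc m then 0 else 1) * of_nat (Suc m) ^ i))"
    and sum: "\<And>J. J > k \<Longrightarrow>
      euler_sum q g J (\<lambda>m. smoothing g (Suc m) * (\<psi> (Suc m) * of_nat (Suc m) ^ (k - 1))) = c"
  shows "nat_integral (\<lambda>a. \<psi> a * of_nat a ^ k) \<nu> = - c"
proof -
  have "vabs (nat_integral (\<lambda>a. \<psi> a * of_nat a ^ k) \<nu> + c) \<le> e" if e: "e > 0" for e
  proof -
    have per: "\<psi> (a + p ^ n) = \<psi> a" for a
      by (metis \<psi>_mod mod_add_self2)
    obtain P where P: "\<And>x. vabs (\<psi> x - poly P (of_nat x)) \<le> e"
      using periodic_poly_approx[of \<psi> n e, OF \<open>odd p\<close> per vabs_\<psi>_le_1 e] by blast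
    \<comment> \<open>\<open>Q\<close> approximates \<psi>(a) a^(k-1), one power below the
      integrand, because the moment of exponent i + 1 is an Euler sum of exponent i.\<close>
    define Q where "Q = P * Polynomial.monom 1 (k - 1)"
    define d where "d = Polynomial.degree Q"
    \<comment> \<open>Exceeds \<open>k\<close> and every i + 1 with i at most \<open>d\<close>, so
      that one Euler functional serves all monomials.\<close>
    define J where "J = d + k + 2"
    have Q: "poly Q x = (\<Sum>i\<le>d. Polynomial.coeff Q i * x ^ i)" for x
      by (simp add: poly_altdef d_def)
    define D where "D = (\<lambda>a. \<psi> a * of_nat a ^ (k - 1) - poly Q (of_nat a))"
    have D_le: "vabs (D a) \<le> e" for a
    proof -
      have "D a = of_nat a ^ (k - 1) * (\<psi> a - poly P (of_nat a))"
        by (simp add: D_def Q_def poly_monom algebra_simps)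
      then show ?thesis using vabs_mult_le_1[OF vabs_of_nat_power_le_1 P] by simp
    qed
    \<comment> \<open>\<psi> vanishes on the multiples of \<open>p\<close> but its polynomial
      approximation need not; this factor cuts it down to the numbers prime to \<open>p\<close>, as
      in the moments.\<close>
    let ?t = "\<lambda>m. if p dvd Suc m then 0 else (1 :: 'c)"
    let ?T = "\<lambda>h. euler_sum q g J (\<lambda>m. smoothing g (Suc m) * h m)"
    let ?R = "\<lambda>a. \<Sum>i\<le>d. Polynomial.coeff Q i * of_nat a ^ Suc i"
    have uni: "p_uniform ?R" by (intro p_uniform_sum p_uniform_cmult p_uniform_power)
    have twist: "\<psi> a * of_nat a ^ k = of_nat a * D a + ?R a" for a
    proof -
      have "?R a = of_nat a * poly Q (of_nat a)" by (simp add: Q sum_distrib_left mult_ac)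
      moreover have "(of_nat a :: 'c) ^ k = of_nat a * of_nat a ^ (k - 1)"
        using \<open>k > 0\<close> by (cases k) auto
      ultimately show ?thesis by (simp add: D_def algebra_simps)
    qed
    have "(\<lambda>a. of_nat a * D a) = (\<lambda>a. \<psi> a * of_nat a ^ k + (-1) * ?R a)"
      unfolding twist by simp
    then have uniD: "p_uniform (\<lambda>a. of_nat a * D a)"
      by (simp only: p_uniform_add p_uniform_twist p_uniform_cmult uni)
    have "nat_integral (\<lambda>a. \<psi> a * of_nat a ^ k) \<nu> = nat_integral (\<lambda>a. of_nat a * D a) \<nu> + nat_integral ?R \<nu>"
      unfolding twist by (rule nat_integral_add[OF uniD uni \<nu>])
    moreover have "nat_integral ?R \<nu> = (\<Sum>i\<le>d. Polynomial.coeff Q i * nat_integral (\<lambda>a. of_nat a ^ Suc i) \<nu>)"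
      by (subst nat_integral_sum) (simp_all only: nat_integral_cmult p_uniform_cmult p_uniform_power \<nu> finite_atMost)
    moreover have "\<dots> = - (\<Sum>i\<le>d. Polynomial.coeff Q i * ?T (\<lambda>m. ?t m * of_nat (Suc m) ^ i))"
      unfolding sum_negf[symmetric]
    proof (intro sum.cong refl)
      fix i assume "i \<in> {..d}"
      then have "J > Suc i" by (simp add: J_def)
      then show "Polynomial.coeff Q i * nat_integral (\<lambda>a. of_nat a ^ Suc i) \<nu> = - (Polynomial.coeff Q i * ?T (\<lambda>m. ?t m * of_nat (Suc m) ^ i))"
        by (simp only: moments) simp
    qed
    moreover have "c = ?T (\<lambda>m. ?t m * D (Suc m)) + (\<Sum>i\<le>d. Polynomial.coeff Q i * ?T (\<lambda>m. ?t m * of_nat (Suc m) ^ i))"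
    proof -
      have eq: "smoothing g (Suc m) * (\<psi> (Suc m) * of_nat (Suc m) ^ (k - 1)) =
          smoothing g (Suc m) * (?t m * D (Suc m)) +
          (\<Sum>i\<le>d. Polynomial.coeff Q i * (smoothing g (Suc m) * (?t m * of_nat (Suc m) ^ i)))" for m
      proof -
        have "(\<Sum>i\<le>d. Polynomial.coeff Q i * (smoothing g (Suc m) * (?t m * of_nat (Suc m) ^ i))) =
            smoothing g (Suc m) * ?t m * poly Q (of_nat (Suc m))"
          unfolding Q sum_distrib_left by (intro sum.cong refl) (simp only: mult_ac)
        then show ?thesis using \<psi>_0[of "Suc m"] by (simp add: D_def algebra_simps del: of_nat_Suc)
      qed
      have "c = euler_sum q g J (\<lambda>m. smoothing g (Suc m) * (\<psi> (Suc m) * of_nat (Suc m) ^ (k - 1)))"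
        by (rule sum[symmetric]) (simp add: J_def)
      then show ?thesis unfolding eq euler_sum_add by (simp only: euler_sum_sum finite_atMost euler_sum_cmult)
    qed
    \<comment> \<open>The monomial parts of the integral and of \<open>c\<close> cancel; what
      remains depends linearly on the error \<open>D\<close>.\<close>
    ultimately have "nat_integral (\<lambda>a. \<psi> a * of_nat a ^ k) \<nu> + c =
        nat_integral (\<lambda>a. of_nat a * D a) \<nu> + ?T (\<lambda>m. ?t m * D (Suc m))"
      by simp
    also have "vabs \<dots> \<le> e"
    proof (rule vabs_add_le)
      show "vabs (nat_integral (\<lambda>a. of_nat a * D a) \<nu>) \<le> e"
        by (intro vabs_nat_integral_le[OF uniD \<nu>] vabs_mult_le_1 vabs_of_nat_le_1 D_le)
      show "vabs (?T (\<lambda>m. ?t m * D (Suc m))) \<le> e"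
        using vabs_of_nat_eq_1[OF g]
        by (intro vabs_euler_sum_le vabs_mult_le_1 vabs_smoothing_le_1 D_le) auto
    qed
    finally show ?thesis .
  qed
  then have "vabs (nat_integral (\<lambda>a. \<psi> a * of_nat a ^ k) \<nu> + c) \<le> 0"
    by (rule field_le_epsilon) simp
  then have "vabs (nat_integral (\<lambda>a. \<psi> a * of_nat a ^ k) \<nu> + c) = 0"
    by (rule order_antisym[OF _ vabs_nonneg])
  then have "nat_integral (\<lambda>a. \<psi> a * of_nat a ^ k) \<nu> + c = 0"
    by (simp only: vabs_eq_0_iff)
  then show ?thesis by (simp add: eq_neg_iff_add_eq_0)
qed

end

section \<open>Values at non-positive integers\<close>

lemma periodic_multiplicative_dirichlet_character:
  assumes "dirichlet_character q chi" "g > 1" "coprime g q"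
  shows "periodic_multiplicative q g chi"
  using assms norm_dirichlet_character_le_1[OF assms(1)]
  by unfold_locales (auto simp: dirichlet_character_def)

text \<open>The indicator already has period p; it is given period p^n in order to be summed with
  the same stride as chi, so that one functional serves both.\<close>

lemma periodic_multiplicative_prime_indicator:
  assumes "Factorial_Ring.prime (p :: nat)" "n > 0" "g > 1" "coprime g (p ^ n)"
  shows "periodic_multiplicative (p ^ n) g (\<lambda>a. if p dvd a then 0 else 1)"
proof
  have "p dvd p ^ n" using assms(2) by simp
  then have "p dvd a + p ^ n \<longleftrightarrow> p dvd a" for a by (simp add: dvd_add_left_iff)
  then show "(if p dvd a + p ^ n then 0 else 1) = (if p dvd a then 0 else (1 :: complex))" for a by simp
qed (use assms prime_gt_0_nat[OF assms(1)] prime_dvd_mult_iff[OF assms(1)] in auto)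

lemma dirichlet_L_nonpos_int_euler_sum:
  assumes chi: "dirichlet_character q chi" and "g > 1" "[g = 1] (mod q)" and "0 < k" "k < J"
  shows "dirichlet_L chi (1 - of_nat k) =
    euler_sum q g J (\<lambda>m. smoothing g (Suc m) * (chi (Suc m) * of_nat (Suc m) ^ (k - 1))) / (1 - of_nat g ^ k)"
proof -
  have "coprime g q" using assms(3) by (metis cong_imp_coprime cong_sym coprime_1_left)
  then interpret periodic_multiplicative q g chi
    using assms by (intro periodic_multiplicative_dirichlet_character)
  have "chi g = chi (1 mod q)"
    using assms(3) dirichlet_character_mod[OF chi, of g] by (simp add: cong_def)
  then have "chi g = 1"
    by (simp only: dirichlet_character_mod[OF chi] dirichlet_character_1[OF chi])
  from dirichlet_L_nonpos_int[OF this \<open>0 < k\<close>] show ?thesis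
    by (simp only: smooth_L_nonpos_int[OF assms(4,5)] mult.assoc)
qed

text \<open>At s = 1 - k the Euler factor 1 - p^(-s) becomes 1 - p^(k-1), the factor in the
  interpolation property.\<close>

lemma zeta_remove_prime_euler_sum:
  assumes p: "Factorial_Ring.prime (p :: nat)" and "n > 0" and g: "g > 1" "coprime g (p ^ n)" and "0 < k" "k < J"
  shows "(1 - of_nat p ^ (k - 1)) * riemann_zeta (1 - of_nat k) =
    euler_sum (p ^ n) g J (\<lambda>m. smoothing g (Suc m) *
      ((if p dvd Suc m then 0 else 1) * of_nat (Suc m) ^ (k - 1))) / (1 - of_nat g ^ k)"
proof -
  note triv = periodic_multiplicative_prime_indicator[OF p \<open>n > 0\<close> g]
  interpret Z: periodic_multiplicative 1 g "\<lambda>_. 1" using g by unfold_locales auto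
  interpret T: periodic_multiplicative "p ^ n" g "\<lambda>a. if p dvd a then 0 else 1" by (rule triv)
  have "\<not> p dvd g"
    using g(2) \<open>n > 0\<close> p by (metis coprime_common_divisor dvd_power not_prime_unit)
  have "of_nat p powr (- (1 - of_nat k)) = (of_nat p powr of_nat (k - 1) :: complex)"
    using \<open>0 < k\<close> by (simp add: of_nat_diff)
  also have "\<dots> = of_nat p ^ (k - 1)"
    using prime_gt_0_nat[OF p] by (simp add: powr_nat')
  finally have "(1 - of_nat p ^ (k - 1)) * Z.smooth_L (1 - of_nat k) = T.smooth_L (1 - of_nat k)"
    using smooth_L_remove_prime[OF Z.periodic_multiplicative_axioms triv prime_gt_0_nat[OF p] \<open>\<not> p dvd g\<close>] by simp
  moreover have "riemann_zeta (1 - of_nat k) = Z.smooth_L (1 - of_nat k) / (1 - of_nat g ^ k)"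
    unfolding riemann_zeta_def using Z.dirichlet_L_nonpos_int[OF refl \<open>0 < k\<close>] .
  ultimately have "(1 - of_nat p ^ (k - 1)) * riemann_zeta (1 - of_nat k) = T.smooth_L (1 - of_nat k) / (1 - of_nat g ^ k)"
    by simp
  then show ?thesis by (simp only: T.smooth_L_nonpos_int[OF assms(5,6)] mult.assoc)
qed

theorem theorem5p1:
  fixes p n :: nat
    and L :: "'c::{alg_closed_field, field_char_0, complete_space} set"
    and \<iota>\<^sub>C :: "rat alg_closure \<Rightarrow> complex"
    and \<iota>\<^sub>p :: "rat alg_closure \<Rightarrow> 'c"
    and \<zeta>\<^sub>p :: "((nat \<Rightarrow> nat \<Rightarrow> 'c) \<times> (nat \<Rightarrow> nat \<Rightarrow> 'c)) set"
    and chi :: "nat \<Rightarrow> complex"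
  assumes "Factorial_Ring.prime p" and "odd p"
    and "is_complex_padic_field p TYPE('c)"
    and "finite_padic_extension L"
    and "field_embedding \<iota>\<^sub>C" and "field_embedding \<iota>\<^sub>p"
    and "is_kubota_leopoldt \<iota>\<^sub>C \<iota>\<^sub>p p L \<zeta>\<^sub>p"
    and "n \<ge> 1" and "primitive_character (p ^ n) chi"
  shows "\<forall>k::nat. k > 0 \<longrightarrow>
    pseudo_measure_integral p L (\<lambda>x. padic_character \<iota>\<^sub>C \<iota>\<^sub>p p n chi x * x ^ k) \<zeta>\<^sub>p =
    complex_to_padic \<iota>\<^sub>C \<iota>\<^sub>p (dirichlet_L chi (1 - of_nat k))"
proof (intro allI impI)
  fix k :: nat assume k: "k > 0"
  note p = assms(1) and embC = assms(5) and embp = assms(6)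
  interpret iwasawa p "TYPE('c)" L
    using assms(3,4) by unfold_locales
  have n: "n > 0" using assms(8) by simp
  define q where "q = p ^ n"
  define g where "g = 1 + q"
  let ?ctp = "complex_to_padic \<iota>\<^sub>C \<iota>\<^sub>p"
  have q: "q > 1" unfolding q_def using p_gt_1 n by (rule one_less_power)
  have g: "g > 1" "[g = 1] (mod q)" "coprime g q" "\<not> p dvd g"
  proof -
    show "g > 1" "coprime g q" using q by (simp_all add: g_def)
    show "[g = 1] (mod q)" unfolding g_def cong_def by (rule mod_add_self2)
    have "p dvd q" using n by (simp add: q_def)
    then show "\<not> p dvd g" unfolding g_def using p by (metis dvd_add_left_iff not_prime_unit)
  qed
  have g_unit: "(of_nat g :: 'c) \<in> padic_units"
    unfolding g_def q_def by (rule one_plus_p_power_in_padic_units[OF n])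
  have g_power: "(of_nat g :: 'c) ^ j \<noteq> 1" if "j > 0" for j
    using one_less_power[OF g(1) that] by (metis less_irrefl of_nat_1 of_nat_eq_iff of_nat_power)

  have chi: "dirichlet_character q chi"
    using assms(9) by (simp add: primitive_character_def q_def)
  \<comment> \<open>The values of chi are pulled back to the algebraic closure of the rationals,
    from which both embeddings start.\<close>
  define chi' where "chi' = (\<lambda>a. inv_into UNIV \<iota>\<^sub>C (chi a))"
  have chi': "\<iota>\<^sub>C (chi' a) = chi a" for a
    unfolding chi'_def using dirichlet_character_in_range[OF chi embC, of a] by (rule f_inv_into_f)
  define \<psi> where "\<psi> = (\<lambda>a. \<iota>\<^sub>p (chi' a))"
  have \<psi>: "?ctp (chi a) = \<psi> a" for a
    by (simp add: \<psi>_def chi'_def complex_to_padic_def)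
  have inj: "chi' a = x" if "chi a = \<iota>\<^sub>C x" for a x
    using that chi'[of a] field_embedding_inj[OF embC] by (simp add: inj_eq)
  interpret psi: finite_level_character p "TYPE('c)" L n \<psi>
  proof
    show "\<psi> (a * b) = \<psi> a * \<psi> b" for a b
    proof -
      have "chi (a * b) = \<iota>\<^sub>C (chi' a * chi' b)"
        using chi by (simp add: dirichlet_character_def field_embedding_mult[OF embC] chi')
      then show ?thesis by (simp add: \<psi>_def inj field_embedding_mult[OF embp])
    qed
    show "\<psi> 1 = 1"
      unfolding \<psi>_def using inj[of 1 1] dirichlet_character_1[OF chi]
      by (simp add: field_embedding_1[OF embC] field_embedding_1[OF embp])
    show "\<psi> (a mod p ^ n) = \<psi> a" for a
      using dirichlet_character_mod[OF chi, of a] by (simp add: \<psi>_def chi'_def q_def)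
    show "vabs (\<psi> a) \<le> 1" for a
    proof (cases "coprime a q")
      case True
      have "\<iota>\<^sub>C (chi' a ^ totient q) = \<iota>\<^sub>C 1"
        using dirichlet_character_power_totient[OF chi True]
        by (simp add: field_embedding_power[OF embC] chi' field_embedding_1[OF embC])
      then have "chi' a ^ totient q = 1" using field_embedding_inj[OF embC] by (simp add: inj_eq)
      then have "\<psi> a ^ totient q = 1"
        unfolding \<psi>_def by (metis field_embedding_power[OF embp] field_embedding_1[OF embp])
      then have "vabs (\<psi> a) ^ totient q = 1" by (metis vabs_power vabs_1)
      moreover have "totient q > 0" using q by simp
      ultimately show ?thesis by (metis not_le one_less_power order_less_irrefl)
    next
      case False
      then have "chi a = 0" using chi unfolding dirichlet_character_def by blast
      then have "chi' a = 0" by (intro inj) (simp add: field_embedding_0[OF embC])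
      then show ?thesis by (simp add: \<psi>_def field_embedding_0[OF embp])
    qed
  qed
  interpret triv: finite_level_character p "TYPE('c)" L n "\<lambda>_. 1"
    by unfold_locales auto
  have \<psi>_0: "\<psi> a = 0" if "p dvd a" for a
  proof -
    have "\<not> coprime a q"
      using that n p by (metis coprime_common_divisor dvd_power not_prime_unit q_def)
    then have "chi a = 0" using chi unfolding dirichlet_character_def by blast
    then have "chi' a = 0" by (intro inj) (simp add: field_embedding_0[OF embC])
    then show ?thesis by (simp add: \<psi>_def field_embedding_0[OF embp])
  qed

  \<comment> \<open>A finite expression over the algebraic closure of the rationals goes under each
    embedding to the same expression in the target field, so \<open>complex_to_padic\<close> acts on
    it termwise.\<close>
  have transport: "?ctp (euler_sum q g J (\<lambda>m. smoothing g (Suc m) * (\<iota>\<^sub>C (f (Suc m)) * of_nat (Suc m) ^ i)) / (1 - of_nat g ^ j)) =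
      euler_sum q g J (\<lambda>m. smoothing g (Suc m) * (\<iota>\<^sub>p (f (Suc m)) * of_nat (Suc m) ^ i)) / (1 - of_nat g ^ j)"
    (is "?l = ?y") for f i j J
  proof -
    define z where "z = euler_sum q g J (\<lambda>m. smoothing g (Suc m) * (f (Suc m) * of_nat (Suc m) ^ i)) / (1 - of_nat g ^ j)"
    \<comment> \<open>Stated for an arbitrary target field so that it applies to both
      embeddings.\<close>
    have z: "\<sigma> z = euler_sum q g J (\<lambda>m. smoothing g (Suc m) * (\<sigma> (f (Suc m)) * of_nat (Suc m) ^ i)) / (1 - of_nat g ^ j)"
      if \<sigma>: "field_embedding \<sigma>" for \<sigma> :: "rat alg_closure \<Rightarrow> 'd::field"
      unfolding z_def
      by (simp only: field_embedding_divide[OF \<sigma>] field_embedding_diff[OF \<sigma>] field_embedding_power[OF \<sigma>]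
          field_embedding_of_nat[OF \<sigma>] field_embedding_1[OF \<sigma>] field_embedding_mult[OF \<sigma>]
          field_embedding_smoothing[OF \<sigma>] field_embedding_euler_sum[OF \<sigma>])
    have "?l = ?ctp (\<iota>\<^sub>C z)" by (simp only: z[OF embC])
    also have "\<dots> = ?y" by (simp only: complex_to_padic_embedding[OF embC] z[OF embp])
    finally show ?thesis .
  qed

  have \<zeta>: "pseudo_measure p L \<zeta>\<^sub>p"
    and moments: "\<And>j. j > 0 \<Longrightarrow> pseudo_measure_integral p L (\<lambda>x. x ^ j) \<zeta>\<^sub>p =
      ?ctp ((1 - of_nat p ^ (j - 1)) * riemann_zeta (1 - of_nat j))"
    using assms(7) by (simp_all add: is_kubota_leopoldt_def)
  have \<zeta>_carrier: "\<zeta>\<^sub>p \<in> carrier (total_fractions \<Lambda>)"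
    using \<zeta> by (simp add: pseudo_measure_def)
  \<comment> \<open>This one measure ([g] - [1]) zeta_p serves the powers x^j and the twist by chi
    alike.\<close>
  obtain \<nu> where \<nu>: "\<nu> \<in> carrier \<Lambda>" "dirac_diff_mult p L (of_nat g) \<zeta>\<^sub>p = to_fractions \<Lambda> \<nu>"
    using \<zeta> g_unit unfolding pseudo_measure_def by blast

  have "nat_integral (\<lambda>a. of_nat a ^ Suc i) \<nu> = - euler_sum q g J (\<lambda>m. smoothing g (Suc m) *
      ((if p dvd Suc m then 0 else 1) * of_nat (Suc m) ^ i))" (is "_ = - ?E") if "J > Suc i" for i J
  proof -
    have tw: "triv.twist j = (\<lambda>x. x ^ j)" for j by (rule ext) (simp add: triv.twist_def)
    have "inverse (of_nat g ^ Suc i - 1) * nat_integral (\<lambda>a. of_nat a ^ Suc i) \<nu> =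
        pseudo_measure_integral p L (\<lambda>x. x ^ Suc i) \<zeta>\<^sub>p"
      using triv.pseudo_measure_integral_twist[OF \<zeta>_carrier g_unit _ \<nu>, of "Suc i"] g_power[of "Suc i"]
      by (simp only: tw mult_1_left) simp
    also have "\<dots> = ?ctp ((1 - of_nat p ^ (Suc i - 1)) * riemann_zeta (1 - of_nat (Suc i)))"
      by (rule moments) simp
    also have "(1 - of_nat p ^ (Suc i - 1)) * riemann_zeta (1 - of_nat (Suc i)) =
        euler_sum q g J (\<lambda>m. smoothing g (Suc m) *
        (\<iota>\<^sub>C (if p dvd Suc m then 0 else 1) * of_nat (Suc m) ^ i)) / (1 - of_nat g ^ Suc i)"
      using zeta_remove_prime_euler_sum[OF p n g(1) g(3)[unfolded q_def] _ that]
      by (simp add: if_distrib[of \<iota>\<^sub>C] field_embedding_0[OF embC] field_embedding_1[OF embC] q_def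
        del: of_nat_Suc power_Suc cong: if_cong)
    also have "?ctp \<dots> = ?E / (1 - of_nat g ^ Suc i)"
      unfolding transport[of J "\<lambda>m. if p dvd m then 0 else 1" i "Suc i"]
      by (simp add: if_distrib[of \<iota>\<^sub>p] field_embedding_0[OF embp] field_embedding_1[OF embp]
        del: of_nat_Suc power_Suc cong: if_cong)
    finally have eq: "inverse (of_nat g ^ Suc i - 1) * nat_integral (\<lambda>a. of_nat a ^ Suc i) \<nu> = ?E / (1 - of_nat g ^ Suc i)" .
    \<comment> \<open>The integral carries the factor 1/(g^j - 1) and the L-value 1/(1 - g^j); hence
      the sign in the moments.\<close>
    have "x = - y" if "inverse (G - 1) * x = y / (1 - G)" "G \<noteq> 1" for x y G :: 'c
    proof -
      have "x + y = G * x + G * y" using that by (simp add: field_simps)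
      moreover have "(G - 1) * (x + y) = (G * x + G * y) - (x + y)" by (simp add: algebra_simps)
      ultimately have "(G - 1) * (x + y) = 0" by (metis diff_self)
      then have "x + y = 0" using that(2) by simp
      then show ?thesis by (simp add: eq_neg_iff_add_eq_0)
    qed
    from this[OF eq g_power] show ?thesis by simp
  qed
  moreover have "euler_sum q g J (\<lambda>m. smoothing g (Suc m) * (\<psi> (Suc m) * of_nat (Suc m) ^ (k - 1))) =
      (1 - of_nat g ^ k) * ?ctp (dirichlet_L chi (1 - of_nat k))" if "J > k" for J
  proof -
    have "?ctp (dirichlet_L chi (1 - of_nat k)) =
        euler_sum q g J (\<lambda>m. smoothing g (Suc m) * (\<psi> (Suc m) * of_nat (Suc m) ^ (k - 1))) / (1 - of_nat g ^ k)"
      unfolding dirichlet_L_nonpos_int_euler_sum[OF chi g(1,2) k that] \<psi>_def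
      using transport[of J chi' "k - 1" k] by (simp only: chi')
    then show ?thesis using g_power[OF k] by simp
  qed
  ultimately have "nat_integral (\<lambda>a. \<psi> a * of_nat a ^ k) \<nu> =
      - ((1 - of_nat g ^ k) * ?ctp (dirichlet_L chi (1 - of_nat k)))"
    unfolding q_def
    by (intro psi.nat_integral_twist_eq_euler_sum[OF assms(2) \<psi>_0 g(4) \<nu>(1) k])
  \<comment> \<open>As \<open>g\<close> is 1 modulo p^n, \<psi>(g) = 1, so the twist has the same
    denominator as the plain power.\<close>
  moreover have tw_g: "psi.twist k (of_nat g) = of_nat g ^ k"
  proof -
    have "\<psi> g = \<psi> (1 mod p ^ n)"
      using psi.\<psi>_mod[of g] g(2) by (simp add: cong_def q_def)
    then have "\<psi> g = 1" by (simp only: psi.\<psi>_mod psi.\<psi>_1)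
    then show ?thesis by (simp add: psi.twist_of_nat)
  qed
  ultimately have "pseudo_measure_integral p L (psi.twist k) \<zeta>\<^sub>p =
      inverse (of_nat g ^ k - 1) * - ((1 - of_nat g ^ k) * ?ctp (dirichlet_L chi (1 - of_nat k)))"
    using psi.pseudo_measure_integral_twist[OF \<zeta>_carrier g_unit _ \<nu>, of k] g_power[OF k] by simp
  also have "\<dots> = ?ctp (dirichlet_L chi (1 - of_nat k))"
    using g_power[OF k] by (simp add: minus_mult_left mult.assoc[symmetric])
  also have "psi.twist k = (\<lambda>x. padic_character \<iota>\<^sub>C \<iota>\<^sub>p p n chi x * x ^ k)"
    by (simp add: fun_eq_iff psi.twist_def padic_character_def \<psi>)
  finally show "pseudo_measure_integral p L (\<lambda>x. padic_character \<iota>\<^sub>C \<iota>\<^sub>p p n chi x * x ^ k) \<zeta>\<^sub>p =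
    ?ctp (dirichlet_L chi (1 - of_nat k))" .
qed

end
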